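(* Suppose that (a) $C$ is symmetric positive definite; and (b) there exists a constant $M>0$ such that, with $W=[Y,Z,X]\in\mathbb{R}^{n\times(r+qr+p)}$ and $S_W=W^{\mathsf T}W/n$, almost surely $$M^{-1}\le\liminf_{n\to\infty}\gamma_{\min}(S_W)\le\limsup_{n\to\infty}\gamma_{\max}(S_W)\le M.$$ Then $\{K_{C,n}\}$, $\{K_{G,n}\}$ and $\{K_{\mathcal{A},n}\}$ are asymptotically geometrically ergodic almost surely.
   Context: Setting. Let $p,q,r$ be fixed positive integers. $(Y_t,X_t)$, $t=1,2,\dots$, are random elements of $\mathbb{R}^r\times\mathbb{R}^p$ on a common probability space, with arbitrary joint distribution (they need not follow the model below), and $Y_{-q+1},\dots,Y_0\in\mathbb{R}^r$ are known and non-stochastic. For each $n>p$ put $Y=[Y_1,\dots,Y_n]^{\mathsf T}\in\mathbb{R}^{n\times r}$, $X=[X_1,\dots,X_n]^{\mathsf T}\in\mathbb{R}^{n\times p}$, $Z_t=[Y_{t-1}^{\mathsf T},\dots,Y_{t-q}^{\mathsf T}]^{\mathsf T}\in\mathbb{R}^{qr}$, $Z=[Z_1,\dots,Z_n]^{\mathsf T}\in\mathbb{R}^{n\times qr}$ (dependence on $n$ suppressed). $\gamma_{\max}(\cdot)$ and $\gamma_{\min}(\cdot)$ are the largest and smallest eigenvalues. Parameters: $\mathcal{A}\in\mathbb{R}^{qr\times r}$ with $\alpha=\operatorname{vec}(\mathcal{A})\in\mathbb{R}^{qr^2}$ ($\alpha$ and $\mathcal A$ are identified), $\mathcal{B}\in\mathbb{R}^{p\times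 r}$, $\Sigma\in\mathbb{S}^r_{++}$ (the $r\times r$ symmetric positive definite matrices); $\theta=(\alpha,\mathcal{B},\Sigma)\in\Theta=\mathbb{R}^{qr^2}\times\mathbb{R}^{p\times r}\times\mathbb{S}^r_{++}$. The likelihood used is $$f(Y\mid X,\mathcal{A},\mathcal{B},\Sigma)=(2\pi)^{-nr/2}|\Sigma|^{-n/2}\exp\left(-\tfrac12\operatorname{tr}[\Sigma^{-1}(Y-Z\mathcal{A}-X\mathcal{B})^{\mathsf T}(Y-Z\mathcal{A}-X\mathcal{B})]\right).$$ The prior is $f(\theta)=f(\alpha)f(\mathcal{B})f(\Sigma)$ with $f(\alpha)\propto\exp(-\tfrac12(\alpha-m)^{\mathsf T}C(\alpha-m))$, $f(\mathcal{B})\propto1$, $f(\Sigma)\propto|\Sigma|^{-a/2}\exp(-\tfrac12\operatorname{tr}[D\Sigma^{-1}])$, with hyperparameters $m\in\mathbb{R}^{qr^2}$, $C\in\mathbb{R}^{qr^2\times qr^2}$ and $D\in\mathbb{R}^{r\times r}$ symmetric positive semi-definite, $a\ge0$, the same for every $n$. The posterior $F(\cdot\mid Y,X)$ has density proportional to likelihood times prior; $F_{\mathcal{A},\Sigma}(\cdot\mid Y,X)$ and $F_{\mathcal{A}}(\cdot\mid Y,X)$ are its marginals for $(\alpha,\Sigma)$ and $\alpha$. Conditional densities $f(\Sigma\mid\alpha,Y,X)$, $f(\alpha\mid\Sigma,Y,X)$, $f(\mathcal{B}\mid\alpha,\Sigma,Y,X)$ are those derived from the posterior (unlisted parameters integrated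 out). Kernels based on the first $n$ observations, for measurable $A$: $K_{C,n}(\theta',A)=\iiint I_A(\alpha,\mathcal{B},\Sigma)f(\Sigma\mid\alpha',Y,X)f(\alpha\mid\Sigma,Y,X)f(\mathcal{B}\mid\alpha,\Sigma,Y,X)\,d\Sigma\,d\alpha\,d\mathcal{B}$ on $\Theta$; $K_{G,n}((\alpha',\Sigma'),A)=\iint I_A(\alpha,\Sigma)f(\alpha\mid\Sigma,Y,X)f(\Sigma\mid\alpha',Y,X)\,d\alpha\,d\Sigma$ on $\mathbb{R}^{qr^2}\times\mathbb{S}^r_{++}$; $K_{\mathcal{A},n}(\alpha',A)=\iint I_A(\alpha)f(\alpha\mid\Sigma,Y,X)f(\Sigma\mid\alpha',Y,X)\,d\Sigma\,d\alpha$ on $\mathbb{R}^{qr^2}$; with invariant distributions $F$, $F_{\mathcal{A},\Sigma}$, $F_{\mathcal{A}}$ (given $Y,X$), respectively. For a kernel $K$ on $\mathsf{S}$ with invariant distribution $\pi$, the geometric convergence rate $\rho^\star$ is the infimum of the $\rho\in[0,1]$ for which there is $M:\mathsf{S}\to[0,\infty)$ with $\|K^h(x,\cdot)-\pi\|_{TV}\le M(x)\rho^h$ for all $x\in\mathsf{S}$, $h\in\{1,2,\dots\}$ ($\|\cdot\|_{TV}$ is the total variation norm). Let $\rho_n^\star$ be the (data-dependent) rate of the $n$-th kernel $K_n$ of a sequence, with the convention $\rho^\star_n=1$ if, for the given $n$ and data, the posterior is not proper. The sequence $\{K_n\}$ is asymptotically geometrically ergodic almost surely if there exist random variables $\bar\rho_n$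 with $\rho_n^\star\le\bar\rho_n$ for every $n$ and $\limsup_{n\to\infty}\bar\rho_n<1$ almost surely. (Possible non-measurability of $\rho_n^\star$ is ignored.) *)

theory Defs
  imports "HOL-Probability.Probability" "HOL-Library.Uprod"
begin

section \<open>Linear algebra\<close>

definition sym_pos_semidef :: "real^'k^'k \<Rightarrow> bool" where
  "sym_pos_semidef A \<longleftrightarrow> transpose A = A \<and> (\<forall>x. 0 \<le> x \<bullet> (A *v x))"

definition sym_pos_def :: "real^'k^'k \<Rightarrow> bool" where
  "sym_pos_def A \<longleftrightarrow> transpose A = A \<and> (\<forall>x. x \<noteq> 0 \<longrightarrow> 0 < x \<bullet> (A *v x))"

definition eigenvalues :: "real^'k^'k \<Rightarrow> real set" where
  "eigenvalues A = {c. \<exists>v. v \<noteq> 0 \<and> A *v v = c *\<^sub>R v}"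

text \<open>Only used for symmetric matrices, whose set of eigenvalues is finite and nonempty.\<close>

definition gamma_max :: "real^'k^'k \<Rightarrow> real" where
  "gamma_max A = Max (eigenvalues A)"

definition gamma_min :: "real^'k^'k \<Rightarrow> real" where
  "gamma_min A = Min (eigenvalues A)"

text \<open>
  An $n \times k$ matrix whose number of rows $n$ varies is represented by its rows
  $w_1, \dots, w_n$, given as a function of the time index. Then
  \<open>gram n w\<close> is the $k \times k$ matrix $W^T W$.
\<close>

definition gram :: "nat \<Rightarrow> (int \<Rightarrow> real^'k) \<Rightarrow> real^'k^'k" where
  "gram n w = (\<chi> i j. \<Sum>t=1..int n. w t $ i * w t $ j)"

section \<open>Lebesgue measure on symmetric positive definite matrices\<close>

instance uprod :: (finite) finite
proof
  have "(UNIV :: 'a uprod set) = (\<lambda>(a, b). Upair a b) ` UNIV"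
    by (auto simp: image_iff) (metis uprod_exhaust)
  then show "finite (UNIV :: 'a uprod set)"
    by (metis finite finite_imageI)
qed

text \<open>
  A symmetric matrix is determined by its $r(r+1)/2$ distinct entries, which are indexed by
  unordered pairs (with repetition). The reference measure $d\Sigma$ is Lebesgue measure
  in these entries, restricted to the positive definite matrices.
\<close>

definition sym_of_entries :: "real^('r uprod) \<Rightarrow> real^'r^'r" where
  "sym_of_entries v = (\<chi> i j. v $ Upair i j)"

definition spd_lborel :: "(real^'r^'r) measure" where
  "spd_lborel = restrict_space (distr lborel borel sym_of_entries) {S. sym_pos_def S}"

section \<open>Markov kernels and their geometric convergence rate\<close>

primrec kernel_pow :: "('s \<Rightarrow> 's measure) \<Rightarrow> nat \<Rightarrow> 's \<Rightarrow> 's measure" where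
  "kernel_pow K 0 x = return (K x) x"
| "kernel_pow K (Suc h) x = bind (kernel_pow K h x) K"

text \<open>
  Total variation norm of the difference of two finite measures, normalised as
  $\sup_A |\mu(A) - \nu(A)|$. The other usual normalisation is twice this for probability
  measures; the rate below is the same for both.
\<close>

definition tv_dist :: "'s measure \<Rightarrow> 's measure \<Rightarrow> real" where
  "tv_dist \<mu> \<nu> = (SUP A\<in>sets \<nu>. \<bar>measure \<mu> A - measure \<nu> A\<bar>)"

definition geom_rate :: "('s \<Rightarrow> 's measure) \<Rightarrow> 's measure \<Rightarrow> real" where
  "geom_rate K \<pi> = Inf {\<rho> \<in> {0..1}. \<exists>M :: 's \<Rightarrow> real. \<forall>x\<in>space \<pi>. 0 \<le> M x \<and>
     (\<forall>h\<ge>1. tv_dist (kernel_pow K h x) \<pi> \<le> M x * \<rho> ^ h)}"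

text \<open>
  \<open>K n \<omega>\<close> is the \<open>n\<close>-th kernel for the data at \<open>\<omega>\<close>, \<open>\<pi> n \<omega>\<close> its invariant
  distribution, \<open>proper n \<omega>\<close> says that the posterior is proper (the rate is 1 if it is not),
  and the sequence consists of the kernels with \<open>n > n0\<close>.
\<close>

definition asymp_geom_ergodic_as ::
  "'w measure \<Rightarrow> nat \<Rightarrow> (nat \<Rightarrow> 'w \<Rightarrow> bool) \<Rightarrow> (nat \<Rightarrow> 'w \<Rightarrow> 's \<Rightarrow> 's measure) \<Rightarrow>
     (nat \<Rightarrow> 'w \<Rightarrow> 's measure) \<Rightarrow> bool" where
  "asymp_geom_ergodic_as P n0 proper K \<pi> \<longleftrightarrow>
     (\<exists>\<rho> :: nat \<Rightarrow> 'w \<Rightarrow> real.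
        (\<forall>n. \<rho> n \<in> borel_measurable P) \<and>
        (\<forall>n>n0. \<forall>\<omega>\<in>space P.
           (if proper n \<omega> then geom_rate (K n \<omega>) (\<pi> n \<omega>) else 1) \<le> \<rho> n \<omega>) \<and>
        (AE \<omega> in P. limsup (\<lambda>n. ereal (\<rho> n \<omega>)) < 1))"

section \<open>The Bayesian vector autoregression with predictors\<close>

text \<open>
  The dimensions $p$, $q$, $r$ are the cardinalities of the index types \<open>'p\<close>, \<open>'q\<close>, \<open>'r\<close>.
  The order on \<open>'q\<close> enumerates the lags $1, \dots, q$.
\<close>

definition lag :: "'q::{finite,linorder} \<Rightarrow> nat" where
  "lag l = card {..l}"

lemma bij_betw_lag: "bij_betw (lag :: 'q::{finite,linorder} \<Rightarrow> nat) UNIV {1..CARD('q)}"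
proof -
  have "strict_mono (lag :: 'q \<Rightarrow> nat)"
    unfolding lag_def by (intro strict_monoI psubset_card_mono) auto
  then have inj: "inj (lag :: 'q \<Rightarrow> nat)"
    by (rule strict_mono_imp_inj_on)
  have "lag ` (UNIV :: 'q set) \<subseteq> {1..CARD('q)}"
    by (auto simp: lag_def card_mono Suc_le_eq card_gt_0_iff)
  moreover have "card (lag ` (UNIV :: 'q set)) = card {1..CARD('q)}"
    using inj by (simp add: card_image)
  ultimately show ?thesis
    using inj by (metis bij_betw_def card_subset_eq finite_atLeastAtMost)
qed

definition lags :: "(int \<Rightarrow> real^'r) \<Rightarrow> int \<Rightarrow> real^('q::{finite,linorder} \<times> 'r)" where
  "lags y t = (\<chi> lj. y (t - int (lag (fst lj))) $ snd lj)"

text \<open>The rows of $W = [Y, Z, X]$.\<close>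

definition data_row :: "(int \<Rightarrow> real^'r) \<Rightarrow> (int \<Rightarrow> real^'p) \<Rightarrow> int
    \<Rightarrow> real^('r + ('q::{finite,linorder} \<times> 'r) + 'p)" where
  "data_row y x t = (\<chi> s. case s of
      Inl i \<Rightarrow> y t $ i
    | Inr (Inl k) \<Rightarrow> (lags y t :: real^('q \<times> 'r)) $ k
    | Inr (Inr i) \<Rightarrow> x t $ i)"

definition S_W :: "nat \<Rightarrow> (int \<Rightarrow> real^'r) \<Rightarrow> (int \<Rightarrow> real^'p)
    \<Rightarrow> real^('r + ('q::{finite,linorder} \<times> 'r) + 'p)^('r + ('q \<times> 'r) + 'p)" where
  "S_W n y x = (1 / real n) *\<^sub>R gram n (data_row y x)"

text \<open>
  $\alpha = \mathrm{vec}(\mathcal{A})$ stacks the columns of $\mathcal{A}$; its index is a pair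
  (column of $\mathcal{A}$, row of $\mathcal{A}$).
\<close>

definition unvec :: "real^('c \<times> 'k) \<Rightarrow> real^'c^'k" where
  "unvec \<alpha> = (\<chi> k c. \<alpha> $ (c, k))"

text \<open>
  Hyperparameters \<open>m C D a\<close>, sample size \<open>n\<close> and a realised data path \<open>y x\<close>. The values of
  \<open>y\<close> at the times $-q+1, \dots, 0$ are the initial values.
\<close>

context
  fixes m :: "real^('r::finite \<times> ('q::{finite,linorder} \<times> 'r))"
    and C :: "real^('r \<times> ('q \<times> 'r))^('r \<times> ('q \<times> 'r))"
    and D :: "real^'r^'r"
    and a :: real
    and n :: nat
    and y :: "int \<Rightarrow> real^'r"
    and x :: "int \<Rightarrow> real^('p::finite)"
begin

text \<open>The rows of $Y - Z\mathcal{A} - X\mathcal{B}$.\<close>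

definition residual :: "real^('r \<times> ('q \<times> 'r)) \<Rightarrow> real^'r^'p \<Rightarrow> int \<Rightarrow> real^'r" where
  "residual \<alpha> B t = y t - lags y t v* unvec \<alpha> - x t v* B"

definition likelihood ::
    "real^('r \<times> ('q \<times> 'r)) \<Rightarrow> real^'r^'p \<Rightarrow> real^'r^'r \<Rightarrow> real" where
  "likelihood \<alpha> B \<Sigma> =
     (2 * pi) powr (- (real n * real CARD('r) / 2)) * det \<Sigma> powr (- (real n / 2)) *
     exp (- (1/2) * trace (matrix_inv \<Sigma> ** gram n (residual \<alpha> B)))"

text \<open>
  The prior up to a constant factor, which cancels in the posterior; the factor for
  $\mathcal{B}$ is 1.
\<close>

definition prior :: "real^('r \<times> ('q \<times> 'r)) \<Rightarrow> real^'r^'r \<Rightarrow> real" where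
  "prior \<alpha> \<Sigma> =
     exp (- (1/2) * ((\<alpha> - m) \<bullet> (C *v (\<alpha> - m)))) *
     (det \<Sigma> powr (- (a / 2)) * exp (- (1/2) * trace (D ** matrix_inv \<Sigma>)))"

definition param_lborel ::
    "((real^('r \<times> ('q \<times> 'r))) \<times> (real^'r^'p) \<times> (real^'r^'r)) measure" where
  "param_lborel = lborel \<Otimes>\<^sub>M (lborel \<Otimes>\<^sub>M spd_lborel)"

definition norm_const :: ennreal where
  "norm_const =
     (\<integral>\<^sup>+ (\<alpha>, B, \<Sigma>). ennreal (likelihood \<alpha> B \<Sigma> * prior \<alpha> \<Sigma>) \<partial>param_lborel)"

definition posterior_proper :: bool where
  "posterior_proper \<longleftrightarrow> 0 < norm_const \<and> norm_const < \<infinity>"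

definition post ::
    "real^('r \<times> ('q \<times> 'r)) \<Rightarrow> real^'r^'p \<Rightarrow> real^'r^'r \<Rightarrow> ennreal" where
  "post \<alpha> B \<Sigma> = ennreal (likelihood \<alpha> B \<Sigma> * prior \<alpha> \<Sigma>) / norm_const"

definition posterior ::
    "((real^('r \<times> ('q \<times> 'r))) \<times> (real^'r^'p) \<times> (real^'r^'r)) measure" where
  "posterior = density param_lborel (\<lambda>(\<alpha>, B, \<Sigma>). post \<alpha> B \<Sigma>)"

definition posterior_A_Sigma :: "((real^('r \<times> ('q \<times> 'r))) \<times> (real^'r^'r)) measure" where
  "posterior_A_Sigma =
     distr posterior (lborel \<Otimes>\<^sub>M spd_lborel) (\<lambda>(\<alpha>, B, \<Sigma>). (\<alpha>, \<Sigma>))"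

definition posterior_A :: "(real^('r \<times> ('q \<times> 'r))) measure" where
  "posterior_A = distr posterior lborel (\<lambda>(\<alpha>, B, \<Sigma>). \<alpha>)"

definition post_A_Sigma :: "real^('r \<times> ('q \<times> 'r)) \<Rightarrow> real^'r^'r \<Rightarrow> ennreal" where
  "post_A_Sigma \<alpha> \<Sigma> = (\<integral>\<^sup>+ B. post \<alpha> B \<Sigma> \<partial>lborel)"

text \<open>Conditional densities $f(\Sigma \mid \alpha, Y, X)$, $f(\alpha \mid \Sigma, Y, X)$ and
  $f(\mathcal{B} \mid \alpha, \Sigma, Y, X)$; the conditioning variable comes first.\<close>

definition cond_Sigma :: "real^('r \<times> ('q \<times> 'r)) \<Rightarrow> real^'r^'r \<Rightarrow> ennreal" where
  "cond_Sigma \<alpha> \<Sigma> = post_A_Sigma \<alpha> \<Sigma> / (\<integral>\<^sup>+ S. post_A_Sigma \<alpha> S \<partial>spd_lborel)"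

definition cond_A :: "real^'r^'r \<Rightarrow> real^('r \<times> ('q \<times> 'r)) \<Rightarrow> ennreal" where
  "cond_A \<Sigma> \<alpha> = post_A_Sigma \<alpha> \<Sigma> / (\<integral>\<^sup>+ u. post_A_Sigma u \<Sigma> \<partial>lborel)"

definition cond_B ::
    "real^('r \<times> ('q \<times> 'r)) \<Rightarrow> real^'r^'r \<Rightarrow> real^'r^'p \<Rightarrow> ennreal" where
  "cond_B \<alpha> \<Sigma> B = post \<alpha> B \<Sigma> / post_A_Sigma \<alpha> \<Sigma>"

definition kernel_C ::
    "(real^('r \<times> ('q \<times> 'r))) \<times> (real^'r^'p) \<times> (real^'r^'r)
     \<Rightarrow> ((real^('r \<times> ('q \<times> 'r))) \<times> (real^'r^'p) \<times> (real^'r^'r)) measure" where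
  "kernel_C = (\<lambda>(\<alpha>', B', \<Sigma>').
     density param_lborel
       (\<lambda>(\<alpha>, B, \<Sigma>). cond_Sigma \<alpha>' \<Sigma> * cond_A \<Sigma> \<alpha> * cond_B \<alpha> \<Sigma> B))"

definition kernel_G ::
    "(real^('r \<times> ('q \<times> 'r))) \<times> (real^'r^'r)
     \<Rightarrow> ((real^('r \<times> ('q \<times> 'r))) \<times> (real^'r^'r)) measure" where
  "kernel_G = (\<lambda>(\<alpha>', \<Sigma>').
     density (lborel \<Otimes>\<^sub>M spd_lborel) (\<lambda>(\<alpha>, \<Sigma>). cond_A \<Sigma> \<alpha> * cond_Sigma \<alpha>' \<Sigma>))"

definition kernel_A ::
    "real^('r \<times> ('q \<times> 'r)) \<Rightarrow> (real^('r \<times> ('q \<times> 'r))) measure" where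
  "kernel_A \<alpha>' =
     density lborel (\<lambda>\<alpha>. \<integral>\<^sup>+ \<Sigma>. cond_A \<Sigma> \<alpha> * cond_Sigma \<alpha>' \<Sigma> \<partial>spd_lborel)"

end

end

theory Submission
  imports Defs
begin

text \<open>
  Since \<open>C\<close> is positive definite, the prior of \<open>\<alpha>\<close> is a proper Gaussian and pulls the chain into one
  fixed compact set in a single step, from wherever it starts. So the samplers satisfy a Doeblin
  condition on the whole space, and its constant can be chosen independently of \<open>n\<close> and the data.

  All three kernels depend on the current state only through \<open>\<alpha>'\<close>, and the other two are images of
  \<open>K_C\<close> (\<open>geom_bounded_marginals\<close>), so it suffices to treat \<open>K_C\<close>. If \<open>K_C^3\<close> dominates \<open>\<epsilon> \<nu>\<close> for some
  probability measure \<open>\<nu>\<close>, the distance to the invariant law after \<open>h\<close> steps is at most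
  \<open>(1 - \<epsilon>)^(h div 3)\<close>, and the rate is at most the third root of \<open>1 - \<epsilon>\<close> (\<open>doeblin_geom_bounded\<close>).
  The measure \<open>\<nu>\<close> may depend on \<open>n\<close> and on the data, as long as \<open>\<epsilon>\<close> is the same for all of them.

  On the event that \<open>n/K |\<xi>|^2 \<le> |W \<xi>|^2 \<le> K n |\<xi>|^2\<close> for all \<open>\<xi>\<close> (locale \<open>design\<close>), such a uniform \<open>\<epsilon>\<close> comes
  from three estimates. The first controls step one of the chain and the other two control step two;
  step three carries the resulting bound on the law of \<open>\<alpha>\<close> over to the full state.

  \<^item> From every \<open>\<Sigma>\<close>, the draw \<open>\<alpha> | \<Sigma>\<close> lands in a fixed ellipsoid \<open>U\<close> around \<open>m\<close> with probability at
    least 1/2 (\<open>prior_ball_likely\<close>). The likelihood is an even, decreasing weight around the least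
    squares estimate, which is bounded in terms of \<open>K\<close>, so it cannot push the Gaussian prior away.

  \<^item> From \<open>\<alpha> \<in> U\<close>, the draw \<open>\<Sigma> | \<alpha>\<close> lands in a fixed compact set \<open>V\<close> of positive definite matrices
    with probability at least 1/2 (\<open>covariance_likely\<close>). This is a large deviations estimate: up to
    constants and a common factor, the unnormalised density integrates to at least \<open>exp (- L n)\<close>, and
    outside \<open>V\<close> to at most \<open>c^n exp (- n R / 4)\<close>, where \<open>R\<close> grows with \<open>V\<close>.

  \<^item> For \<open>\<Sigma> \<in> V\<close>, the law of \<open>\<alpha> | \<Sigma>\<close> is concentrated at scale \<open>1 / sqrt n\<close> around the same point, the
    least squares estimate, and its density on the ball of radius \<open>1 / sqrt n\<close> is at least a constant
    times \<open>n^(d/2)\<close>, where \<open>d\<close> is the dimension of \<open>\<alpha>\<close> (\<open>neighbourhood_density\<close>). So the mass that all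
    these laws share does not shrink with \<open>n\<close>.

  \<open>uniform_geometric_rate\<close> fixes the constants. The random bound \<open>\<rho>\<^sub>n\<close> of the theorem is the resulting
  rate when \<open>n\<close> is large and the event above occurs, and a constant at least 1 otherwise; the event is
  measurable, and almost surely it occurs for all large \<open>n\<close>, by the hypothesis on the eigenvalues.
\<close>

section \<open>Uniformly ergodic Markov chains\<close>

lemma kernel_pow_measurable:
  assumes K: "K \<in> S \<rightarrow>\<^sub>M prob_algebra S"
  shows "kernel_pow K h \<in> S \<rightarrow>\<^sub>M prob_algebra S"
proof (induction h)
  case 0
  have "return (K x) x = return S x" if "x \<in> space S" for x
    using measurable_space[OF K that] by (intro return_cong) (auto simp: space_prob_algebra)
  then show ?case
    by (subst measurable_cong[where g = "return S"]) auto
next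
  case (Suc h)
  then show ?case
    using measurable_bind_prob_space[OF Suc K] by simp
qed

lemma kernel_pow_add:
  assumes K: "K \<in> S \<rightarrow>\<^sub>M prob_algebra S" and x: "x \<in> space S"
  shows "kernel_pow K (j + i) x = kernel_pow K j x \<bind> kernel_pow K i"
proof (induction i)
  case 0
  have sets: "sets (kernel_pow K j x) = sets S"
    using measurable_space[OF kernel_pow_measurable[OF K] x] by (auto simp: space_prob_algebra)
  have "return (K y) y = return S y" if "y \<in> space (kernel_pow K j x)" for y
    using measurable_space[OF K] that sets_eq_imp_space_eq[OF sets]
    by (intro return_cong) (auto simp: space_prob_algebra)
  then have "kernel_pow K j x \<bind> kernel_pow K 0 = kernel_pow K j x \<bind> return S"
    by (intro bind_cong) auto
  then show ?case
    using sets by (simp add: bind_return'' del: kernel_pow.simps)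
next
  case (Suc i)
  have "kernel_pow K j x \<in> space (prob_algebra S)"
    by (rule measurable_space[OF kernel_pow_measurable[OF K] x])
  then have "sets (kernel_pow K j x) = sets S" by (simp add: space_prob_algebra)
  then have "kernel_pow K i \<in> kernel_pow K j x \<rightarrow>\<^sub>M subprob_algebra S"
    using measurable_prob_algebraD[OF kernel_pow_measurable[OF K]]
    by (simp cong: measurable_cong_sets)
  from bind_assoc[OF this measurable_prob_algebraD[OF K]] show ?case
    using Suc by simp
qed

lemma integral_bind_bounded:
  fixes f :: "'s \<Rightarrow> real"
  assumes M: "M \<in> space (prob_algebra S)" and N: "N \<in> S \<rightarrow>\<^sub>M prob_algebra S"
    and f: "f \<in> borel_measurable S" and bnd: "\<And>x. x \<in> space S \<Longrightarrow> \<bar>f x\<bar> \<le> B"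
  shows "(\<integral>x. f x \<partial>(M \<bind> N)) = (\<integral>x. (\<integral>y. f y \<partial>N x) \<partial>M)"
proof (rule integral_bind[where K = S and B = B and B' = 1])
  have sM: "sets M = sets S" "prob_space M" using M by (auto simp: space_prob_algebra)
  show "N \<in> M \<rightarrow>\<^sub>M subprob_algebra S"
    using measurable_prob_algebraD[OF N] sM by (simp cong: measurable_cong_sets)
  show "finite_measure M" using sM(2) by (simp add: prob_space.finite_measure)
  show "AE x in M. emeasure (N x) (space (N x)) \<le> ennreal 1"
    using measurable_space[OF N] sets_eq_imp_space_eq[OF sM(1)]
    by (intro AE_I2) (auto simp: space_prob_algebra prob_space.emeasure_space_1)
qed (use f bnd in auto)

lemma prob_space_integral_bounds:
  fixes f :: "'s \<Rightarrow> real"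
  assumes M: "M \<in> space (prob_algebra S)" and f: "f \<in> borel_measurable S"
    and bnd: "\<And>x. x \<in> space S \<Longrightarrow> l \<le> f x \<and> f x \<le> u"
  shows "integrable M f" "l \<le> (\<integral>x. f x \<partial>M)" "(\<integral>x. f x \<partial>M) \<le> u"
proof -
  have sM: "sets M = sets S" "prob_space M" using M by (auto simp: space_prob_algebra)
  interpret prob_space M by fact
  have sp: "space M = space S" by (rule sets_eq_imp_space_eq[OF sM(1)])
  have fm: "f \<in> borel_measurable M" using f sM(1) by (simp cong: measurable_cong_sets)
  show int: "integrable M f"
    by (rule integrable_const_bound[where B = "\<bar>l\<bar> + \<bar>u\<bar>"])
       (use bnd sp fm in \<open>force intro!: AE_I2\<close>)+
  show "l \<le> (\<integral>x. f x \<partial>M)" "(\<integral>x. f x \<partial>M) \<le> u"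
    using integral_ge_const[OF int, of l] integral_le_const[OF int, of u] bnd sp by (auto intro!: AE_I2)
qed

text \<open>
  If \<open>\<mu>\<close> dominates \<open>\<epsilon> \<nu>\<close>, then the nonnegative functions \<open>f - l\<close> and \<open>u - f\<close> integrate under \<open>\<mu>\<close> to at least
  \<open>\<epsilon>\<close> times their \<open>\<nu>\<close>-integrals. The resulting interval for \<open>\<integral> f \<partial>\<mu>\<close> has length \<open>(1 - \<epsilon>) (u - l)\<close> and does
  not depend on \<open>\<mu>\<close>.
\<close>

lemma minorized_integral_bounds:
  fixes f :: "'s \<Rightarrow> real"
  assumes \<mu>: "\<mu> \<in> space (prob_algebra S)" and \<nu>: "\<nu> \<in> space (prob_algebra S)"
    and minor: "\<And>g. g \<in> borel_measurable S \<Longrightarrow> ennreal \<epsilon> * (\<integral>\<^sup>+x. g x \<partial>\<nu>) \<le> (\<integral>\<^sup>+x. g x \<partial>\<mu>)"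
    and f: "f \<in> borel_measurable S" and \<epsilon>: "0 \<le> \<epsilon>"
    and bnd: "\<And>x. x \<in> space S \<Longrightarrow> l \<le> f x \<and> f x \<le> u"
  shows "l + \<epsilon> * ((\<integral>x. f x \<partial>\<nu>) - l) \<le> (\<integral>x. f x \<partial>\<mu>)"
    and "(\<integral>x. f x \<partial>\<mu>) \<le> u - \<epsilon> * (u - (\<integral>x. f x \<partial>\<nu>))"
proof -
  interpret \<mu>: prob_space \<mu> using \<mu> by (simp add: space_prob_algebra)
  interpret \<nu>: prob_space \<nu> using \<nu> by (simp add: space_prob_algebra)
  have sp: "space \<mu> = space S" "space \<nu> = space S"
    using \<mu> \<nu> by (auto simp: space_prob_algebra dest!: sets_eq_imp_space_eq)
  have mono: "\<epsilon> * (\<integral>x. g x \<partial>\<nu>) \<le> (\<integral>x. g x \<partial>\<mu>)"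
    if g: "g \<in> borel_measurable S" and g0: "\<And>x. x \<in> space S \<Longrightarrow> 0 \<le> g x \<and> g x \<le> u - l"
    for g :: "'s \<Rightarrow> real"
  proof -
    note bounds = prob_space_integral_bounds[OF _ g g0]
    have "ennreal \<epsilon> * (\<integral>\<^sup>+x. ennreal (g x) \<partial>\<nu>) \<le> (\<integral>\<^sup>+x. ennreal (g x) \<partial>\<mu>)"
      using g by (intro minor) simp
    also have "(\<integral>\<^sup>+x. ennreal (g x) \<partial>\<mu>) = ennreal (\<integral>x. g x \<partial>\<mu>)"
      using bounds(1)[OF \<mu>] g0 sp by (intro nn_integral_eq_integral) (auto intro!: AE_I2)
    also have "(\<integral>\<^sup>+x. ennreal (g x) \<partial>\<nu>) = ennreal (\<integral>x. g x \<partial>\<nu>)"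
      using bounds(1)[OF \<nu>] g0 sp by (intro nn_integral_eq_integral) (auto intro!: AE_I2)
    finally show ?thesis
      using \<epsilon> bounds(2)[OF \<mu>] bounds(2)[OF \<nu>] by (simp flip: ennreal_mult)
  qed
  note int = prob_space_integral_bounds(1)[OF _ f bnd]
  have "\<epsilon> * (\<integral>x. f x - l \<partial>\<nu>) \<le> (\<integral>x. f x - l \<partial>\<mu>)"
    using f bnd by (intro mono) auto
  then show "l + \<epsilon> * ((\<integral>x. f x \<partial>\<nu>) - l) \<le> (\<integral>x. f x \<partial>\<mu>)"
    using int[OF \<mu>] int[OF \<nu>] by (simp add: \<mu>.prob_space \<nu>.prob_space)
  have "\<epsilon> * (\<integral>x. u - f x \<partial>\<nu>) \<le> (\<integral>x. u - f x \<partial>\<mu>)"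
    using f bnd by (intro mono) auto
  then show "(\<integral>x. f x \<partial>\<mu>) \<le> u - \<epsilon> * (u - (\<integral>x. f x \<partial>\<nu>))"
    using int[OF \<mu>] int[OF \<nu>] by (simp add: \<mu>.prob_space \<nu>.prob_space)
qed

text \<open>
  Under a minorization, \<open>m\<close> steps of the chain map a function with values in \<open>[l, u]\<close> to one with values
  in an interval shorter by the factor \<open>1 - \<epsilon>\<close>. Iterating on functions instead of measures avoids the
  residual kernel \<open>(K^m - \<epsilon> \<nu>) / (1 - \<epsilon>)\<close>.
\<close>

lemma doeblin_oscillation:
  fixes f :: "'s \<Rightarrow> real"
  assumes K: "K \<in> S \<rightarrow>\<^sub>M prob_algebra S" and \<nu>: "\<nu> \<in> space (prob_algebra S)"
    and \<epsilon>: "0 \<le> \<epsilon>"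
    and minor: "\<And>x g. x \<in> space S \<Longrightarrow> g \<in> borel_measurable S \<Longrightarrow>
      ennreal \<epsilon> * (\<integral>\<^sup>+y. g y \<partial>\<nu>) \<le> (\<integral>\<^sup>+y. g y \<partial>kernel_pow K m x)"
  shows "f \<in> borel_measurable S \<Longrightarrow> (\<And>x. x \<in> space S \<Longrightarrow> l \<le> f x \<and> f x \<le> u) \<Longrightarrow>
    \<exists>l' u'. u' - l' = (1 - \<epsilon>) ^ k * (u - l) \<and>
      (\<forall>x\<in>space S. l' \<le> (\<integral>y. f y \<partial>kernel_pow K (k * m) x) \<and>
                   (\<integral>y. f y \<partial>kernel_pow K (k * m) x) \<le> u')"
proof (induction k arbitrary: f l u)
  case 0
  have "(\<integral>y. f y \<partial>kernel_pow K 0 x) = f x" if x: "x \<in> space S" for x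
  proof -
    have "return (K x) x = return S x"
      using measurable_space[OF K x] by (intro return_cong) (auto simp: space_prob_algebra)
    then show ?thesis using x 0 by (simp add: integral_return)
  qed
  then show ?case using 0 by (intro exI[of _ l] exI[of _ u]) auto
next
  case (Suc k)
  define f' where "f' x = (\<integral>y. f y \<partial>kernel_pow K m x)" for x
  define I where "I = (\<integral>y. f y \<partial>\<nu>)"
  note Km = kernel_pow_measurable[OF K]
  have f'm: "f' \<in> borel_measurable S"
    unfolding f'_def
    by (rule measurable_compose[OF measurable_prob_algebraD[OF Km] integral_measurable_subprob_algebra[OF Suc.prems(1)]])
  have f'b: "l + \<epsilon> * (I - l) \<le> f' x \<and> f' x \<le> u - \<epsilon> * (u - I)" if x: "x \<in> space S" for x
    unfolding f'_def I_def
    using minorized_integral_bounds[OF measurable_space[OF Km x] \<nu> minor[OF x] Suc.prems(1) \<epsilon> Suc.prems(2)]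
      by auto
  have eq: "(\<integral>y. f y \<partial>kernel_pow K (Suc k * m) x) = (\<integral>y. f' y \<partial>kernel_pow K (k * m) x)"
    if x: "x \<in> space S" for x
  proof -
    have "kernel_pow K (Suc k * m) x = kernel_pow K (k * m) x \<bind> kernel_pow K m"
      using kernel_pow_add[OF K x, of "k * m" m] by (simp add: add.commute)
    then show ?thesis
      unfolding f'_def
      using integral_bind_bounded[OF measurable_space[OF Km x] Km Suc.prems(1), where B = "\<bar>l\<bar> + \<bar>u\<bar>" ]
        Suc.prems(2) by force
  qed
  obtain l' u' where *: "u' - l' = (1 - \<epsilon>) ^ k * ((u - \<epsilon> * (u - I)) - (l + \<epsilon> * (I - l)))"
    "\<And>x. x \<in> space S \<Longrightarrow> l' \<le> (\<integral>y. f' y \<partial>kernel_pow K (k * m) x) \<and>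
                   (\<integral>y. f' y \<partial>kernel_pow K (k * m) x) \<le> u'"
    using Suc.IH[OF f'm f'b] by blast
  have "u' - l' = (1 - \<epsilon>) ^ Suc k * (u - l)"
    unfolding *(1) by (simp add: algebra_simps)
  with *(2) eq show ?case by (intro exI[of _ l'] exI[of _ u']) auto
qed

lemma kernel_pow_invariant:
  assumes K: "K \<in> S \<rightarrow>\<^sub>M prob_algebra S" and \<pi>: "\<pi> \<in> space (prob_algebra S)" and inv: "\<pi> \<bind> K = \<pi>"
  shows "\<pi> \<bind> kernel_pow K h = \<pi>"
proof (induction h)
  case 0
  have s: "sets \<pi> = sets S" using \<pi> by (simp add: space_prob_algebra)
  have "return (K y) y = return S y" if "y \<in> space \<pi>" for y
    using measurable_space[OF K] that sets_eq_imp_space_eq[OF s]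
    by (intro return_cong) (auto simp: space_prob_algebra)
  then have "\<pi> \<bind> kernel_pow K 0 = \<pi> \<bind> return S"
    by (intro bind_cong) auto
  then show ?case using s by (simp add: bind_return'' del: kernel_pow.simps)
next
  case (Suc h)
  have s: "sets \<pi> = sets S" using \<pi> by (simp add: space_prob_algebra)
  have "kernel_pow K h \<in> \<pi> \<rightarrow>\<^sub>M subprob_algebra S"
    using measurable_prob_algebraD[OF kernel_pow_measurable[OF K]] s by (simp cong: measurable_cong_sets)
  from bind_assoc[OF this measurable_prob_algebraD[OF K]] show ?case
    using Suc inv by simp
qed

text \<open>
  Both numbers are averages, over different starting laws, of the same function
  \<open>x \<mapsto> K^(k m) x A\<close>, whose values lie in an interval of length \<open>(1 - \<epsilon>)^k\<close>.
\<close>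

theorem doeblin_tv_dist:
  assumes K: "K \<in> S \<rightarrow>\<^sub>M prob_algebra S" and \<nu>: "\<nu> \<in> space (prob_algebra S)"
    and \<pi>: "\<pi> \<in> space (prob_algebra S)" and inv: "\<pi> \<bind> K = \<pi>"
    and \<epsilon>: "0 \<le> \<epsilon>" "\<epsilon> \<le> 1"
    and minor: "\<And>x g. x \<in> space S \<Longrightarrow> g \<in> borel_measurable S \<Longrightarrow>
      ennreal \<epsilon> * (\<integral>\<^sup>+y. g y \<partial>\<nu>) \<le> (\<integral>\<^sup>+y. g y \<partial>kernel_pow K m x)"
    and x: "x \<in> space S" and A: "A \<in> sets S"
  shows "\<bar>measure (kernel_pow K (j + k * m) x) A - measure \<pi> A\<bar> \<le> (1 - \<epsilon>) ^ k"
proof -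
  let ?f = "indicator A :: _ \<Rightarrow> real"
  note Km = kernel_pow_measurable[OF K]
  have fm: "?f \<in> borel_measurable S" using A by simp
  have f01: "0 \<le> ?f x \<and> ?f x \<le> 1" for x by (simp add: indicator_def)
  obtain l' u' where *: "u' - l' = (1 - \<epsilon>) ^ k * (1 - 0)"
    "\<And>x. x \<in> space S \<Longrightarrow> l' \<le> (\<integral>y. ?f y \<partial>kernel_pow K (k * m) x) \<and>
                   (\<integral>y. ?f y \<partial>kernel_pow K (k * m) x) \<le> u'"
    using doeblin_oscillation[OF K \<nu> \<epsilon>(1) minor fm f01] by blast
  have measure_eq: "measure \<mu> A = (\<integral>y. ?f y \<partial>\<mu>)" if "\<mu> \<in> space (prob_algebra S)" for \<mu>
  proof -
    from that have s: "sets \<mu> = sets S" "prob_space \<mu>" by (auto simp: space_prob_algebra)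
    show ?thesis using A s by simp
  qed
  let ?F = "\<lambda>x. \<integral>y. ?f y \<partial>kernel_pow K (k * m) x"
  have Fm: "?F \<in> borel_measurable S"
    by (rule measurable_compose[OF measurable_prob_algebraD[OF Km] integral_measurable_subprob_algebra[OF fm]])
  have within: "l' \<le> measure (\<mu> \<bind> kernel_pow K (k * m)) A \<and>
      measure (\<mu> \<bind> kernel_pow K (k * m)) A \<le> u'" if \<mu>: "\<mu> \<in> space (prob_algebra S)" for \<mu>
  proof -
    have "\<mu> \<bind> kernel_pow K (k * m) \<in> space (prob_algebra S)"
      using prob_space_bind'[OF \<mu> Km] sets_bind'[OF \<mu> Km] by (simp add: space_prob_algebra)
    moreover have "(\<integral>y. ?f y \<partial>(\<mu> \<bind> kernel_pow K (k * m))) = (\<integral>x. ?F x \<partial>\<mu>)"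
      by (rule integral_bind_bounded[OF \<mu> Km fm, where B = 1]) (simp add: indicator_def)
    ultimately have "measure (\<mu> \<bind> kernel_pow K (k * m)) A = (\<integral>x. ?F x \<partial>\<mu>)"
      by (simp only: measure_eq)
    then show ?thesis
      using prob_space_integral_bounds[OF \<mu> Fm *(2)] by simp
  qed
  have "measure (kernel_pow K (j + k * m) x) A = measure (kernel_pow K j x \<bind> kernel_pow K (k * m)) A"
    by (simp add: kernel_pow_add[OF K x])
  moreover have "u' - l' = (1 - \<epsilon>) ^ k" using *(1) by simp
  ultimately show ?thesis
    using within[OF measurable_space[OF Km x, of j]] within[OF \<pi>] kernel_pow_invariant[OF K \<pi> inv, of "k * m"]
    by (simp only: abs_le_iff) linarith
qed

text \<open>
  Geometric convergence with one constant for all starting points. Unlike \<open>geom_rate\<close>, this property is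
  inherited by images of the chain for the same \<open>\<rho>\<close> (\<open>geom_bounded_lumped\<close>).
\<close>

definition geom_bounded :: "('s \<Rightarrow> 's measure) \<Rightarrow> 's measure \<Rightarrow> real \<Rightarrow> bool" where
  "geom_bounded K \<pi> \<rho> \<longleftrightarrow> (\<exists>c\<ge>0. \<forall>x\<in>space \<pi>. \<forall>h\<ge>1. tv_dist (kernel_pow K h x) \<pi> \<le> c * \<rho> ^ h)"

lemma geom_rate_le:
  assumes "geom_bounded K \<pi> \<rho>" "0 \<le> \<rho>" "\<rho> \<le> 1"
  shows "geom_rate K \<pi> \<le> \<rho>"
proof -
  obtain c where "c \<ge> 0" "\<forall>x\<in>space \<pi>. \<forall>h\<ge>1. tv_dist (kernel_pow K h x) \<pi> \<le> c * \<rho> ^ h"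
    using assms(1) by (auto simp: geom_bounded_def)
  then have "\<rho> \<in> {\<rho> \<in> {0..1}. \<exists>M. \<forall>x\<in>space \<pi>. 0 \<le> M x \<and>
     (\<forall>h\<ge>1. tv_dist (kernel_pow K h x) \<pi> \<le> M x * \<rho> ^ h)}"
    using assms by (auto intro!: exI[of _ "\<lambda>_. c"])
  then show ?thesis
    unfolding geom_rate_def by (rule cInf_lower) (auto intro!: bdd_belowI[of _ 0])
qed

text \<open>
  In \<open>h\<close> steps there are \<open>h div m\<close> contractions by \<open>1 - \<epsilon>\<close>; rounding down costs the constant factor \<open>1 / \<rho>^m\<close>.
\<close>

theorem doeblin_geom_bounded:
  assumes K: "K \<in> S \<rightarrow>\<^sub>M prob_algebra S" and \<nu>: "\<nu> \<in> space (prob_algebra S)"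
    and \<pi>: "\<pi> \<in> space (prob_algebra S)" and inv: "\<pi> \<bind> K = \<pi>"
    and \<epsilon>: "0 \<le> \<epsilon>" "\<epsilon> < 1" and m: "0 < m"
    and minor: "\<And>x g. x \<in> space S \<Longrightarrow> g \<in> borel_measurable S \<Longrightarrow>
      ennreal \<epsilon> * (\<integral>\<^sup>+y. g y \<partial>\<nu>) \<le> (\<integral>\<^sup>+y. g y \<partial>kernel_pow K m x)"
  shows "geom_bounded K \<pi> (root m (1 - \<epsilon>))"
  unfolding geom_bounded_def
proof (intro exI conjI ballI allI impI)
  let ?\<rho> = "root m (1 - \<epsilon>)"
  have \<rho>: "0 < ?\<rho>" "?\<rho> \<le> 1" "?\<rho> ^ m = 1 - \<epsilon>"
    using \<epsilon> m by auto
  show "0 \<le> inverse (?\<rho> ^ m)" using \<epsilon> unfolding \<rho>(3) by simp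
  fix x and h :: nat assume x: "x \<in> space \<pi>"
  have s: "sets \<pi> = sets S" using \<pi> by (simp add: space_prob_algebra)
  have x': "x \<in> space S" using x sets_eq_imp_space_eq[OF s] by simp
  have "\<bar>measure (kernel_pow K h x) A - measure \<pi> A\<bar> \<le> inverse (?\<rho> ^ m) * ?\<rho> ^ h"
    if "A \<in> sets \<pi>" for A
  proof -
    have "\<bar>measure (kernel_pow K h x) A - measure \<pi> A\<bar> \<le> (1 - \<epsilon>) ^ (h div m)"
      using doeblin_tv_dist[OF K \<nu> \<pi> inv \<epsilon>(1) less_imp_le[OF \<epsilon>(2)] minor x' that[unfolded s],
          of "h mod m" "h div m"]
      by (simp only: mod_div_mult_eq)
    also have "\<dots> = inverse (?\<rho> ^ m) * ?\<rho> ^ (m * (h div m) + m)"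
      unfolding power_add power_mult \<rho>(3) using \<epsilon> by simp
    also have "\<dots> \<le> inverse (?\<rho> ^ m) * ?\<rho> ^ h"
    proof (intro mult_left_mono power_decreasing)
      have "h = m * (h div m) + h mod m" by simp
      moreover have "h mod m < m" using m by simp
      ultimately show "h \<le> m * (h div m) + m" by linarith
    qed (use \<rho>(1,2) in auto)
    finally show ?thesis .
  qed
  then show "tv_dist (kernel_pow K h x) \<pi> \<le> inverse (?\<rho> ^ m) * ?\<rho> ^ h"
    unfolding tv_dist_def by (intro cSUP_least) auto
qed

text \<open>
  A chain \<open>K\<close> whose transition law depends on \<open>x\<close> only through \<open>\<phi> x\<close> projects to a chain on the image, and
  projecting measures does not increase their distance. The section \<open>\<sigma>\<close> picks a representative of each
  fibre, which makes the projected kernel measurable.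
\<close>

lemma geom_bounded_lumped:
  assumes K: "K \<in> S \<rightarrow>\<^sub>M prob_algebra S" and \<phi>: "\<phi> \<in> S \<rightarrow>\<^sub>M T" and \<sigma>: "\<sigma> \<in> T \<rightarrow>\<^sub>M S"
    and K': "\<And>z. z \<in> space T \<Longrightarrow> K' z = distr (K (\<sigma> z)) T \<phi>"
    and lump: "\<And>x. x \<in> space S \<Longrightarrow> K (\<sigma> (\<phi> x)) = K x"
    and \<pi>: "\<pi> \<in> space (prob_algebra S)"
    and b: "geom_bounded K \<pi> \<rho>"
  shows "geom_bounded K' (distr \<pi> T \<phi>) \<rho>"
proof -
  note Km = kernel_pow_measurable[OF K]
  have K'm: "K' \<in> T \<rightarrow>\<^sub>M prob_algebra T"
    using measurable_compose[OF measurable_compose[OF \<sigma> K] measurable_distr_prob_space[OF \<phi>]]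
    by (subst measurable_cong[OF K']) auto
  have pow: "kernel_pow K' (Suc h) z = distr (kernel_pow K (Suc h) (\<sigma> z)) T \<phi>" if z: "z \<in> space T" for h z
  proof (induction h)
    case 0
    have sz: "\<sigma> z \<in> space S" by (rule measurable_space[OF \<sigma> z])
    have "return (K' z) z = return T z" "return (K (\<sigma> z)) (\<sigma> z) = return S (\<sigma> z)"
      using z K' measurable_space[OF K sz] by (intro return_cong; simp add: space_prob_algebra)+
    then show ?case
      using bind_return[OF measurable_prob_algebraD[OF K] sz] bind_return[OF measurable_prob_algebraD[OF K'm] z] K'[OF z]
      by simp
  next
    case (Suc h)
    let ?\<mu> = "kernel_pow K (Suc h) (\<sigma> z)"
    have \<mu>: "?\<mu> \<in> space (prob_algebra S)"
      by (rule measurable_space[OF Km measurable_space[OF \<sigma> z]])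
    then have s: "sets ?\<mu> = sets S" "space ?\<mu> \<noteq> {}" "space ?\<mu> = space S"
      by (auto simp: space_prob_algebra prob_space.not_empty dest: sets_eq_imp_space_eq)
    have \<phi>': "\<phi> \<in> ?\<mu> \<rightarrow>\<^sub>M T" and Km': "K \<in> ?\<mu> \<rightarrow>\<^sub>M subprob_algebra S"
      using \<phi> measurable_prob_algebraD[OF K] by (subst measurable_cong_sets[OF s(1) refl], simp)+
    have "kernel_pow K' (Suc (Suc h)) z = distr ?\<mu> T \<phi> \<bind> K'"
      using Suc by simp
    also have "\<dots> = ?\<mu> \<bind> (\<lambda>y. K' (\<phi> y))"
      by (rule bind_distr[OF \<phi>' measurable_prob_algebraD[OF K'm] s(2)])
    also have "\<dots> = ?\<mu> \<bind> (\<lambda>y. distr (K y) T \<phi>)"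
      using measurable_space[OF \<phi>] by (intro bind_cong refl) (simp add: s K' lump del: kernel_pow.simps)
    also have "\<dots> = distr (?\<mu> \<bind> K) T \<phi>"
      by (rule distr_bind[symmetric, OF Km' s(2) \<phi>])
    finally show ?case by simp
  qed
  obtain c where c: "c \<ge> 0" "\<And>x h. x \<in> space \<pi> \<Longrightarrow> h \<ge> 1 \<Longrightarrow> tv_dist (kernel_pow K h x) \<pi> \<le> c * \<rho> ^ h"
    using b by (auto simp: geom_bounded_def)
  have s\<pi>: "sets \<pi> = sets S" "space \<pi> = space S" "prob_space \<pi>"
    using \<pi> by (auto simp: space_prob_algebra dest: sets_eq_imp_space_eq)
  have "tv_dist (kernel_pow K' h z) (distr \<pi> T \<phi>) \<le> c * \<rho> ^ h" if z: "z \<in> space T" and h: "h \<ge> 1" for z h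
    unfolding tv_dist_def
  proof (intro cSUP_least)
    fix A assume "A \<in> sets (distr \<pi> T \<phi>)"
    then have A: "A \<in> sets T" by simp
    obtain h' where h': "h = Suc h'" using h by (cases h) auto
    let ?\<mu> = "kernel_pow K h (\<sigma> z)"
    have \<mu>: "?\<mu> \<in> space (prob_algebra S)"
      by (rule measurable_space[OF Km measurable_space[OF \<sigma> z]])
    then have s: "sets ?\<mu> = sets S" "space ?\<mu> = space S" "prob_space ?\<mu>"
      by (auto simp: space_prob_algebra prob_space.not_empty dest: sets_eq_imp_space_eq)
    let ?A = "\<phi> -` A \<inter> space S"
    have A': "?A \<in> sets \<pi>" using measurable_sets[OF \<phi> A] s\<pi> by simp
    have m\<mu>: "\<phi> \<in> ?\<mu> \<rightarrow>\<^sub>M T" "\<phi> \<in> \<pi> \<rightarrow>\<^sub>M T"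
      using \<phi> s(1) s\<pi>(1) measurable_cong_sets by blast+
    have "\<bar>measure (kernel_pow K' h z) A - measure (distr \<pi> T \<phi>) A\<bar> = \<bar>measure ?\<mu> ?A - measure \<pi> ?A\<bar>"
      unfolding h' pow[OF z] using measure_distr[OF m\<mu>(1) A] measure_distr[OF m\<mu>(2) A] s s\<pi>
      by (simp add: h' del: kernel_pow.simps)
    also have "\<dots> \<le> tv_dist ?\<mu> \<pi>"
      unfolding tv_dist_def
    proof (rule cSUP_upper[OF A'])
      have "\<bar>measure ?\<mu> B - measure \<pi> B\<bar> \<le> 1" for B
        using prob_space.prob_le_1[OF s(3), of B] prob_space.prob_le_1[OF s\<pi>(3), of B]
          measure_nonneg[of ?\<mu> B] measure_nonneg[of \<pi> B] by linarith
      then show "bdd_above ((\<lambda>B. \<bar>measure ?\<mu> B - measure \<pi> B\<bar>) ` sets \<pi>)"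
        by (intro bdd_aboveI2)
    qed
    also have "\<dots> \<le> c * \<rho> ^ h"
      using measurable_space[OF \<sigma> z] h s\<pi> by (intro c(2)) auto
    finally show "\<bar>measure (kernel_pow K' h z) A - measure (distr \<pi> T \<phi>) A\<bar> \<le> c * \<rho> ^ h" .
  qed auto
  then show ?thesis
    unfolding geom_bounded_def using c(1) by auto
qed

lemma nn_integral_kernel_pow_Suc:
  assumes K: "K \<in> S \<rightarrow>\<^sub>M prob_algebra S" and x: "x \<in> space S" and f: "f \<in> borel_measurable S"
  shows "(\<integral>\<^sup>+y. f y \<partial>kernel_pow K (Suc h) x) = (\<integral>\<^sup>+y. (\<integral>\<^sup>+z. f z \<partial>K y) \<partial>kernel_pow K h x)"
proof -
  have "kernel_pow K h x \<in> space (prob_algebra S)"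
    by (rule measurable_space[OF kernel_pow_measurable[OF K] x])
  then have "sets (kernel_pow K h x) = sets S" by (simp add: space_prob_algebra)
  then have "K \<in> kernel_pow K h x \<rightarrow>\<^sub>M subprob_algebra S"
    using measurable_prob_algebraD[OF K] by (simp cong: measurable_cong_sets)
  from nn_integral_bind[OF f this] show ?thesis by simp
qed

lemma nn_integral_kernel_pow_3:
  assumes K: "K \<in> S \<rightarrow>\<^sub>M prob_algebra S" and x: "x \<in> space S" and f: "f \<in> borel_measurable S"
  shows "(\<integral>\<^sup>+y. f y \<partial>kernel_pow K 3 x) = (\<integral>\<^sup>+y. (\<integral>\<^sup>+z. (\<integral>\<^sup>+w. f w \<partial>K z) \<partial>K y) \<partial>K x)"
proof -
  note meas = measurable_compose[OF measurable_prob_algebraD[OF K] nn_integral_measurable_subprob_algebra]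
  have "return (K x) x = return S x"
    using measurable_space[OF K x] by (intro return_cong) (auto simp: space_prob_algebra)
  then have base: "(\<integral>\<^sup>+y. F y \<partial>kernel_pow K 0 x) = F x" if "F \<in> borel_measurable S" for F
    using x that by (simp add: nn_integral_return)
  show ?thesis
    using f x by (simp only: numeral_3_eq_3 nn_integral_kernel_pow_Suc[OF K] meas base)
qed

section \<open>Gibbs samplers with three blocks\<close>

lemma ennreal_one_le_mult_divide:
  fixes g x k :: ennreal
  assumes "0 < g" "g < \<infinity>" "g \<le> k * x"
  shows "1 \<le> k * (x / g)"
proof -
  have "1 = g / g" using assms by (simp add: ennreal_divide_self less_top)
  also have "\<dots> \<le> k * x / g" by (rule divide_right_mono_ennreal) fact
  finally show ?thesis by (simp add: ennreal_times_divide)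
qed

lemma ennreal_mult_divide_cancel:
  fixes g x :: ennreal
  assumes "0 < g" "g < \<infinity>"
  shows "g * (x / g) = x" "x * g / g = x"
proof -
  show "x * g / g = x" using assms by (intro mult_divide_eq_ennreal) auto
  then show "g * (x / g) = x" by (simp add: ennreal_times_divide mult.commute)
qed

text \<open>
  A sampler for this density updates \<open>s\<close> given \<open>\<alpha>'\<close>, then \<open>\<alpha>\<close> given \<open>s\<close>, then \<open>b\<close> given both; \<open>b\<close> and \<open>s\<close> stand
  for \<open>\<B>\<close> and \<open>\<Sigma>\<close>. The density \<open>p\<close> may be unnormalised, because the conditional densities are ratios.
\<close>

locale three_block_density =
  A: sigma_finite_measure \<mu>a + B: sigma_finite_measure \<mu>b + S: sigma_finite_measure \<mu>s
  for \<mu>a :: "'a measure" and \<mu>b :: "'b measure" and \<mu>s :: "'s measure" +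
  fixes p :: "'a \<Rightarrow> 'b \<Rightarrow> 's \<Rightarrow> ennreal"
  assumes p_measurable: "(\<lambda>(\<alpha>, b, s). p \<alpha> b s) \<in> borel_measurable (\<mu>a \<Otimes>\<^sub>M (\<mu>b \<Otimes>\<^sub>M \<mu>s))"
begin

definition g :: "'a \<Rightarrow> 's \<Rightarrow> ennreal" where "g \<alpha> s = (\<integral>\<^sup>+b. p \<alpha> b s \<partial>\<mu>b)"
definition cS :: "'a \<Rightarrow> 's \<Rightarrow> ennreal" where "cS \<alpha> s = g \<alpha> s / (\<integral>\<^sup>+s. g \<alpha> s \<partial>\<mu>s)"
definition cA :: "'s \<Rightarrow> 'a \<Rightarrow> ennreal" where "cA s \<alpha> = g \<alpha> s / (\<integral>\<^sup>+u. g u s \<partial>\<mu>a)"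
definition cB :: "'a \<Rightarrow> 's \<Rightarrow> 'b \<Rightarrow> ennreal" where "cB \<alpha> s b = p \<alpha> b s / g \<alpha> s"

abbreviation "joint \<equiv> \<mu>a \<Otimes>\<^sub>M (\<mu>b \<Otimes>\<^sub>M \<mu>s)"

definition stationary :: "('a \<times> 'b \<times> 's) measure" where
  "stationary = density joint (\<lambda>(\<alpha>, b, s). p \<alpha> b s)"

text \<open>
  The law of the next state, which depends on the current one only through its first component. As a
  map on the first block alone, it carries a minorization of the law of that block over to the full
  state.
\<close>

definition step :: "'a \<Rightarrow> ('a \<times> 'b \<times> 's) measure" where
  "step \<alpha>' = density joint (\<lambda>(\<alpha>, b, s). cS \<alpha>' s * cA s \<alpha> * cB \<alpha> s b)"

definition kern :: "'a \<times> 'b \<times> 's \<Rightarrow> ('a \<times> 'b \<times> 's) measure" where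
  "kern = (\<lambda>(\<alpha>', b', s'). step \<alpha>')"

lemma p_comp[measurable (raw)]:
  assumes "f \<in> N \<rightarrow>\<^sub>M \<mu>a" "h \<in> N \<rightarrow>\<^sub>M \<mu>b" "k \<in> N \<rightarrow>\<^sub>M \<mu>s"
  shows "(\<lambda>x. p (f x) (h x) (k x)) \<in> borel_measurable N"
proof -
  have "(\<lambda>x. (f x, h x, k x)) \<in> N \<rightarrow>\<^sub>M joint" using assms by simp
  from measurable_compose[OF this p_measurable] show ?thesis by simp
qed

lemma g_comp[measurable (raw)]:
  assumes [measurable]: "f \<in> N \<rightarrow>\<^sub>M \<mu>a" "k \<in> N \<rightarrow>\<^sub>M \<mu>s"
  shows "(\<lambda>x. g (f x) (k x)) \<in> borel_measurable N"
  unfolding g_def by measurable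

lemma cS_comp[measurable (raw)]:
  assumes [measurable]: "f \<in> N \<rightarrow>\<^sub>M \<mu>a" "k \<in> N \<rightarrow>\<^sub>M \<mu>s"
  shows "(\<lambda>x. cS (f x) (k x)) \<in> borel_measurable N"
  unfolding cS_def by measurable

lemma cA_comp[measurable (raw)]:
  assumes [measurable]: "f \<in> N \<rightarrow>\<^sub>M \<mu>a" "k \<in> N \<rightarrow>\<^sub>M \<mu>s"
  shows "(\<lambda>x. cA (k x) (f x)) \<in> borel_measurable N"
  unfolding cA_def by measurable

lemma cB_comp[measurable (raw)]:
  assumes [measurable]: "f \<in> N \<rightarrow>\<^sub>M \<mu>a" "h \<in> N \<rightarrow>\<^sub>M \<mu>b" "k \<in> N \<rightarrow>\<^sub>M \<mu>s"
  shows "(\<lambda>x. cB (f x) (k x) (h x)) \<in> borel_measurable N"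
  unfolding cB_def by measurable

text \<open>
  The order of integration in which a sampler draws its blocks: \<open>b\<close> innermost, \<open>s\<close> outermost.
\<close>

lemma nn_integral_joint:
  assumes f: "f \<in> borel_measurable joint"
  shows "(\<integral>\<^sup>+z. f z \<partial>joint) = (\<integral>\<^sup>+s. \<integral>\<^sup>+\<alpha>. \<integral>\<^sup>+b. f (\<alpha>, b, s) \<partial>\<mu>b \<partial>\<mu>a \<partial>\<mu>s)"
proof -
  note [measurable] = f
  interpret AS: pair_sigma_finite \<mu>a \<mu>s ..
  interpret BS: pair_sigma_finite \<mu>b \<mu>s ..
  have "(\<integral>\<^sup>+z. f z \<partial>joint) = (\<integral>\<^sup>+\<alpha>. \<integral>\<^sup>+w. f (\<alpha>, w) \<partial>(\<mu>b \<Otimes>\<^sub>M \<mu>s) \<partial>\<mu>a)"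
    by (rule BS.nn_integral_fst[symmetric]) measurable
  also have "\<dots> = (\<integral>\<^sup>+\<alpha>. \<integral>\<^sup>+s. \<integral>\<^sup>+b. f (\<alpha>, b, s) \<partial>\<mu>b \<partial>\<mu>s \<partial>\<mu>a)"
    by (intro nn_integral_cong BS.nn_integral_snd[symmetric]) measurable
  also have "\<dots> = (\<integral>\<^sup>+s. \<integral>\<^sup>+\<alpha>. \<integral>\<^sup>+b. f (\<alpha>, b, s) \<partial>\<mu>b \<partial>\<mu>a \<partial>\<mu>s)"
    by (rule AS.Fubini'[symmetric]) measurable
  finally show ?thesis .
qed

lemma nn_integral_step:
  assumes f: "f \<in> borel_measurable joint" and \<alpha>': "\<alpha>' \<in> space \<mu>a"
  shows "(\<integral>\<^sup>+z. f z \<partial>step \<alpha>') =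
    (\<integral>\<^sup>+s. cS \<alpha>' s * (\<integral>\<^sup>+\<alpha>. cA s \<alpha> * (\<integral>\<^sup>+b. cB \<alpha> s b * f (\<alpha>, b, s) \<partial>\<mu>b) \<partial>\<mu>a) \<partial>\<mu>s)"
proof -
  note [measurable] = f \<alpha>'
  have "(\<integral>\<^sup>+z. f z \<partial>step \<alpha>') = (\<integral>\<^sup>+z. (case z of (\<alpha>, b, s) \<Rightarrow> cS \<alpha>' s * cA s \<alpha> * cB \<alpha> s b) * f z \<partial>joint)"
    unfolding step_def by (rule nn_integral_density) measurable
  also have "\<dots> = (\<integral>\<^sup>+s. \<integral>\<^sup>+\<alpha>. \<integral>\<^sup>+b. cS \<alpha>' s * (cA s \<alpha> * (cB \<alpha> s b * f (\<alpha>, b, s))) \<partial>\<mu>b \<partial>\<mu>a \<partial>\<mu>s)"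
    by (subst nn_integral_joint) (auto simp: mult.assoc)
  also have "\<dots> = (\<integral>\<^sup>+s. cS \<alpha>' s * (\<integral>\<^sup>+\<alpha>. cA s \<alpha> * (\<integral>\<^sup>+b. cB \<alpha> s b * f (\<alpha>, b, s) \<partial>\<mu>b) \<partial>\<mu>a) \<partial>\<mu>s)"
  proof (intro nn_integral_cong)
    fix s assume [measurable]: "s \<in> space \<mu>s"
    have "(\<integral>\<^sup>+b. cS \<alpha>' s * (cA s \<alpha> * (cB \<alpha> s b * f (\<alpha>, b, s))) \<partial>\<mu>b) =
        cS \<alpha>' s * (cA s \<alpha> * (\<integral>\<^sup>+b. cB \<alpha> s b * f (\<alpha>, b, s) \<partial>\<mu>b))"
      if [measurable]: "\<alpha> \<in> space \<mu>a" for \<alpha>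
      by (simp add: nn_integral_cmult)
    then have "(\<integral>\<^sup>+\<alpha>. \<integral>\<^sup>+b. cS \<alpha>' s * (cA s \<alpha> * (cB \<alpha> s b * f (\<alpha>, b, s))) \<partial>\<mu>b \<partial>\<mu>a) =
        (\<integral>\<^sup>+\<alpha>. cS \<alpha>' s * (cA s \<alpha> * (\<integral>\<^sup>+b. cB \<alpha> s b * f (\<alpha>, b, s) \<partial>\<mu>b)) \<partial>\<mu>a)"
      by (intro nn_integral_cong)
    also have "\<dots> = cS \<alpha>' s * (\<integral>\<^sup>+\<alpha>. cA s \<alpha> * (\<integral>\<^sup>+b. cB \<alpha> s b * f (\<alpha>, b, s) \<partial>\<mu>b) \<partial>\<mu>a)"
      by (simp add: nn_integral_cmult)
    finally show "(\<integral>\<^sup>+\<alpha>. \<integral>\<^sup>+b. cS \<alpha>' s * (cA s \<alpha> * (cB \<alpha> s b * f (\<alpha>, b, s))) \<partial>\<mu>b \<partial>\<mu>a) =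
        cS \<alpha>' s * (\<integral>\<^sup>+\<alpha>. cA s \<alpha> * (\<integral>\<^sup>+b. cB \<alpha> s b * f (\<alpha>, b, s) \<partial>\<mu>b) \<partial>\<mu>a)" .
  qed
  finally show ?thesis .
qed

lemma nn_integral_stationary:
  assumes f: "f \<in> borel_measurable joint"
  shows "(\<integral>\<^sup>+z. f z \<partial>stationary) = (\<integral>\<^sup>+s. \<integral>\<^sup>+\<alpha>. \<integral>\<^sup>+b. p \<alpha> b s * f (\<alpha>, b, s) \<partial>\<mu>b \<partial>\<mu>a \<partial>\<mu>s)"
proof -
  note [measurable] = f
  have "(\<integral>\<^sup>+z. f z \<partial>stationary) = (\<integral>\<^sup>+z. (case z of (\<alpha>, b, s) \<Rightarrow> p \<alpha> b s) * f z \<partial>joint)"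
    unfolding stationary_def by (rule nn_integral_density) measurable
  also have "\<dots> = (\<integral>\<^sup>+s. \<integral>\<^sup>+\<alpha>. \<integral>\<^sup>+b. p \<alpha> b s * f (\<alpha>, b, s) \<partial>\<mu>b \<partial>\<mu>a \<partial>\<mu>s)"
    by (subst nn_integral_joint) auto
  finally show ?thesis .
qed

end

locale gibbs_sampler = three_block_density +
  assumes total: "(\<integral>\<^sup>+z. (case z of (\<alpha>, b, s) \<Rightarrow> p \<alpha> b s) \<partial>joint) = 1"
    and g_pos: "\<And>\<alpha> s. \<alpha> \<in> space \<mu>a \<Longrightarrow> s \<in> space \<mu>s \<Longrightarrow> 0 < g \<alpha> s \<and> g \<alpha> s < \<infinity>"
    and gS_pos: "\<And>\<alpha>. \<alpha> \<in> space \<mu>a \<Longrightarrow> 0 < (\<integral>\<^sup>+s. g \<alpha> s \<partial>\<mu>s) \<and> (\<integral>\<^sup>+s. g \<alpha> s \<partial>\<mu>s) < \<infinity>"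
    and gA_pos: "\<And>s. s \<in> space \<mu>s \<Longrightarrow> 0 < (\<integral>\<^sup>+\<alpha>. g \<alpha> s \<partial>\<mu>a) \<and> (\<integral>\<^sup>+\<alpha>. g \<alpha> s \<partial>\<mu>a) < \<infinity>"
begin

lemma cS_total: "\<alpha> \<in> space \<mu>a \<Longrightarrow> (\<integral>\<^sup>+s. cS \<alpha> s \<partial>\<mu>s) = 1"
  using gS_pos[of \<alpha>] unfolding cS_def
  by (subst nn_integral_divide) (auto intro!: ennreal_divide_self)

lemma cA_total: "s \<in> space \<mu>s \<Longrightarrow> (\<integral>\<^sup>+\<alpha>. cA s \<alpha> \<partial>\<mu>a) = 1"
  using gA_pos[of s] unfolding cA_def
  by (subst nn_integral_divide) (auto intro!: ennreal_divide_self)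

lemma cB_total: "\<alpha> \<in> space \<mu>a \<Longrightarrow> s \<in> space \<mu>s \<Longrightarrow> (\<integral>\<^sup>+b. cB \<alpha> s b \<partial>\<mu>b) = 1"
  using g_pos[of \<alpha> s] unfolding cB_def
  by (subst nn_integral_divide) (auto intro!: ennreal_divide_self simp: g_def[symmetric])

lemma nn_integral_step_alpha:
  assumes F[measurable]: "F \<in> borel_measurable \<mu>a" and \<alpha>': "\<alpha>' \<in> space \<mu>a"
  shows "(\<integral>\<^sup>+z. F (fst z) \<partial>step \<alpha>') = (\<integral>\<^sup>+s. cS \<alpha>' s * (\<integral>\<^sup>+\<alpha>. cA s \<alpha> * F \<alpha> \<partial>\<mu>a) \<partial>\<mu>s)"
proof -
  have "(\<integral>\<^sup>+b. cB \<alpha> s b * F \<alpha> \<partial>\<mu>b) = F \<alpha>"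
    if [measurable]: "\<alpha> \<in> space \<mu>a" "s \<in> space \<mu>s" for \<alpha> s
    using cB_total[OF that] by (simp add: nn_integral_multc)
  then show ?thesis
    using \<alpha>' by (subst nn_integral_step) (auto intro!: nn_integral_cong arg_cong2[where f = "(*)"])
qed

lemma prob_space_step: "\<alpha> \<in> space \<mu>a \<Longrightarrow> prob_space (step \<alpha>)"
proof (rule prob_spaceI)
  assume \<alpha>: "\<alpha> \<in> space \<mu>a"
  have "(\<integral>\<^sup>+z. 1 \<partial>step \<alpha>) = (\<integral>\<^sup>+s. cS \<alpha> s * (\<integral>\<^sup>+\<alpha>. cA s \<alpha> * 1 \<partial>\<mu>a) \<partial>\<mu>s)"
    by (rule nn_integral_step_alpha[OF _ \<alpha>]) simp
  also have "\<dots> = (\<integral>\<^sup>+s. cS \<alpha> s \<partial>\<mu>s)"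
    by (intro nn_integral_cong) (simp add: cA_total)
  also have "\<dots> = 1" by (rule cS_total[OF \<alpha>])
  finally show "emeasure (step \<alpha>) (space (step \<alpha>)) = 1" by simp
qed

lemma sets_step[simp]: "sets (step \<alpha>) = sets joint"
  by (simp add: step_def)

lemma step_measurable: "step \<in> \<mu>a \<rightarrow>\<^sub>M prob_algebra joint"
proof (intro measurable_prob_algebraI measurable_subprob_algebra)
  fix X assume [measurable]: "X \<in> sets joint"
  have "emeasure (step \<alpha>) X = (\<integral>\<^sup>+z. (case z of (\<alpha>', b, s) \<Rightarrow> cS \<alpha> s * cA s \<alpha>' * cB \<alpha>' s b) * indicator X z \<partial>joint)"
    if [measurable]: "\<alpha> \<in> space \<mu>a" for \<alpha>
    unfolding step_def by (rule emeasure_density) measurable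
  moreover have "(\<lambda>\<alpha>. \<integral>\<^sup>+z. (case z of (\<alpha>', b, s) \<Rightarrow> cS \<alpha> s * cA s \<alpha>' * cB \<alpha>' s b) * indicator X z \<partial>joint)
      \<in> borel_measurable \<mu>a"
  proof -
    interpret BS: pair_sigma_finite \<mu>b \<mu>s ..
    interpret ABS: pair_sigma_finite \<mu>a "\<mu>b \<Otimes>\<^sub>M \<mu>s" ..
    interpret J: sigma_finite_measure joint by (rule ABS.sigma_finite_measure_axioms)
    show ?thesis by measurable
  qed
  ultimately show "(\<lambda>\<alpha>. emeasure (step \<alpha>) X) \<in> borel_measurable \<mu>a"
    by (subst measurable_cong) auto
qed (auto intro: prob_space_step prob_space_imp_subprob_space)

lemma kern_fst: "kern z = step (fst z)"
  by (simp add: kern_def split: prod.split)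

lemma kern_measurable: "kern \<in> joint \<rightarrow>\<^sub>M prob_algebra joint"
  unfolding kern_fst[abs_def] by (rule measurable_compose[OF measurable_fst step_measurable])

lemma stationary_prob: "stationary \<in> space (prob_algebra joint)"
proof -
  have "emeasure stationary (space stationary) = (\<integral>\<^sup>+z. (case z of (\<alpha>, b, s) \<Rightarrow> p \<alpha> b s) * indicator (space joint) z \<partial>joint)"
    unfolding stationary_def by (subst emeasure_density) (auto intro!: nn_integral_cong)
  also have "\<dots> = 1"
    unfolding total[symmetric] by (intro nn_integral_cong) auto
  finally show ?thesis
    by (auto simp: space_prob_algebra stationary_def intro!: prob_spaceI)
qed

text \<open>
  The first block of the stationary law has density \<open>\<integral> g \<alpha> s ds\<close>. Multiplying it by the three conditional
  densities in turn cancels one normalising integral each time and ends at \<open>p\<close>.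
\<close>

lemma stationary_invariant: "stationary \<bind> kern = stationary"
proof (rule measure_eqI)
  show eq: "sets (stationary \<bind> kern) = sets stationary"
    using sets_bind'[OF stationary_prob kern_measurable] by (simp add: stationary_def)
  fix X assume "X \<in> sets (stationary \<bind> kern)"
  then have X[measurable]: "X \<in> sets joint" using eq by (simp add: stationary_def)
  define R where "R s = (\<integral>\<^sup>+\<alpha>. cA s \<alpha> * (\<integral>\<^sup>+b. cB \<alpha> s b * indicator X (\<alpha>, b, s) \<partial>\<mu>b) \<partial>\<mu>a)" for s
  define H where "H \<alpha>' = (\<integral>\<^sup>+s. cS \<alpha>' s * R s \<partial>\<mu>s)" for \<alpha>'
  have [measurable]: "R \<in> borel_measurable \<mu>s" unfolding R_def by measurable
  have [measurable]: "H \<in> borel_measurable \<mu>a" unfolding H_def by measurable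
  interpret AS: pair_sigma_finite \<mu>a \<mu>s ..
  have "emeasure (stationary \<bind> kern) X = (\<integral>\<^sup>+z. emeasure (kern z) X \<partial>stationary)"
    by (rule emeasure_bind_prob_algebra[OF stationary_prob kern_measurable X])
  also have "\<dots> = (\<integral>\<^sup>+z. H (fst z) \<partial>stationary)"
  proof (intro nn_integral_cong)
    fix z assume "z \<in> space stationary"
    then have "fst z \<in> space \<mu>a" by (auto simp: stationary_def space_pair_measure)
    then show "emeasure (kern z) X = H (fst z)"
      using nn_integral_step[of "indicator X" "fst z"] by (simp add: H_def R_def kern_fst)
  qed
  also have "\<dots> = (\<integral>\<^sup>+s. \<integral>\<^sup>+\<alpha>. g \<alpha> s * H \<alpha> \<partial>\<mu>a \<partial>\<mu>s)"
    by (subst nn_integral_stationary) (auto intro!: nn_integral_cong simp: nn_integral_multc g_def)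
  also have "\<dots> = (\<integral>\<^sup>+\<alpha>. \<integral>\<^sup>+s. g \<alpha> s * H \<alpha> \<partial>\<mu>s \<partial>\<mu>a)"
    by (rule AS.Fubini') measurable
  also have "\<dots> = (\<integral>\<^sup>+\<alpha>. \<integral>\<^sup>+s. g \<alpha> s * R s \<partial>\<mu>s \<partial>\<mu>a)"
  proof (rule nn_integral_cong)
    fix \<alpha> assume \<alpha>[measurable]: "\<alpha> \<in> space \<mu>a"
    let ?G = "\<integral>\<^sup>+s. g \<alpha> s \<partial>\<mu>s"
    have "(\<integral>\<^sup>+s. g \<alpha> s * H \<alpha> \<partial>\<mu>s) = ?G * H \<alpha>"
      by (simp add: nn_integral_multc)
    also have "\<dots> = (\<integral>\<^sup>+s. ?G * (cS \<alpha> s * R s) \<partial>\<mu>s)"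
      unfolding H_def by (simp add: nn_integral_cmult)
    also have "\<dots> = (\<integral>\<^sup>+s. g \<alpha> s * R s \<partial>\<mu>s)"
      using gS_pos[OF \<alpha>] unfolding cS_def
      by (intro nn_integral_cong) (simp add: mult.assoc[symmetric] ennreal_mult_divide_cancel)
    finally show "(\<integral>\<^sup>+s. g \<alpha> s * H \<alpha> \<partial>\<mu>s) = (\<integral>\<^sup>+s. g \<alpha> s * R s \<partial>\<mu>s)" .
  qed
  also have "\<dots> = (\<integral>\<^sup>+s. \<integral>\<^sup>+\<alpha>. g \<alpha> s * R s \<partial>\<mu>a \<partial>\<mu>s)"
    by (rule AS.Fubini'[symmetric]) measurable
  also have "\<dots> = (\<integral>\<^sup>+s. \<integral>\<^sup>+\<alpha>. \<integral>\<^sup>+b. p \<alpha> b s * indicator X (\<alpha>, b, s) \<partial>\<mu>b \<partial>\<mu>a \<partial>\<mu>s)"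
  proof (rule nn_integral_cong)
    fix s assume s[measurable]: "s \<in> space \<mu>s"
    let ?G = "\<integral>\<^sup>+\<alpha>. g \<alpha> s \<partial>\<mu>a"
    have "(\<integral>\<^sup>+\<alpha>. g \<alpha> s * R s \<partial>\<mu>a) = ?G * R s"
      by (simp add: nn_integral_multc)
    also have "\<dots> = (\<integral>\<^sup>+\<alpha>. ?G * (cA s \<alpha> * (\<integral>\<^sup>+b. cB \<alpha> s b * indicator X (\<alpha>, b, s) \<partial>\<mu>b)) \<partial>\<mu>a)"
      unfolding R_def by (simp add: nn_integral_cmult)
    also have "\<dots> = (\<integral>\<^sup>+\<alpha>. g \<alpha> s * (\<integral>\<^sup>+b. cB \<alpha> s b * indicator X (\<alpha>, b, s) \<partial>\<mu>b) \<partial>\<mu>a)"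
      using gA_pos[OF s] unfolding cA_def
      by (intro nn_integral_cong) (simp add: mult.assoc[symmetric] ennreal_mult_divide_cancel)
    also have "\<dots> = (\<integral>\<^sup>+\<alpha>. \<integral>\<^sup>+b. p \<alpha> b s * indicator X (\<alpha>, b, s) \<partial>\<mu>b \<partial>\<mu>a)"
    proof (intro nn_integral_cong)
      fix \<alpha> assume \<alpha>[measurable]: "\<alpha> \<in> space \<mu>a"
      have "g \<alpha> s * (\<integral>\<^sup>+b. cB \<alpha> s b * indicator X (\<alpha>, b, s) \<partial>\<mu>b) = (\<integral>\<^sup>+b. g \<alpha> s * (cB \<alpha> s b * indicator X (\<alpha>, b, s)) \<partial>\<mu>b)"
        by (simp add: nn_integral_cmult)
      also have "\<dots> = (\<integral>\<^sup>+b. p \<alpha> b s * indicator X (\<alpha>, b, s) \<partial>\<mu>b)"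
        using g_pos[OF \<alpha> s] unfolding cB_def
        by (intro nn_integral_cong) (simp add: mult.assoc[symmetric] ennreal_mult_divide_cancel)
      finally show "g \<alpha> s * (\<integral>\<^sup>+b. cB \<alpha> s b * indicator X (\<alpha>, b, s) \<partial>\<mu>b) = (\<integral>\<^sup>+b. p \<alpha> b s * indicator X (\<alpha>, b, s) \<partial>\<mu>b)" .
    qed
    finally show "(\<integral>\<^sup>+\<alpha>. g \<alpha> s * R s \<partial>\<mu>a) = (\<integral>\<^sup>+\<alpha>. \<integral>\<^sup>+b. p \<alpha> b s * indicator X (\<alpha>, b, s) \<partial>\<mu>b \<partial>\<mu>a)" .
  qed
  also have "\<dots> = (\<integral>\<^sup>+z. indicator X z \<partial>stationary)"
    by (rule nn_integral_stationary[symmetric]) measurable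
  also have "\<dots> = emeasure stationary X"
    by (rule nn_integral_indicator) (simp add: stationary_def)
  finally show "emeasure (stationary \<bind> kern) X = emeasure stationary X" .
qed

end

context gibbs_sampler
begin

text \<open>
  The first step reaches \<open>U\<close> with probability at least 1/2. From \<open>U\<close>, the second step draws \<open>s \<in> V\<close> with
  probability at least 1/2, and given such an \<open>s\<close> its density for \<open>\<alpha>\<close> is at least \<open>c\<close> on \<open>N\<close>. So after two
  steps the first block dominates \<open>c/4\<close> times the reference measure on \<open>N\<close>, and the third step carries
  this over to the full state.
\<close>

lemma kern_minorization:
  assumes U[measurable]: "U \<in> sets \<mu>a" and V[measurable]: "V \<in> sets \<mu>s" and N[measurable]: "N \<in> sets \<mu>a"
    and U_likely: "\<And>s. s \<in> space \<mu>s \<Longrightarrow> (\<integral>\<^sup>+\<alpha>. g \<alpha> s \<partial>\<mu>a) \<le> 2 * (\<integral>\<^sup>+\<alpha>. g \<alpha> s * indicator U \<alpha> \<partial>\<mu>a)"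
    and V_likely: "\<And>\<alpha>. \<alpha> \<in> space \<mu>a \<Longrightarrow> \<alpha> \<in> U \<Longrightarrow> (\<integral>\<^sup>+s. g \<alpha> s \<partial>\<mu>s) \<le> 2 * (\<integral>\<^sup>+s. g \<alpha> s * indicator V s \<partial>\<mu>s)"
    and N_dense: "\<And>s \<alpha>. s \<in> V \<Longrightarrow> \<alpha> \<in> N \<Longrightarrow> c * (\<integral>\<^sup>+u. g u s \<partial>\<mu>a) \<le> g \<alpha> s"
    and N_meas: "0 < emeasure \<mu>a N" "emeasure \<mu>a N < \<infinity>"
    and \<epsilon>: "4 * ennreal \<epsilon> \<le> c * emeasure \<mu>a N"
    and z: "z \<in> space joint" and f[measurable]: "f \<in> borel_measurable joint"
  shows "ennreal \<epsilon> * (\<integral>\<^sup>+y. f y \<partial>(uniform_measure \<mu>a N \<bind> step)) \<le> (\<integral>\<^sup>+y. f y \<partial>kernel_pow kern 3 z)"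
proof -
  define F where "F \<alpha> = (\<integral>\<^sup>+y. f y \<partial>step \<alpha>)" for \<alpha>
  have F[measurable]: "F \<in> borel_measurable \<mu>a"
    unfolding F_def
    by (rule measurable_compose[OF measurable_prob_algebraD[OF step_measurable] nn_integral_measurable_subprob_algebra[OF f]])
  define I where "I = (\<integral>\<^sup>+\<alpha>. F \<alpha> * indicator N \<alpha> \<partial>\<mu>a)"
  define G where "G \<alpha>' = (\<integral>\<^sup>+y. F (fst y) \<partial>step \<alpha>')" for \<alpha>'
  have G[measurable]: "G \<in> borel_measurable \<mu>a"
    unfolding G_def
    by (rule measurable_compose[OF measurable_prob_algebraD[OF step_measurable] nn_integral_measurable_subprob_algebra]) measurable
  have G_lower: "c * I \<le> 2 * G \<alpha>'" if \<alpha>'[measurable]: "\<alpha>' \<in> space \<mu>a" and U': "\<alpha>' \<in> U" for \<alpha>'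
  proof -
    have inner: "c * I \<le> (\<integral>\<^sup>+\<alpha>. cA s \<alpha> * F \<alpha> \<partial>\<mu>a)" if s: "s \<in> space \<mu>s" "s \<in> V" for s
    proof -
      have "c * I = (\<integral>\<^sup>+\<alpha>. c * (F \<alpha> * indicator N \<alpha>) \<partial>\<mu>a)"
        unfolding I_def by (simp add: nn_integral_cmult)
      also have "\<dots> \<le> (\<integral>\<^sup>+\<alpha>. cA s \<alpha> * F \<alpha> \<partial>\<mu>a)"
      proof (rule nn_integral_mono)
        fix \<alpha> assume \<alpha>: "\<alpha> \<in> space \<mu>a"
        have "c \<le> cA s \<alpha>" if "\<alpha> \<in> N"
        proof -
          let ?G = "\<integral>\<^sup>+u. g u s \<partial>\<mu>a"
          have "c = c * ?G / ?G"
            using gA_pos[OF s(1)] by (simp add: ennreal_mult_divide_cancel)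
          also have "\<dots> \<le> g \<alpha> s / ?G"
            by (rule divide_right_mono_ennreal[OF N_dense[OF s(2) that]])
          finally show ?thesis by (simp add: cA_def)
        qed
        then show "c * (F \<alpha> * indicator N \<alpha>) \<le> cA s \<alpha> * F \<alpha>"
          by (auto split: split_indicator intro: mult_right_mono)
      qed
      finally show ?thesis .
    qed
    have "1 \<le> 2 * ((\<integral>\<^sup>+s. g \<alpha>' s * indicator V s \<partial>\<mu>s) / (\<integral>\<^sup>+s. g \<alpha>' s \<partial>\<mu>s))"
      using gS_pos[OF \<alpha>'] V_likely[OF \<alpha>' U'] by (intro ennreal_one_le_mult_divide) auto
    also have "(\<integral>\<^sup>+s. g \<alpha>' s * indicator V s \<partial>\<mu>s) / (\<integral>\<^sup>+s. g \<alpha>' s \<partial>\<mu>s) = (\<integral>\<^sup>+s. cS \<alpha>' s * indicator V s \<partial>\<mu>s)"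
      unfolding cS_def by (subst nn_integral_divide[symmetric]) (auto simp: ennreal_divide_times ennreal_times_divide)
    finally have "c * I \<le> 2 * (\<integral>\<^sup>+s. cS \<alpha>' s * indicator V s \<partial>\<mu>s) * (c * I)"
      using mult_right_mono[of 1 _ "c * I"] by simp
    also have "\<dots> = 2 * (\<integral>\<^sup>+s. cS \<alpha>' s * indicator V s * (c * I) \<partial>\<mu>s)"
      by (subst nn_integral_multc) (auto simp: mult.assoc)
    also have "\<dots> \<le> 2 * (\<integral>\<^sup>+s. cS \<alpha>' s * (\<integral>\<^sup>+\<alpha>. cA s \<alpha> * F \<alpha> \<partial>\<mu>a) \<partial>\<mu>s)"
      using inner by (intro mult_left_mono nn_integral_mono) (auto split: split_indicator intro: mult_left_mono)
    also have "\<dots> = 2 * G \<alpha>'"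
      unfolding G_def by (simp add: nn_integral_step_alpha[OF F \<alpha>'])
    finally show ?thesis .
  qed
  have z1[measurable]: "fst z \<in> space \<mu>a" using z by (auto simp: space_pair_measure)
  have U_half: "1 \<le> 2 * (\<integral>\<^sup>+\<alpha>. cA s \<alpha> * indicator U \<alpha> \<partial>\<mu>a)" if s: "s \<in> space \<mu>s" for s
  proof -
    note [measurable] = s
    have "1 \<le> 2 * ((\<integral>\<^sup>+\<alpha>. g \<alpha> s * indicator U \<alpha> \<partial>\<mu>a) / (\<integral>\<^sup>+\<alpha>. g \<alpha> s \<partial>\<mu>a))"
      using gA_pos[OF s] U_likely[OF s] by (intro ennreal_one_le_mult_divide) auto
    also have "(\<integral>\<^sup>+\<alpha>. g \<alpha> s * indicator U \<alpha> \<partial>\<mu>a) / (\<integral>\<^sup>+\<alpha>. g \<alpha> s \<partial>\<mu>a) = (\<integral>\<^sup>+\<alpha>. cA s \<alpha> * indicator U \<alpha> \<partial>\<mu>a)"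
      unfolding cA_def by (subst nn_integral_divide[symmetric]) (auto simp: ennreal_divide_times ennreal_times_divide)
    finally show ?thesis .
  qed
  have inner2: "c * I \<le> 4 * (\<integral>\<^sup>+\<alpha>. cA s \<alpha> * G \<alpha> \<partial>\<mu>a)" if s[measurable]: "s \<in> space \<mu>s" for s
  proof -
    have "c * I \<le> 2 * (\<integral>\<^sup>+\<alpha>. cA s \<alpha> * indicator U \<alpha> \<partial>\<mu>a) * (c * I)"
      using mult_right_mono[OF U_half[OF s], of "c * I"] by simp
    also have "\<dots> = 2 * (\<integral>\<^sup>+\<alpha>. cA s \<alpha> * indicator U \<alpha> * (c * I) \<partial>\<mu>a)"
      by (subst nn_integral_multc) (auto simp: mult.assoc)
    also have "\<dots> \<le> 2 * (\<integral>\<^sup>+\<alpha>. cA s \<alpha> * (2 * G \<alpha>) \<partial>\<mu>a)"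
      using G_lower by (intro mult_left_mono nn_integral_mono) (auto split: split_indicator intro: mult_left_mono)
    also have "\<dots> = 2 * (\<integral>\<^sup>+\<alpha>. 2 * (cA s \<alpha> * G \<alpha>) \<partial>\<mu>a)"
      by (simp add: mult.left_commute)
    also have "\<dots> = 4 * (\<integral>\<^sup>+\<alpha>. cA s \<alpha> * G \<alpha> \<partial>\<mu>a)"
      by (subst nn_integral_cmult) (auto simp: mult.assoc[symmetric])
    finally show ?thesis .
  qed
  have "c * I = (\<integral>\<^sup>+s. cS (fst z) s * (c * I) \<partial>\<mu>s)"
    using cS_total[OF z1] by (simp add: nn_integral_multc)
  also have "\<dots> \<le> (\<integral>\<^sup>+s. cS (fst z) s * (4 * (\<integral>\<^sup>+\<alpha>. cA s \<alpha> * G \<alpha> \<partial>\<mu>a)) \<partial>\<mu>s)"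
    using inner2 by (intro nn_integral_mono mult_left_mono) auto
  also have "\<dots> = (\<integral>\<^sup>+s. 4 * (cS (fst z) s * (\<integral>\<^sup>+\<alpha>. cA s \<alpha> * G \<alpha> \<partial>\<mu>a)) \<partial>\<mu>s)"
    by (simp add: mult.left_commute)
  also have "\<dots> = 4 * (\<integral>\<^sup>+y. G (fst y) \<partial>step (fst z))"
    by (simp add: nn_integral_cmult nn_integral_step_alpha[OF G z1])
  also have "(\<integral>\<^sup>+y. G (fst y) \<partial>step (fst z)) = (\<integral>\<^sup>+y. f y \<partial>kernel_pow kern 3 z)"
    unfolding nn_integral_kernel_pow_3[OF kern_measurable z f] kern_fst G_def F_def ..
  finally have main: "c * I \<le> 4 * (\<integral>\<^sup>+y. f y \<partial>kernel_pow kern 3 z)" .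
  have "(\<integral>\<^sup>+y. f y \<partial>(uniform_measure \<mu>a N \<bind> step)) = (\<integral>\<^sup>+\<alpha>. F \<alpha> \<partial>uniform_measure \<mu>a N)"
    unfolding F_def using measurable_prob_algebraD[OF step_measurable]
    by (intro nn_integral_bind[OF f]) (simp cong: measurable_cong_sets)
  also have "\<dots> = I / emeasure \<mu>a N"
    unfolding I_def using N_meas by (intro nn_integral_uniform_measure) auto
  finally have "4 * ennreal \<epsilon> * (\<integral>\<^sup>+y. f y \<partial>(uniform_measure \<mu>a N \<bind> step)) \<le> c * emeasure \<mu>a N * (I / emeasure \<mu>a N)"
    using \<epsilon> by (simp add: mult_right_mono)
  also have "\<dots> = c * I"
    using N_meas by (simp add: mult.assoc ennreal_mult_divide_cancel)
  finally have "4 * (ennreal \<epsilon> * (\<integral>\<^sup>+y. f y \<partial>(uniform_measure \<mu>a N \<bind> step))) \<le> 4 * (\<integral>\<^sup>+y. f y \<partial>kernel_pow kern 3 z)"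
    using main by (simp add: mult.assoc order_trans)
  then show ?thesis
    by (subst (asm) ennreal_mult_le_mult_iff) auto
qed

lemma kern_geom_bounded:
  assumes U: "U \<in> sets \<mu>a" and V: "V \<in> sets \<mu>s" and N: "N \<in> sets \<mu>a"
    and U_likely: "\<And>s. s \<in> space \<mu>s \<Longrightarrow> (\<integral>\<^sup>+\<alpha>. g \<alpha> s \<partial>\<mu>a) \<le> 2 * (\<integral>\<^sup>+\<alpha>. g \<alpha> s * indicator U \<alpha> \<partial>\<mu>a)"
    and V_likely: "\<And>\<alpha>. \<alpha> \<in> space \<mu>a \<Longrightarrow> \<alpha> \<in> U \<Longrightarrow> (\<integral>\<^sup>+s. g \<alpha> s \<partial>\<mu>s) \<le> 2 * (\<integral>\<^sup>+s. g \<alpha> s * indicator V s \<partial>\<mu>s)"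
    and N_dense: "\<And>s \<alpha>. s \<in> V \<Longrightarrow> \<alpha> \<in> N \<Longrightarrow> c * (\<integral>\<^sup>+u. g u s \<partial>\<mu>a) \<le> g \<alpha> s"
    and N_meas: "0 < emeasure \<mu>a N" "emeasure \<mu>a N < \<infinity>"
    and \<epsilon>: "4 * ennreal \<epsilon> \<le> c * emeasure \<mu>a N" "0 \<le> \<epsilon>" "\<epsilon> < 1"
  shows "geom_bounded kern stationary (root 3 (1 - \<epsilon>))"
proof (rule doeblin_geom_bounded[OF kern_measurable _ stationary_prob stationary_invariant \<epsilon>(2,3)])
  have "uniform_measure \<mu>a N \<in> space (prob_algebra \<mu>a)"
    using N_meas by (auto simp: space_prob_algebra intro!: prob_space_uniform_measure)
  then show "uniform_measure \<mu>a N \<bind> step \<in> space (prob_algebra joint)"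
    using prob_space_bind'[OF _ step_measurable] sets_bind'[OF _ step_measurable] by (simp add: space_prob_algebra)
  show "ennreal \<epsilon> * (\<integral>\<^sup>+y. f y \<partial>(uniform_measure \<mu>a N \<bind> step)) \<le> (\<integral>\<^sup>+y. f y \<partial>kernel_pow kern 3 x)"
    if "x \<in> space joint" "f \<in> borel_measurable joint" for x f
    by (rule kern_minorization[OF U V N U_likely V_likely N_dense N_meas \<epsilon>(1) that])
qed simp

text \<open>
  Forgetting the second block, or the second and the third, leaves a chain that is driven by the same
  first block. The fixed values \<open>b0\<close> and \<open>s0\<close> fill the dropped blocks of a representative.
\<close>

lemma geom_bounded_marginals:
  assumes b: "geom_bounded kern stationary \<rho>"
  shows "geom_bounded (\<lambda>(\<alpha>', s'). density (\<mu>a \<Otimes>\<^sub>M \<mu>s) (\<lambda>(\<alpha>, s). cA s \<alpha> * cS \<alpha>' s))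
      (distr stationary (\<mu>a \<Otimes>\<^sub>M \<mu>s) (\<lambda>(\<alpha>, b, s). (\<alpha>, s))) \<rho>" (is "geom_bounded ?KG _ _")
    and "geom_bounded (\<lambda>\<alpha>'. density \<mu>a (\<lambda>\<alpha>. \<integral>\<^sup>+s. cA s \<alpha> * cS \<alpha>' s \<partial>\<mu>s))
      (distr stationary \<mu>a (\<lambda>(\<alpha>, b, s). \<alpha>)) \<rho>" (is "geom_bounded ?KA _ _")
proof -
  interpret AS: pair_sigma_finite \<mu>a \<mu>s ..
  have "space stationary \<noteq> {}"
    using stationary_prob by (auto simp: space_prob_algebra prob_space.not_empty)
  then obtain b0 s0 where b0[measurable]: "b0 \<in> space \<mu>b" and s0[measurable]: "s0 \<in> space \<mu>s"
    by (auto simp: stationary_def space_pair_measure)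
  show "geom_bounded ?KG (distr stationary (\<mu>a \<Otimes>\<^sub>M \<mu>s) (\<lambda>(\<alpha>, b, s). (\<alpha>, s))) \<rho>"
  proof (rule geom_bounded_lumped[where \<sigma> = "\<lambda>(\<alpha>, s). (\<alpha>, b0, s)", OF kern_measurable _ _ _ _ stationary_prob b])
    fix z assume z: "z \<in> space (\<mu>a \<Otimes>\<^sub>M \<mu>s)"
    then have z1[measurable]: "fst z \<in> space \<mu>a" by (auto simp: space_pair_measure)
    show "?KG z = distr (kern (case z of (\<alpha>, s) \<Rightarrow> (\<alpha>, b0, s))) (\<mu>a \<Otimes>\<^sub>M \<mu>s) (\<lambda>(\<alpha>, b, s). (\<alpha>, s))"
    proof (rule measure_eqI)
      fix X assume "X \<in> sets (?KG z)"
      then have X[measurable]: "X \<in> sets (\<mu>a \<Otimes>\<^sub>M \<mu>s)" by (simp split: prod.splits)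
      have "emeasure (?KG z) X = (\<integral>\<^sup>+w. (case w of (\<alpha>, s) \<Rightarrow> cA s \<alpha> * cS (fst z) s) * indicator X w \<partial>(\<mu>a \<Otimes>\<^sub>M \<mu>s))"
        unfolding case_prod_beta by (rule emeasure_density) measurable
      also have "\<dots> = (\<integral>\<^sup>+s. \<integral>\<^sup>+\<alpha>. cA s \<alpha> * cS (fst z) s * indicator X (\<alpha>, s) \<partial>\<mu>a \<partial>\<mu>s)"
        by (subst AS.nn_integral_snd[symmetric]) auto
      also have "\<dots> = (\<integral>\<^sup>+s. cS (fst z) s * (\<integral>\<^sup>+\<alpha>. cA s \<alpha> * (\<integral>\<^sup>+b. cB \<alpha> s b * indicator X (\<alpha>, s) \<partial>\<mu>b) \<partial>\<mu>a) \<partial>\<mu>s)"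
      proof (intro nn_integral_cong)
        fix s assume s[measurable]: "s \<in> space \<mu>s"
        have "(\<integral>\<^sup>+b. cB \<alpha> s b * indicator X (\<alpha>, s) \<partial>\<mu>b) = indicator X (\<alpha>, s)"
          if [measurable]: "\<alpha> \<in> space \<mu>a" for \<alpha>
          using cB_total[OF that s] by (simp add: nn_integral_multc)
        then have "(\<integral>\<^sup>+\<alpha>. cA s \<alpha> * (\<integral>\<^sup>+b. cB \<alpha> s b * indicator X (\<alpha>, s) \<partial>\<mu>b) \<partial>\<mu>a) =
            (\<integral>\<^sup>+\<alpha>. cA s \<alpha> * indicator X (\<alpha>, s) \<partial>\<mu>a)"
          by (intro nn_integral_cong) simp
        then show "(\<integral>\<^sup>+\<alpha>. cA s \<alpha> * cS (fst z) s * indicator X (\<alpha>, s) \<partial>\<mu>a) =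
            cS (fst z) s * (\<integral>\<^sup>+\<alpha>. cA s \<alpha> * (\<integral>\<^sup>+b. cB \<alpha> s b * indicator X (\<alpha>, s) \<partial>\<mu>b) \<partial>\<mu>a)"
          by (simp add: nn_integral_cmult[symmetric] mult.assoc mult.left_commute)
      qed
      also have "\<dots> = (\<integral>\<^sup>+w. indicator X (case w of (\<alpha>, b, s) \<Rightarrow> (\<alpha>, s)) \<partial>step (fst z))"
        using z1 by (subst nn_integral_step) auto
      also have "\<dots> = (\<integral>\<^sup>+w. indicator X w \<partial>distr (step (fst z)) (\<mu>a \<Otimes>\<^sub>M \<mu>s) (\<lambda>(\<alpha>, b, s). (\<alpha>, s)))"
        by (subst nn_integral_distr) (auto simp: step_def)
      also have "\<dots> = emeasure (distr (kern (case z of (\<alpha>, s) \<Rightarrow> (\<alpha>, b0, s))) (\<mu>a \<Otimes>\<^sub>M \<mu>s) (\<lambda>(\<alpha>, b, s). (\<alpha>, s))) X"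
        by (simp add: kern_fst split: prod.split)
      finally show "emeasure (?KG z) X = emeasure (distr (kern (case z of (\<alpha>, s) \<Rightarrow> (\<alpha>, b0, s))) (\<mu>a \<Otimes>\<^sub>M \<mu>s) (\<lambda>(\<alpha>, b, s). (\<alpha>, s))) X" .
    qed (simp split: prod.split)
  qed (auto simp: kern_fst)
  show "geom_bounded ?KA (distr stationary \<mu>a (\<lambda>(\<alpha>, b, s). \<alpha>)) \<rho>"
  proof (rule geom_bounded_lumped[where \<sigma> = "\<lambda>\<alpha>. (\<alpha>, b0, s0)", OF kern_measurable _ _ _ _ stationary_prob b])
    fix z assume z[measurable]: "z \<in> space \<mu>a"
    show "?KA z = distr (kern (z, b0, s0)) \<mu>a (\<lambda>(\<alpha>, b, s). \<alpha>)"
    proof (rule measure_eqI)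
      fix X assume "X \<in> sets (?KA z)"
      then have X[measurable]: "X \<in> sets \<mu>a" by simp
      have "emeasure (?KA z) X = (\<integral>\<^sup>+\<alpha>. (\<integral>\<^sup>+s. cA s \<alpha> * cS z s \<partial>\<mu>s) * indicator X \<alpha> \<partial>\<mu>a)"
        by (rule emeasure_density) measurable
      also have "\<dots> = (\<integral>\<^sup>+\<alpha>. \<integral>\<^sup>+s. cA s \<alpha> * cS z s * indicator X \<alpha> \<partial>\<mu>s \<partial>\<mu>a)"
        by (intro nn_integral_cong) (simp add: nn_integral_multc)
      also have "\<dots> = (\<integral>\<^sup>+s. \<integral>\<^sup>+\<alpha>. cA s \<alpha> * cS z s * indicator X \<alpha> \<partial>\<mu>a \<partial>\<mu>s)"
        by (rule AS.Fubini'[symmetric]) measurable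
      also have "\<dots> = (\<integral>\<^sup>+s. cS z s * (\<integral>\<^sup>+\<alpha>. cA s \<alpha> * indicator X \<alpha> \<partial>\<mu>a) \<partial>\<mu>s)"
        by (intro nn_integral_cong) (simp add: nn_integral_cmult[symmetric] mult.assoc mult.left_commute)
      also have "\<dots> = (\<integral>\<^sup>+w. indicator X (fst w) \<partial>step z)"
        using z by (subst nn_integral_step_alpha) auto
      also have "\<dots> = (\<integral>\<^sup>+w. indicator X w \<partial>distr (step z) \<mu>a fst)"
        by (subst nn_integral_distr) (auto simp: step_def)
      also have "\<dots> = emeasure (distr (kern (z, b0, s0)) \<mu>a (\<lambda>(\<alpha>, b, s). \<alpha>)) X"
        by (simp add: kern_fst case_prod_beta')
      finally show "emeasure (?KA z) X = emeasure (distr (kern (z, b0, s0)) \<mu>a (\<lambda>(\<alpha>, b, s). \<alpha>)) X" .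
    qed simp
  qed (auto simp: kern_fst)
qed

end

context three_block_density
begin

lemma g_divide:
  assumes c: "0 < c" "c < \<infinity>" and [measurable]: "\<alpha> \<in> space \<mu>a" "s \<in> space \<mu>s"
  shows "(\<integral>\<^sup>+b. p \<alpha> b s / c \<partial>\<mu>b) = g \<alpha> s / c"
  unfolding g_def by (rule nn_integral_divide) measurable

text \<open>
  Conditions for an unnormalised density transfer to the probability density, since all the integrals
  involved are divided by the same constant.
\<close>

lemma normalised_gibbs_sampler:
  fixes c :: ennreal
  defines "c \<equiv> \<integral>\<^sup>+z. (case z of (\<alpha>, b, s) \<Rightarrow> p \<alpha> b s) \<partial>joint"
  assumes c: "0 < c" "c < \<infinity>"
    and g_pos: "\<And>\<alpha> s. \<alpha> \<in> space \<mu>a \<Longrightarrow> s \<in> space \<mu>s \<Longrightarrow> 0 < g \<alpha> s \<and> g \<alpha> s < \<infinity>"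
    and gS_pos: "\<And>\<alpha>. \<alpha> \<in> space \<mu>a \<Longrightarrow> 0 < (\<integral>\<^sup>+s. g \<alpha> s \<partial>\<mu>s) \<and> (\<integral>\<^sup>+s. g \<alpha> s \<partial>\<mu>s) < \<infinity>"
    and gA_pos: "\<And>s. s \<in> space \<mu>s \<Longrightarrow> 0 < (\<integral>\<^sup>+\<alpha>. g \<alpha> s \<partial>\<mu>a) \<and> (\<integral>\<^sup>+\<alpha>. g \<alpha> s \<partial>\<mu>a) < \<infinity>"
  shows "gibbs_sampler \<mu>a \<mu>b \<mu>s (\<lambda>\<alpha> b s. p \<alpha> b s / c)"
proof -
  have quot: "0 < u / c \<and> u / c < \<infinity>" if "0 < u \<and> u < \<infinity>" for u
    using that c by (auto simp: ennreal_zero_less_divide ennreal_divide_eq_top_iff less_top[symmetric] zero_less_iff_neq_zero)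
  interpret P: three_block_density \<mu>a \<mu>b \<mu>s "\<lambda>\<alpha> b s. p \<alpha> b s / c"
    by unfold_locales measurable
  have Pg: "P.g \<alpha> s = g \<alpha> s / c" if "\<alpha> \<in> space \<mu>a" "s \<in> space \<mu>s" for \<alpha> s
    unfolding P.g_def by (rule g_divide[OF c that])
  have PS: "(\<integral>\<^sup>+s. P.g \<alpha> s \<partial>\<mu>s) = (\<integral>\<^sup>+s. g \<alpha> s \<partial>\<mu>s) / c" if [measurable]: "\<alpha> \<in> space \<mu>a" for \<alpha>
    using that by (subst nn_integral_divide[symmetric]) (auto intro!: nn_integral_cong Pg)
  have PA: "(\<integral>\<^sup>+\<alpha>. P.g \<alpha> s \<partial>\<mu>a) = (\<integral>\<^sup>+\<alpha>. g \<alpha> s \<partial>\<mu>a) / c" if [measurable]: "s \<in> space \<mu>s" for s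
    using that by (subst nn_integral_divide[symmetric]) (auto intro!: nn_integral_cong Pg)
  show ?thesis
  proof unfold_locales
    have "(\<integral>\<^sup>+z. (case z of (\<alpha>, b, s) \<Rightarrow> p \<alpha> b s / c) \<partial>joint) = (\<integral>\<^sup>+z. (case z of (\<alpha>, b, s) \<Rightarrow> p \<alpha> b s) / c \<partial>joint)"
      by (intro nn_integral_cong) auto
    also have "\<dots> = c / c" unfolding c_def by (rule nn_integral_divide) (rule p_measurable)
    also have "\<dots> = 1" using c by (simp add: ennreal_divide_self)
    finally show "(\<integral>\<^sup>+z. (case z of (\<alpha>, b, s) \<Rightarrow> p \<alpha> b s / c) \<partial>joint) = 1" .
  qed (use g_pos gS_pos gA_pos Pg PS PA quot in auto)
qed

end

section \<open>Symmetric matrices\<close>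

lemma inner_symmetric_matrix:
  fixes A :: "real^'k^'k"
  assumes "transpose A = A"
  shows "x \<bullet> (A *v y) = (A *v x) \<bullet> y"
  using assms by (metis dot_lmul_matrix vector_transpose_matrix)

text \<open>
  With \<open>x = A u\<close>, the form at \<open>u + t x\<close> equals \<open>2 t |x|^2 + t^2 (x \<bullet> A x)\<close>, which is negative for small negative
  \<open>t\<close> unless \<open>x = 0\<close>.
\<close>

lemma psd_form_zero_imp_kernel:
  fixes A :: "real^'k^'k"
  assumes sym: "transpose A = A" and psd: "\<And>x. 0 \<le> x \<bullet> (A *v x)" and u: "u \<bullet> (A *v u) = 0"
  shows "A *v u = 0"
proof (rule ccontr)
  assume nz: "A *v u \<noteq> 0"
  define x where "x = A *v u"
  define k where "k = x \<bullet> (A *v x)"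
  have pos: "0 < x \<bullet> x" using nz by (simp add: x_def)
  have quad: "0 \<le> 2 * t * (x \<bullet> x) + t\<^sup>2 * k" for t
  proof -
    have "0 \<le> (u + t *\<^sub>R x) \<bullet> (A *v (u + t *\<^sub>R x))" by (rule psd)
    also have "\<dots> = 2 * t * (x \<bullet> x) + t\<^sup>2 * k"
      using u inner_symmetric_matrix[OF sym, of u x]
      by (simp add: matrix_vector_right_distrib matrix_vector_mult_scaleR inner_add k_def
          power2_eq_square algebra_simps x_def[symmetric] inner_commute)
    finally show ?thesis .
  qed
  have k0: "0 \<le> k" unfolding k_def by (rule psd)
  \<comment> \<open>The denominator \<open>1 + k\<close> keeps the witness well defined when \<open>k = 0\<close>.\<close>
  define t where "t = - (x \<bullet> x) / (1 + k)"
  have "2 * (- a / u) * a + (- a / u)\<^sup>2 * k = (a\<^sup>2 / u) * (k / u - 2)" if "u \<noteq> 0" for a u :: real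
    using that by (simp add: power2_eq_square field_simps)
  from this[of "1 + k" "x \<bullet> x"] have "2 * t * (x \<bullet> x) + t\<^sup>2 * k = ((x \<bullet> x)\<^sup>2 / (1 + k)) * (k / (1 + k) - 2)"
    using k0 by (simp add: t_def)
  also have "\<dots> < 0"
    using pos k0 by (intro mult_pos_neg) (auto simp: field_simps)
  finally show False using quad[of t] by simp
qed

text \<open>
  The form attains its minimum \<open>c\<close> on the unit sphere at some \<open>u\<close>. Then \<open>A - c I\<close> is positive semidefinite
  and its form vanishes at \<open>u\<close>, so \<open>u\<close> is an eigenvector.
\<close>

lemma rayleigh_minimum_eigenvalue:
  fixes A :: "real^'k^'k"
  assumes sym: "transpose A = A"
  obtains c where "c \<in> eigenvalues A" "\<And>x. c * (x \<bullet> x) \<le> x \<bullet> (A *v x)"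
proof -
  have ne: "sphere 0 1 \<noteq> ({} :: (real^'k) set)"
    using vector_choose_size[of 1] by (auto simp: sphere_def dist_norm)
  have cont: "continuous_on (sphere 0 1) (\<lambda>x. x \<bullet> (A *v x))"
    by (intro continuous_intros linear_continuous_on matrix_vector_mul_bounded_linear)
  obtain u where u: "norm u = 1" and umin: "\<And>x. norm x = 1 \<Longrightarrow> u \<bullet> (A *v u) \<le> x \<bullet> (A *v x)"
    using continuous_attains_inf[OF compact_sphere ne cont] by auto
  define c where "c = u \<bullet> (A *v u)"
  have lower: "c * (x \<bullet> x) \<le> x \<bullet> (A *v x)" for x
  proof (cases "x = 0")
    case False
    have "c \<le> (x /\<^sub>R norm x) \<bullet> (A *v (x /\<^sub>R norm x))"
      unfolding c_def using False by (intro umin) simp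
    also have "\<dots> = (x \<bullet> (A *v x)) / (x \<bullet> x)"
      by (simp add: matrix_vector_mult_scaleR dot_square_norm power2_eq_square divide_inverse)
    finally show ?thesis using False by (simp add: field_simps)
  qed simp
  let ?B = "A - c *\<^sub>R mat 1"
  have Bv: "?B *v x = A *v x - c *\<^sub>R x" for x
    by (simp add: matrix_vector_mult_diff_rdistrib scaleR_matrix_vector_assoc[symmetric])
  have "transpose ?B = ?B"
    using sym by (simp add: transpose_def vec_eq_iff mat_def)
  moreover have "0 \<le> x \<bullet> (?B *v x)" for x
    using lower[of x] by (simp add: Bv inner_diff_right)
  moreover have "u \<bullet> (?B *v u) = 0"
    using u unfolding Bv inner_diff_right by (simp add: c_def dot_square_norm)
  ultimately have "?B *v u = 0" by (rule psd_form_zero_imp_kernel)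
  then have "c \<in> eigenvalues A"
    using u by (auto simp: Bv eigenvalues_def intro!: exI[of _ u])
  then show ?thesis using lower that by blast
qed

text \<open>
  Eigenvectors of distinct eigenvalues are orthogonal, hence linearly independent.
\<close>

lemma finite_eigenvalues:
  fixes A :: "real^'k^'k"
  assumes sym: "transpose A = A"
  shows "finite (eigenvalues A)"
proof -
  obtain v where v: "\<And>c. c \<in> eigenvalues A \<Longrightarrow> v c \<noteq> 0 \<and> A *v v c = c *\<^sub>R v c"
    using bchoice[of "eigenvalues A" "\<lambda>c v. v \<noteq> 0 \<and> A *v v = c *\<^sub>R v"] by (auto simp: eigenvalues_def)
  have orth: "v c \<bullet> v d = 0" if "c \<in> eigenvalues A" "d \<in> eigenvalues A" "c \<noteq> d" for c d
  proof -
    have "c * (v c \<bullet> v d) = d * (v c \<bullet> v d)"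
      using inner_symmetric_matrix[OF sym, of "v c" "v d"] v that by simp
    then show ?thesis using that(3) by simp
  qed
  have inj: "inj_on v (eigenvalues A)"
    using orth v by (intro inj_onI) (metis inner_eq_zero_iff)
  have "independent (v ` eigenvalues A)"
    using orth v by (intro pairwise_orthogonal_independent) (auto simp: pairwise_def orthogonal_def)
  then have "finite (v ` eigenvalues A)" by (rule independent_imp_finite)
  then show ?thesis using inj by (rule finite_imageD)
qed

lemma gamma_min_le_form:
  fixes A :: "real^'k^'k"
  assumes sym: "transpose A = A"
  shows "gamma_min A * (x \<bullet> x) \<le> x \<bullet> (A *v x)"
proof -
  obtain c where c: "c \<in> eigenvalues A" "c * (x \<bullet> x) \<le> x \<bullet> (A *v x)"
    using rayleigh_minimum_eigenvalue[OF sym] by metis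
  have "gamma_min A \<le> c"
    unfolding gamma_min_def using c finite_eigenvalues[OF sym] by simp
  then show ?thesis using c(2) mult_right_mono[of "gamma_min A" c "x \<bullet> x"] by simp
qed

lemma form_le_gamma_max:
  fixes A :: "real^'k^'k"
  assumes sym: "transpose A = A"
  shows "x \<bullet> (A *v x) \<le> gamma_max A * (x \<bullet> x)"
proof -
  have neg: "(- A) *v y = - (A *v y)" for y
    using scaleR_matrix_vector_assoc[of "-1" A y] by simp
  have "transpose (- A) = - A"
    using sym by (simp add: transpose_def vec_eq_iff)
  then obtain c where c: "c \<in> eigenvalues (- A)" "c * (x \<bullet> x) \<le> x \<bullet> ((- A) *v x)"
    using rayleigh_minimum_eigenvalue by metis
  have "- c \<in> eigenvalues A"
    using c(1) by (auto simp: eigenvalues_def neg) (metis neg minus_equation_iff scaleR_minus_left)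
  then have "- c \<le> gamma_max A"
    unfolding gamma_max_def using finite_eigenvalues[OF sym] by simp
  then show ?thesis
    using c(2) mult_right_mono[of "- c" "gamma_max A" "x \<bullet> x"] by (simp add: neg)
qed

section \<open>Positive definite matrices\<close>

lemma sym_pos_def_sym: "sym_pos_def S \<Longrightarrow> transpose S = S"
  by (simp add: sym_pos_def_def)

lemma sym_pos_def_pos: "sym_pos_def S \<Longrightarrow> x \<noteq> 0 \<Longrightarrow> 0 < x \<bullet> (S *v x)"
  by (simp add: sym_pos_def_def)

lemma sym_pos_def_nonneg: "sym_pos_def S \<Longrightarrow> 0 \<le> x \<bullet> (S *v x)"
  by (cases "x = 0") (auto simp: sym_pos_def_def less_imp_le)

text \<open>
  The minimum eigenvalue is a constant of coercivity, and it is positive because its eigenvector has a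
  positive form.
\<close>

lemma sym_pos_def_coercive:
  fixes S :: "real^'k^'k"
  assumes "sym_pos_def S"
  obtains c where "0 < c" "\<And>x. c * (x \<bullet> x) \<le> x \<bullet> (S *v x)"
proof -
  obtain c where c: "c \<in> eigenvalues S" "\<And>x. c * (x \<bullet> x) \<le> x \<bullet> (S *v x)"
    using rayleigh_minimum_eigenvalue[OF sym_pos_def_sym[OF assms]] by metis
  from c(1) obtain v where v: "v \<noteq> 0" "S *v v = c *\<^sub>R v" by (auto simp: eigenvalues_def)
  then have "0 < c * (v \<bullet> v)" using sym_pos_def_pos[OF assms v(1)] by simp
  then have "0 < c" using v(1) by (metis inner_gt_zero_iff zero_less_mult_pos2)
  with c(2) that show ?thesis by blast
qed

lemma sym_pos_def_invertible:
  fixes S :: "real^'k^'k"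
  assumes "sym_pos_def S"
  shows "matrix_inv S ** S = mat 1" "S ** matrix_inv S = mat 1" "det S \<noteq> 0"
proof -
  have "x = 0" if "S *v x = 0" for x
    using sym_pos_def_pos[OF assms, of x] that by auto
  then have "invertible S"
    by (metis invertible_left_inverse matrix_left_invertible_ker)
  then show "matrix_inv S ** S = mat 1" "S ** matrix_inv S = mat 1" "det S \<noteq> 0"
    using someI_ex[of "\<lambda>A'. S ** A' = mat 1 \<and> A' ** S = mat 1"]
    by (auto simp: matrix_inv_def invertible_def invertible_det_nz[symmetric])
qed

text \<open>
  Take a largest set that is orthonormal for the inner product \<open>x \<bullet> S y\<close>. It spans the space, since
  otherwise the normalised remainder of some vector could be added, and expanding \<open>S\<^sup>-\<^sup>1 z\<close> in it gives the
  claim. Writing the inverse as a sum of \<open>b b\<^sup>T\<close> turns traces against it into sums of squares.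
\<close>

lemma inverse_sum_of_squares:
  fixes S :: "real^'k^'k"
  assumes S: "sym_pos_def S"
  obtains B where "finite B" "\<And>z. matrix_inv S *v z = (\<Sum>b\<in>B. (b \<bullet> z) *\<^sub>R b)"
proof -
  define good where "good B \<longleftrightarrow> finite B \<and> (\<forall>b\<in>B. b \<bullet> (S *v b) = 1) \<and>
      (\<forall>b\<in>B. \<forall>b'\<in>B. b \<noteq> b' \<longrightarrow> b \<bullet> (S *v b') = 0)" for B :: "(real^'k) set"
  note sym = inner_symmetric_matrix[OF sym_pos_def_sym[OF S]]
  have coeff: "b \<bullet> (S *v (\<Sum>b'\<in>B. f b' *\<^sub>R b')) = f b" if "good B" "b \<in> B" for f and B :: "(real^'k) set" and b
  proof -
    have "b \<bullet> (S *v (\<Sum>b'\<in>B. f b' *\<^sub>R b')) = (\<Sum>b'\<in>B. f b' * (b \<bullet> (S *v b')))"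
      by (simp add: linear_sum[OF matrix_vector_mul_linear] inner_sum_right matrix_vector_mult_scaleR)
    also have "\<dots> = (\<Sum>b'\<in>B. if b' = b then f b else 0)"
      using that by (intro sum.cong) (auto simp: good_def)
    also have "\<dots> = f b" using that by (simp add: good_def)
    finally show ?thesis .
  qed
  have "card B \<le> DIM(real^'k)" if g: "good B" for B :: "(real^'k) set"
  proof -
    have "independent B"
    proof (rule independent_if_scalars_zero)
      show "finite B" using g by (simp add: good_def)
      fix f b assume "(\<Sum>b'\<in>B. f b' *\<^sub>R b') = 0" "b \<in> B"
      then show "f b = 0" using coeff[OF g, of b f] by simp
    qed
    then show ?thesis using independent_bound by blast
  qed
  then have bdd: "\<forall>B. good B \<longrightarrow> card B < Suc (DIM(real^'k))" by (simp add: less_Suc_eq_le)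
  have "good {}" by (simp add: good_def)
  then obtain B where B: "good B" "\<And>B'. good B' \<Longrightarrow> card B' \<le> card B"
    using ex_has_greatest_nat[of good "{}" card, OF _ bdd] by blast
  have expand: "x = (\<Sum>b\<in>B. (b \<bullet> (S *v x)) *\<^sub>R b)" for x
  proof (rule ccontr)
    define y where "y = x - (\<Sum>b\<in>B. (b \<bullet> (S *v x)) *\<^sub>R b)"
    assume "x \<noteq> (\<Sum>b\<in>B. (b \<bullet> (S *v x)) *\<^sub>R b)"
    then have "y \<noteq> 0" by (simp add: y_def)
    define l where "l = y \<bullet> (S *v y)"
    have l: "0 < l" unfolding l_def using sym_pos_def_pos[OF S \<open>y \<noteq> 0\<close>] .
    define u where "u = (1 / sqrt l) *\<^sub>R y"
    have orth: "b \<bullet> (S *v y) = 0" if "b \<in> B" for b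
      using coeff[OF B(1) that, of "\<lambda>b. b \<bullet> (S *v x)"]
      by (simp add: y_def matrix_vector_mult_diff_distrib inner_diff_right)
    have u1: "u \<bullet> (S *v u) = 1"
      using l by (simp add: u_def matrix_vector_mult_scaleR l_def[symmetric])
    have u0: "b \<bullet> (S *v u) = 0" "u \<bullet> (S *v b) = 0" if "b \<in> B" for b
      using orth[OF that] sym[of y b] by (auto simp: u_def matrix_vector_mult_scaleR inner_commute)
    have "u \<notin> B" using u0 u1 by fastforce
    moreover have "good (insert u B)"
      using B(1) u0 u1 by (auto simp: good_def)
    ultimately have "Suc (card B) \<le> card B"
      using B(2)[of "insert u B"] B(1) by (simp add: good_def)
    then show False by simp
  qed
  have "matrix_inv S *v z = (\<Sum>b\<in>B. (b \<bullet> z) *\<^sub>R b)" for z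
    using expand[of "matrix_inv S *v z"]
    by (simp add: matrix_vector_mul_assoc sym_pos_def_invertible[OF S])
  then show ?thesis using that B(1) by (auto simp: good_def)
qed

lemma continuous_on_det:
  fixes F :: "'a::topological_space \<Rightarrow> real^'k^'k"
  assumes "continuous_on T F"
  shows "continuous_on T (\<lambda>x. det (F x))"
  unfolding det_def by (intro continuous_intros assms)

text \<open>
  The segment from the identity to \<open>S\<close> stays in the positive definite matrices, where the determinant
  has no zero, and it starts at \<open>det I = 1\<close>.
\<close>

lemma sym_pos_def_det_pos:
  fixes S :: "real^'k^'k"
  assumes S: "sym_pos_def S"
  shows "0 < det S"
proof (rule ccontr)
  assume neg: "\<not> 0 < det S"
  define F where "F t = t *\<^sub>R S + (1 - t) *\<^sub>R mat 1" for t :: real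
  have Fx: "F t *v x = t *\<^sub>R (S *v x) + (1 - t) *\<^sub>R x" for t x
    by (simp add: F_def matrix_vector_mult_add_rdistrib scaleR_matrix_vector_assoc[symmetric])
  have F: "sym_pos_def (F t)" if "0 \<le> t" "t \<le> 1" for t
  proof -
    have "transpose (F t) = F t"
      using sym_pos_def_sym[OF S] by (simp add: F_def transpose_def vec_eq_iff mat_def)
    moreover have "0 < x \<bullet> (F t *v x)" if "x \<noteq> 0" for x
    proof (cases "t = 0")
      case False
      then show ?thesis
        using sym_pos_def_pos[OF S that] \<open>0 \<le> t\<close> \<open>t \<le> 1\<close>
        by (auto simp: Fx inner_add_right intro!: add_pos_nonneg mult_pos_pos)
    qed (use that in \<open>simp add: Fx\<close>)
    ultimately show ?thesis by (simp add: sym_pos_def_def)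
  qed
  have "continuous_on {0..1} (\<lambda>t. det (F t))"
    unfolding F_def by (intro continuous_on_det continuous_intros)
  moreover have "det (F 1) \<le> 0" "0 \<le> det (F 0)"
    using neg by (auto simp: F_def)
  ultimately obtain t where "0 \<le> t" "t \<le> 1" "det (F t) = 0"
    using IVT2'[of "\<lambda>t. det (F t)" 1 0 0] by auto
  then show False using sym_pos_def_invertible(3)[OF F] by blast
qed

lemma abs_det_le:
  fixes A :: "real^'k^'k"
  assumes "\<And>i j. \<bar>A $ i $ j\<bar> \<le> c"
  shows "\<bar>det A\<bar> \<le> fact CARD('k) * c ^ CARD('k)"
proof -
  have "\<bar>det A\<bar> \<le> (\<Sum>p\<in>{p. p permutes (UNIV :: 'k set)}. \<bar>of_int (sign p) * (\<Prod>i\<in>UNIV. A $ i $ p i)\<bar>)"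
    unfolding det_def by (rule sum_abs)
  also have "\<dots> \<le> (\<Sum>p\<in>{p. p permutes (UNIV :: 'k set)}. c ^ CARD('k))"
  proof (intro sum_mono)
    fix p :: "'k \<Rightarrow> 'k"
    have "\<bar>\<Prod>i\<in>UNIV. A $ i $ p i\<bar> \<le> (\<Prod>i\<in>(UNIV :: 'k set). c)"
      unfolding abs_prod using assms by (intro prod_mono) auto
    then show "\<bar>of_int (sign p) * (\<Prod>i\<in>UNIV. A $ i $ p i)\<bar> \<le> c ^ CARD('k)"
      by (simp add: abs_mult sign_def)
  qed
  also have "\<dots> = fact CARD('k) * c ^ CARD('k)"
    by (simp add: card_permutations)
  finally show ?thesis .
qed

lemma trace_inner_axis: "trace A = (\<Sum>i\<in>UNIV. axis i 1 \<bullet> (A *v axis i (1::real)))"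
  by (simp add: trace_def matrix_vector_mult_basis inner_axis' column_def)

lemma entry_inner_axis: "axis i 1 \<bullet> (A *v axis j (1::real)) = A $ i $ j"
  by (simp add: matrix_vector_mult_basis inner_axis' column_def)

lemma spd_entry_le_trace:
  fixes S :: "real^'k^'k"
  assumes S: "sym_pos_def S"
  shows "\<bar>S $ i $ j\<bar> \<le> trace S" "0 \<le> S $ i $ i" "0 < trace S"
proof -
  have diag: "0 < S $ i $ i" for i
    using sym_pos_def_pos[OF S, of "axis i 1"] by (simp add: entry_inner_axis axis_eq_0_iff)
  show "0 \<le> S $ i $ i" using diag by (simp add: less_imp_le)
  show tr: "0 < trace S" unfolding trace_def using diag by (intro sum_pos) auto
  have le: "S $ i $ i \<le> trace S" for i
    unfolding trace_def using diag by (intro member_le_sum) (auto intro: less_imp_le)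
  have sym: "S $ j $ i = S $ i $ j"
    using arg_cong[OF sym_pos_def_sym[OF S], of "\<lambda>A. A $ i $ j"] by (simp add: transpose_def)
  have "0 \<le> (axis i 1 + axis j 1) \<bullet> (S *v (axis i 1 + axis j 1))"
       "0 \<le> (axis i 1 - axis j 1) \<bullet> (S *v (axis i 1 - axis j 1))"
    using sym_pos_def_nonneg[OF S] by blast+
  then have "0 \<le> S $ i $ i + S $ j $ j + 2 * S $ i $ j" "0 \<le> S $ i $ i + S $ j $ j - 2 * S $ i $ j"
    using sym by (simp_all add: inner_add_left inner_diff_left inner_add_right inner_diff_right
      matrix_vector_right_distrib matrix_vector_mult_diff_distrib entry_inner_axis)
  then show "\<bar>S $ i $ j\<bar> \<le> trace S" using le[of i] le[of j] by (simp add: abs_le_iff)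
qed

lemma sym_pos_def_matrix_inv:
  fixes S :: "real^'k^'k"
  assumes S: "sym_pos_def S"
  shows "sym_pos_def (matrix_inv S)"
proof -
  let ?P = "matrix_inv S"
  have "transpose ?P = ?P"
  proof -
    have "transpose ?P ** S = mat 1"
      using arg_cong[OF sym_pos_def_invertible(2)[OF S], of transpose] sym_pos_def_sym[OF S]
      by (simp add: matrix_transpose_mul)
    then have "transpose ?P ** S ** ?P = ?P" by simp
    then show ?thesis
      by (simp add: matrix_mul_assoc[symmetric] sym_pos_def_invertible[OF S])
  qed
  moreover have "0 < x \<bullet> (?P *v x)" if "x \<noteq> 0" for x
  proof -
    let ?y = "?P *v x"
    have x: "S *v ?y = x" by (simp add: matrix_vector_mul_assoc sym_pos_def_invertible[OF S])
    with that have "?y \<noteq> 0" by auto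
    from sym_pos_def_pos[OF S this] show ?thesis by (simp add: x inner_commute)
  qed
  ultimately show ?thesis by (simp add: sym_pos_def_def)
qed

lemma form_le_entries:
  fixes A :: "real^'k^'k" and c :: real
  assumes c: "\<And>i j. \<bar>A $ i $ j\<bar> \<le> c"
  shows "x \<bullet> (A *v x) \<le> CARD('k) * c * (x \<bullet> x)"
proof -
  have c0: "0 \<le> c" using c[of undefined undefined] by linarith
  have "x \<bullet> (A *v x) = (\<Sum>i\<in>UNIV. \<Sum>j\<in>UNIV. x $ i * A $ i $ j * x $ j)"
    by (simp add: inner_vec_def matrix_vector_mult_def sum_distrib_left mult.assoc)
  also have "\<dots> \<le> (\<Sum>i\<in>UNIV. \<Sum>j\<in>UNIV. c * (((x $ i)\<^sup>2 + (x $ j)\<^sup>2) / 2))"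
  proof (intro sum_mono)
    fix i j
    have "x $ i * A $ i $ j * x $ j \<le> \<bar>A $ i $ j\<bar> * \<bar>x $ i * x $ j\<bar>"
      using abs_ge_self[of "x $ i * A $ i $ j * x $ j"] by (simp add: abs_mult mult_ac)
    also have "\<dots> \<le> c * (((x $ i)\<^sup>2 + (x $ j)\<^sup>2) / 2)"
      using c[of i j] c0 sum_squares_bound[of "\<bar>x $ i\<bar>" "\<bar>x $ j\<bar>"]
      by (intro mult_mono) (auto simp: abs_mult)
    finally show "x $ i * A $ i $ j * x $ j \<le> c * (((x $ i)\<^sup>2 + (x $ j)\<^sup>2) / 2)" .
  qed
  also have "\<dots> = c * (\<Sum>i\<in>UNIV. \<Sum>j\<in>UNIV. ((x $ i)\<^sup>2 + (x $ j)\<^sup>2) / 2)"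
    by (simp only: sum_distrib_left)
  also have "(\<Sum>i\<in>UNIV. \<Sum>j\<in>UNIV. ((x $ i)\<^sup>2 + (x $ j)\<^sup>2) / 2) = CARD('k) * (x \<bullet> x)"
    by (simp add: inner_vec_def sum.distrib sum_divide_distrib[symmetric] sum_distrib_left[symmetric] power2_eq_square)
  finally show ?thesis by (simp add: mult_ac)
qed

lemma form_le_trace:
  fixes S :: "real^'k^'k"
  assumes S: "sym_pos_def S"
  shows "x \<bullet> (S *v x) \<le> CARD('k) * trace S * (x \<bullet> x)"
  by (rule form_le_entries) (rule spd_entry_le_trace(1)[OF S])

text \<open>
  The Cauchy-Schwarz inequality for \<open>S\<^sup>-\<^sup>1\<close>, applied to \<open>x\<close> and \<open>S x\<close>, reads
  \<open>|x|^4 \<le> (x \<bullet> S\<^sup>-\<^sup>1 x) (x \<bullet> S x)\<close>, and \<open>x \<bullet> S x\<close> is at most a multiple of \<open>tr S |x|^2\<close>.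
\<close>

lemma inner_le_trace_inverse_form:
  fixes S :: "real^'k^'k"
  assumes S: "sym_pos_def S"
  shows "x \<bullet> x \<le> CARD('k) * trace S * (x \<bullet> (matrix_inv S *v x))"
proof -
  obtain B where B: "finite B" "\<And>z. matrix_inv S *v z = (\<Sum>b\<in>B. (b \<bullet> z) *\<^sub>R b)"
    using inverse_sum_of_squares[OF S] by metis
  have form: "y \<bullet> (matrix_inv S *v z) = (\<Sum>b\<in>B. (b \<bullet> y) * (b \<bullet> z))" for y z
    by (simp add: B inner_sum_right inner_commute mult.commute)
  let ?q = "x \<bullet> (matrix_inv S *v x)"
  have "(x \<bullet> x)\<^sup>2 = (\<Sum>b\<in>B. (b \<bullet> x) * (b \<bullet> (S *v x)))\<^sup>2"
    using form[of x "S *v x"] by (simp add: matrix_vector_mul_assoc sym_pos_def_invertible[OF S])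
  also have "\<dots> \<le> (\<Sum>b\<in>B. (b \<bullet> x)\<^sup>2) * (\<Sum>b\<in>B. (b \<bullet> (S *v x))\<^sup>2)"
    by (rule Cauchy_Schwarz_ineq_sum)
  also have "(\<Sum>b\<in>B. (b \<bullet> x)\<^sup>2) = ?q"
    by (simp add: form power2_eq_square)
  also have "(\<Sum>b\<in>B. (b \<bullet> (S *v x))\<^sup>2) = x \<bullet> (S *v x)"
    using form[of "S *v x" "S *v x"]
    by (simp add: power2_eq_square matrix_vector_mul_assoc sym_pos_def_invertible[OF S] inner_commute)
  finally have "(x \<bullet> x)\<^sup>2 \<le> ?q * (x \<bullet> (S *v x))" .
  also have "\<dots> \<le> ?q * (CARD('k) * trace S * (x \<bullet> x))"
    using form_le_trace[OF S] sym_pos_def_nonneg[OF sym_pos_def_matrix_inv[OF S]]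
    by (intro mult_left_mono)
  finally have "(x \<bullet> x) * (x \<bullet> x) \<le> (CARD('k) * trace S * ?q) * (x \<bullet> x)"
    by (simp add: power2_eq_square mult_ac)
  then show ?thesis
    by (cases "x = 0") (auto dest: mult_right_le_imp_le)
qed

text \<open>
  Compare \<open>1 + y\<close> with a multiple of \<open>exp (s y / j)\<close> and take \<open>j\<close>-th powers.
\<close>

lemma one_plus_power_le_exp:
  fixes s :: real
  assumes s: "0 < s"
  obtains c where "1 \<le> c" "\<And>y. 0 \<le> y \<Longrightarrow> (1 + y) ^ j \<le> c * exp (s * y)"
proof (cases "j = 0")
  case True
  have "(1::real) \<le> 1 * exp (s * y)" if "0 \<le> y" for y using s that by simp
  then show ?thesis using that[of 1] True by simp
next
  case False
  define d where "d = min 1 (s / j)"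
  have d: "0 < d" "d \<le> 1" "d \<le> s / j" using s False by (auto simp: d_def)
  have "(1 + y) ^ j \<le> (1 / d) ^ j * exp (s * y)" if y: "0 \<le> y" for y
  proof -
    have "d * y \<le> s / j * y" using d y by (intro mult_right_mono) auto
    then have "d * (1 + y) \<le> 1 + s * y / j" using d by (simp add: algebra_simps)
    also have "\<dots> \<le> exp (s * y / j)" by (rule exp_ge_add_one_self)
    finally have "(d * (1 + y)) ^ j \<le> exp (s * y / j) ^ j"
      using d y by (intro power_mono) auto
    also have "\<dots> = exp (s * y)" using False by (simp flip: exp_of_nat_mult)
    finally have "d ^ j * (1 + y) ^ j \<le> exp (s * y)" by (simp only: power_mult_distrib)
    then have "(1 / d) ^ j * (d ^ j * (1 + y) ^ j) \<le> (1 / d) ^ j * exp (s * y)"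
      using d by (intro mult_left_mono) auto
    moreover have "(1 / d) ^ j * d ^ j = 1"
      using d(1) by (simp flip: power_mult_distrib)
    ultimately show ?thesis
      by (simp only: mult.assoc[symmetric] mult_1)
  qed
  moreover have "1 \<le> (1 / d) ^ j" using d by (intro one_le_power) simp
  ultimately show ?thesis using that by blast
qed

text \<open>
  By Cramer's rule, both \<open>det S\<^sup>-\<^sup>1\<close> and \<open>S $ i $ i * det S\<^sup>-\<^sup>1\<close> are determinants whose entries are at most
  \<open>1 + tr S\<^sup>-\<^sup>1\<close>, so \<open>(1 + tr S) det S\<^sup>-\<^sup>1\<close> grows at most polynomially in \<open>tr S\<^sup>-\<^sup>1\<close>. This lets the factor
  \<open>exp (- s tr S\<^sup>-\<^sup>1)\<close> of an inverse Wishart density absorb the growth of its determinant near singular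
  matrices and still leave decay at infinity.
\<close>

lemma trace_le_exp_trace_inverse:
  fixes s :: real
  assumes s: "0 < s"
  obtains c where "1 \<le> c"
    "\<And>S :: real^'k^'k. sym_pos_def S \<Longrightarrow> 1 + trace S \<le> c * exp (s * trace (matrix_inv S)) * det S"
proof -
  let ?r = "CARD('k)"
  obtain c' where c': "1 \<le> c'" "\<And>t. 0 \<le> t \<Longrightarrow> (1 + t) ^ ?r \<le> c' * exp (s * t)"
    using one_plus_power_le_exp[OF s] by blast
  define c where "c = (1 + real ?r) * fact ?r * c'"
  have "1 \<le> (1 + real ?r) * fact ?r"
  proof -
    have "(1::real) \<le> 1 * fact ?r" using fact_ge_1[of ?r, where 'a = real] by simp
    also have "\<dots> \<le> (1 + real ?r) * fact ?r" by (intro mult_right_mono) auto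
    finally show ?thesis .
  qed
  then have "1 * 1 \<le> (1 + real ?r) * fact ?r * c'" using c'(1) by (intro mult_mono) auto
  then have "1 \<le> c" unfolding c_def by (simp only: mult_1)
  moreover have "1 + trace S \<le> c * exp (s * trace (matrix_inv S)) * det S" if S: "sym_pos_def S" for S :: "real^'k^'k"
  proof -
    let ?P = "matrix_inv S"
    note P = sym_pos_def_matrix_inv[OF S]
    define \<tau> where "\<tau> = 1 + trace ?P"
    have \<tau>: "1 \<le> \<tau>" unfolding \<tau>_def using spd_entry_le_trace(3)[OF P] by simp
    have dets: "det ?P * det S = 1"
      using arg_cong[OF sym_pos_def_invertible(1)[OF S], of det] by (simp add: det_mul)
    have ent: "\<bar>?P $ i $ j\<bar> \<le> \<tau>" for i j
      using spd_entry_le_trace(1)[OF P, of i j] by (simp add: \<tau>_def)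
    have "S $ i $ i * det ?P \<le> fact ?r * \<tau> ^ ?r" for i
    proof -
      let ?x = "S *v axis i 1"
      have x: "?P *v ?x = axis i 1" "?x $ i = S $ i $ i"
        by (simp_all add: matrix_vector_mul_assoc sym_pos_def_invertible[OF S])
           (simp add: matrix_vector_mult_basis column_def)
      have "S $ i $ i * det ?P = det ((\<chi> k j. if j = i then axis i 1 $ k else ?P $ k $ j) :: real^'k^'k)"
        using cramer_lemma[of i ?P ?x, unfolded x] by (rule sym)
      also have "\<dots> \<le> \<bar>\<dots>\<bar>" by (rule abs_ge_self)
      also have "\<dots> \<le> fact ?r * \<tau> ^ ?r"
        using ent \<tau> by (intro abs_det_le) (auto simp: axis_def)
      finally show ?thesis .
    qed
    then have "trace S * det ?P \<le> ?r * (fact ?r * \<tau> ^ ?r)"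
      unfolding trace_def sum_distrib_right
      using sum_bounded_above[of UNIV "\<lambda>i. S $ i $ i * det ?P" "fact ?r * \<tau> ^ ?r"] by simp
    moreover have "det ?P \<le> fact ?r * \<tau> ^ ?r"
      using abs_det_le[of ?P \<tau>, OF ent] by simp
    ultimately have 1: "(1 + trace S) * det ?P \<le> (1 + real ?r) * fact ?r * \<tau> ^ ?r"
      by (simp add: algebra_simps)
    have "\<tau> ^ ?r \<le> c' * exp (s * trace ?P)"
      using c'(2)[of "trace ?P"] spd_entry_le_trace(3)[OF P] by (simp add: \<tau>_def)
    then have "(1 + real ?r) * fact ?r * \<tau> ^ ?r \<le> c * exp (s * trace ?P)"
      unfolding c_def mult.assoc by (intro mult_left_mono) auto
    with 1 have "(1 + trace S) * det ?P \<le> c * exp (s * trace ?P)" by simp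
    then have "(1 + trace S) * det ?P * det S \<le> c * exp (s * trace ?P) * det S"
      using sym_pos_def_det_pos[OF S] by (intro mult_right_mono) auto
    then show ?thesis using dets by (simp add: mult.assoc)
  qed
  ultimately show ?thesis by (rule that)
qed

section \<open>Integrability on Euclidean spaces\<close>

lemma nn_integral_lborel_affine:
  fixes f :: "'a::euclidean_space \<Rightarrow> ennreal"
  assumes f: "f \<in> borel_measurable borel" and c: "c \<noteq> 0"
  shows "(\<integral>\<^sup>+x. f x \<partial>lborel) = ennreal (\<bar>c\<bar> ^ DIM('a)) * (\<integral>\<^sup>+x. f (t + c *\<^sub>R x) \<partial>lborel)"
proof -
  note [measurable] = f
  have "(\<integral>\<^sup>+x. f x \<partial>lborel) = (\<integral>\<^sup>+x. f x \<partial>density (distr lborel borel (\<lambda>x. t + c *\<^sub>R x)) (\<lambda>_. \<bar>c\<bar>^DIM('a)))"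
    using lborel_affine[OF c, of t] by simp
  also have "\<dots> = ennreal (\<bar>c\<bar> ^ DIM('a)) * (\<integral>\<^sup>+x. f (t + c *\<^sub>R x) \<partial>lborel)"
    by (simp add: nn_integral_density nn_integral_distr nn_integral_cmult)
  finally show ?thesis .
qed

lemma prod_inverse_pointwise:
  fixes f :: "'b \<Rightarrow> real"
  shows "(\<Prod>b\<in>A. inverse (f b)) = inverse (\<Prod>b\<in>A. f b)"
  by (induction A rule: infinite_finite_induct) auto

lemma nn_integral_prod_cauchy_finite:
  "(\<integral>\<^sup>+(x::'a::euclidean_space). ennreal (\<Prod>b\<in>Basis. inverse (1 + (x \<bullet> b)\<^sup>2)) \<partial>lborel) < \<infinity>"
proof -
  have "integrable lborel (\<lambda>x::real. inverse (1 + x\<^sup>2))"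
    using integrable_inverse_1_plus_square by (simp add: set_integrable_def)
  then have 1: "(\<integral>\<^sup>+(x::real). ennreal (inverse (1 + x\<^sup>2)) \<partial>lborel) < \<infinity>"
    by (subst nn_integral_eq_integral) auto
  have "(\<integral>\<^sup>+(x::'a). ennreal (\<Prod>b\<in>Basis. inverse (1 + (x \<bullet> b)\<^sup>2)) \<partial>lborel) =
      (\<integral>\<^sup>+(x::'a). (\<Prod>b\<in>Basis. ennreal (inverse (1 + (x \<bullet> b)\<^sup>2))) \<partial>lborel)"
    by (subst prod_ennreal) auto
  also have "\<dots> = (\<Prod>b\<in>(Basis::'a set). (\<integral>\<^sup>+(x::real). ennreal (inverse (1 + x\<^sup>2)) \<partial>lborel))"
    by (rule nn_integral_lborel_prod) auto
  also have "\<dots> < \<infinity>" using 1 by (simp add: power_less_top_ennreal)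
  finally show ?thesis .
qed

text \<open>
  The integrand is at most the product of the Cauchy densities \<open>1 / (1 + x_b^2)\<close>, up to a constant factor.
\<close>

lemma nn_integral_decay_finite:
  "(\<integral>\<^sup>+(x::'a::euclidean_space). ennreal (inverse ((1 + x \<bullet> x) ^ DIM('a))) \<partial>lborel) < \<infinity>"
proof (rule le_less_trans[OF nn_integral_mono nn_integral_prod_cauchy_finite])
  fix x :: 'a
  have "(x \<bullet> b)\<^sup>2 \<le> x \<bullet> x" if "b \<in> Basis" for b
    using Basis_le_norm[OF that, of x] by (simp add: abs_le_square_iff[symmetric] dot_square_norm)
  then have "(\<Prod>b\<in>(Basis::'a set). (1 + (x \<bullet> b)\<^sup>2)) \<le> (\<Prod>b\<in>(Basis::'a set). 1 + x \<bullet> x)"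
    by (intro prod_mono) auto
  moreover have "0 < (\<Prod>b\<in>(Basis::'a set). (1 + (x \<bullet> b)\<^sup>2))"
    by (intro prod_pos) (simp add: add_pos_nonneg)
  ultimately have "inverse ((1 + x \<bullet> x) ^ DIM('a)) \<le> inverse (\<Prod>b\<in>(Basis::'a set). (1 + (x \<bullet> b)\<^sup>2))"
    by (intro le_imp_inverse_le) auto
  then show "ennreal (inverse ((1 + x \<bullet> x) ^ DIM('a))) \<le> ennreal (\<Prod>b\<in>(Basis::'a set). inverse (1 + (x \<bullet> b)\<^sup>2))"
    by (intro ennreal_leI) (simp add: prod_inverse_pointwise)
qed

lemma nn_integral_gaussian_finite:
  fixes s :: real
  assumes s: "0 < s"
  shows "(\<integral>\<^sup>+(x::'a::euclidean_space). ennreal (exp (- s * (x \<bullet> x))) \<partial>lborel) < \<infinity>"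
proof -
  obtain c where c: "1 \<le> c" "\<And>y. 0 \<le> y \<Longrightarrow> (1 + y) ^ DIM('a) \<le> c * exp (s * y)"
    using one_plus_power_le_exp[OF s] by blast
  have "(\<integral>\<^sup>+(x::'a). ennreal (exp (- s * (x \<bullet> x))) \<partial>lborel) \<le>
      (\<integral>\<^sup>+(x::'a). ennreal c * ennreal (inverse ((1 + x \<bullet> x) ^ DIM('a))) \<partial>lborel)"
  proof (intro nn_integral_mono)
    fix x :: 'a
    have "exp (- s * (x \<bullet> x)) \<le> c * inverse ((1 + x \<bullet> x) ^ DIM('a))"
    proof -
      have "0 < (1 + x \<bullet> x) ^ DIM('a)" by (intro zero_less_power) (simp add: add_pos_nonneg)
      then show ?thesis using c(2)[of "x \<bullet> x"] by (simp add: exp_minus field_simps)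
    qed
    then show "ennreal (exp (- s * (x \<bullet> x))) \<le> ennreal c * ennreal (inverse ((1 + x \<bullet> x) ^ DIM('a)))"
      using c(1) by (simp flip: ennreal_mult)
  qed
  also have "\<dots> = ennreal c * (\<integral>\<^sup>+(x::'a). ennreal (inverse ((1 + x \<bullet> x) ^ DIM('a))) \<partial>lborel)"
    by (rule nn_integral_cmult) measurable
  also have "\<dots> < \<infinity>"
    using nn_integral_decay_finite[where 'a = 'a] by (simp add: ennreal_mult_less_top)
  finally show ?thesis .
qed

lemma nn_integral_pos_of_pos:
  assumes f: "f \<in> borel_measurable M" and pos: "\<And>x. x \<in> space M \<Longrightarrow> 0 < f x"
    and M: "emeasure M (space M) \<noteq> 0"
  shows "0 < (\<integral>\<^sup>+x. f x \<partial>M)"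
proof (rule ccontr)
  assume "\<not> 0 < (\<integral>\<^sup>+x. f x \<partial>M)"
  then have "AE x in M. f x = 0" using nn_integral_0_iff_AE[OF f] by simp
  then have "AE x in M. False" using AE_space by eventually_elim (use pos in fastforce)
  then show False using M emeasure_eq_0_AE[of "\<lambda>_. True" M] by simp
qed

section \<open>Lebesgue measure on positive definite matrices\<close>

lemma continuous_on_transpose[continuous_intros]:
  fixes F :: "'a::topological_space \<Rightarrow> real^'k^'l"
  shows "continuous_on T F \<Longrightarrow> continuous_on T (\<lambda>x. transpose (F x))"
  unfolding transpose_def by (intro continuous_intros)

lemma continuous_on_matrix_vector_mult[continuous_intros]:
  fixes F :: "'a::topological_space \<Rightarrow> real^'k^'l"
  shows "continuous_on T F \<Longrightarrow> continuous_on T G \<Longrightarrow> continuous_on T (\<lambda>x. F x *v G x)"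
  unfolding matrix_vector_mult_def by (intro continuous_intros)

text \<open>
  Positive definiteness is uniform on the unit sphere, so the set is a countable union of the closed
  sets where the form is at least \<open>|x|^2 / (k + 1)\<close>.
\<close>

lemma sym_pos_def_borel[measurable]: "{S :: real^'k^'k. sym_pos_def S} \<in> sets borel"
proof -
  have eq: "{S :: real^'k^'k. sym_pos_def S} =
      (\<Union>n. {S. transpose S = S} \<inter> (\<Inter>x. {S. inverse (real (Suc n)) * (x \<bullet> x) \<le> x \<bullet> (S *v x)}))"
    (is "?L = (\<Union>n. ?R n)")
  proof (intro set_eqI iffI)
    fix S :: "real^'k^'k" assume "S \<in> ?L"
    then have S: "sym_pos_def S" by simp
    then obtain c where c: "0 < c" "\<And>x. c * (x \<bullet> x) \<le> x \<bullet> (S *v x)"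
      using sym_pos_def_coercive by blast
    obtain n where n: "inverse (real (Suc n)) < c" using reals_Archimedean[OF c(1)] by blast
    have "inverse (real (Suc n)) * (x \<bullet> x) \<le> x \<bullet> (S *v x)" for x
      using c(2)[of x] mult_right_mono[OF less_imp_le[OF n], of "x \<bullet> x"] by (simp del: of_nat_Suc)
    then show "S \<in> (\<Union>n. ?R n)" using sym_pos_def_sym[OF S] by blast
  next
    fix S :: "real^'k^'k" assume "S \<in> (\<Union>n. ?R n)"
    then obtain n where n: "transpose S = S" "\<And>x. inverse (real (Suc n)) * (x \<bullet> x) \<le> x \<bullet> (S *v x)" by blast
    have "0 < x \<bullet> (S *v x)" if "x \<noteq> 0" for x
    proof -
      have "0 < inverse (real (Suc n)) * (x \<bullet> x)" using that by (intro mult_pos_pos) auto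
      then show ?thesis using n(2)[of x] by linarith
    qed
    then show "S \<in> ?L" using n(1) by (simp add: sym_pos_def_def)
  qed
  have "closed (?R n)" for n
    by (intro closed_Int closed_INT ballI closed_Collect_eq closed_Collect_le continuous_intros)
  then show ?thesis unfolding eq by (intro sets.countable_UN) auto
qed

lemma sym_of_entries_measurable[measurable]: "sym_of_entries \<in> borel \<rightarrow>\<^sub>M borel"
  unfolding sym_of_entries_def by (intro borel_measurable_continuous_onI continuous_intros)

lemma space_spd_lborel[simp]: "space spd_lborel = {S :: real^'r^'r. sym_pos_def S}"
  by (simp add: spd_lborel_def space_restrict_space)

lemma sets_spd_lborel: "sets spd_lborel = sets (restrict_space borel {S :: real^'r^'r. sym_pos_def S})"
  by (simp add: spd_lborel_def sets_restrict_space)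

lemma measurable_spd_lborelI:
  "f \<in> restrict_space borel {S :: real^'r^'r. sym_pos_def S} \<rightarrow>\<^sub>M N \<Longrightarrow> f \<in> spd_lborel \<rightarrow>\<^sub>M N"
  using measurable_cong_sets[OF sets_spd_lborel refl] by blast

lemma continuous_on_spd_measurable:
  fixes f :: "real^'r^'r \<Rightarrow> 'b::topological_space"
  assumes "continuous_on {S. sym_pos_def S} f"
  shows "f \<in> spd_lborel \<rightarrow>\<^sub>M borel"
  by (intro measurable_spd_lborelI borel_measurable_continuous_on_restrict assms)

lemma nn_integral_spd_lborel:
  fixes f :: "real^'r^'r \<Rightarrow> ennreal"
  assumes f: "f \<in> borel_measurable spd_lborel"
  shows "(\<integral>\<^sup>+S. f S \<partial>spd_lborel) =
    (\<integral>\<^sup>+v. f (sym_of_entries v) * indicator {S. sym_pos_def S} (sym_of_entries v) \<partial>lborel)"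
proof -
  let ?P = "{S :: real^'r^'r. sym_pos_def S}"
  have "f \<in> borel_measurable (restrict_space borel ?P)"
    using f measurable_cong_sets[OF sets_spd_lborel refl] by blast
  then have m: "(\<lambda>S. f S * indicator ?P S) \<in> borel_measurable borel"
    by (subst (asm) borel_measurable_restrict_space_iff_ennreal) auto
  have "(\<integral>\<^sup>+S. f S \<partial>spd_lborel) = (\<integral>\<^sup>+S. f S * indicator ?P S \<partial>distr lborel borel sym_of_entries)"
    unfolding spd_lborel_def by (rule nn_integral_restrict_space) simp
  also have "\<dots> = (\<integral>\<^sup>+v. f (sym_of_entries v) * indicator ?P (sym_of_entries v) \<partial>lborel)"
    using m by (subst nn_integral_distr) auto
  finally show ?thesis .
qed

lemma continuous_on_trace[continuous_intros]:
  fixes F :: "'a::topological_space \<Rightarrow> real^'k^'k"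
  shows "continuous_on T F \<Longrightarrow> continuous_on T (\<lambda>x. trace (F x))"
  unfolding trace_def by (intro continuous_intros)

text \<open>
  Every entry of a positive definite matrix is at most its trace, so the integrand is dominated by the
  product over the free entries \<open>v\<close> of \<open>1 / (1 + v^2)\<close>.
\<close>

lemma nn_integral_spd_decay_finite:
  "(\<integral>\<^sup>+(S::real^'r^'r). ennreal (inverse ((1 + trace S) ^ (2 * CARD('r uprod)))) \<partial>spd_lborel) < \<infinity>"
proof -
  have m: "(\<lambda>S::real^'r^'r. ennreal (inverse ((1 + trace S) ^ (2 * CARD('r uprod))))) \<in> borel_measurable spd_lborel"
    by (intro measurable_compose[OF _ measurable_ennreal] continuous_on_spd_measurable continuous_intros)
       (auto dest: spd_entry_le_trace(3))
  have bound: "ennreal (inverse ((1 + trace (sym_of_entries v)) ^ (2 * CARD('r uprod)))) *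
      indicator {S :: real^'r^'r. sym_pos_def S} (sym_of_entries v)
      \<le> ennreal (\<Prod>b\<in>Basis. inverse (1 + (v \<bullet> b)\<^sup>2))" for v :: "real^'r uprod"
  proof (cases "sym_pos_def (sym_of_entries v :: real^'r^'r)")
    case True
    let ?t = "trace (sym_of_entries v :: real^'r^'r)"
    have t: "0 < ?t" by (rule spd_entry_le_trace(3)[OF True])
    have "1 + (v \<bullet> b)\<^sup>2 \<le> (1 + ?t)\<^sup>2" if b: "b \<in> Basis" for b :: "real^'r uprod"
    proof -
      obtain k where k: "b = axis k 1" using b by (auto simp: Basis_vec_def)
      obtain i j where ij: "k = Upair i j" by (cases k) auto
      have "\<bar>v \<bullet> b\<bar> \<le> ?t"
        using spd_entry_le_trace(1)[OF True, of i j] by (simp add: k ij inner_axis sym_of_entries_def)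
      then have "(v \<bullet> b)\<^sup>2 \<le> ?t\<^sup>2" using t by (simp add: abs_le_square_iff[symmetric])
      then show ?thesis using t by (simp add: power2_eq_square algebra_simps)
    qed
    then have "(\<Prod>b\<in>(Basis :: (real^'r uprod) set). 1 + (v \<bullet> b)\<^sup>2) \<le> (\<Prod>b\<in>(Basis :: (real^'r uprod) set). (1 + ?t)\<^sup>2)"
      by (intro prod_mono) auto
    also have "\<dots> = (1 + ?t) ^ (2 * CARD('r uprod))"
      by (simp add: power_mult)
    finally have le: "(\<Prod>b\<in>(Basis :: (real^'r uprod) set). 1 + (v \<bullet> b)\<^sup>2) \<le> (1 + ?t) ^ (2 * CARD('r uprod))" .
    have "0 < (\<Prod>b\<in>(Basis :: (real^'r uprod) set). (1 + (v \<bullet> b)\<^sup>2))"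
      by (intro prod_pos) (simp add: add_pos_nonneg)
    with le have "inverse ((1 + ?t) ^ (2 * CARD('r uprod))) \<le> inverse (\<Prod>b\<in>(Basis :: (real^'r uprod) set). (1 + (v \<bullet> b)\<^sup>2))"
      by (intro le_imp_inverse_le)
    then show ?thesis using True by (simp add: prod_inverse_pointwise ennreal_leI)
  qed simp
  show ?thesis
    unfolding nn_integral_spd_lborel[OF m]
    by (rule le_less_trans[OF nn_integral_mono[OF bound] nn_integral_prod_cauchy_finite])
qed

lemma trace_measurable[measurable]: "trace \<in> borel_measurable (spd_lborel :: (real^'r^'r) measure)"
  by (intro continuous_on_spd_measurable continuous_intros)

text \<open>
  The sets \<open>tr S \<le> k\<close> have finite measure, because the integrable function of
  \<open>nn_integral_spd_decay_finite\<close> is bounded below on them.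
\<close>

lemma sigma_finite_spd_lborel: "sigma_finite_measure (spd_lborel :: (real^'r^'r) measure)"
proof
  let ?M = "spd_lborel :: (real^'r^'r) measure"
  let ?A = "\<lambda>n::nat. {S \<in> space ?M. trace S \<le> real n}"
  let ?j = "2 * CARD('r uprod)"
  have m: "?A n \<in> sets ?M" for n by measurable
  have fin: "emeasure ?M (?A n) \<noteq> \<infinity>" for n
  proof -
    have "emeasure ?M (?A n) = (\<integral>\<^sup>+S. indicator (?A n) S \<partial>?M)"
      using m by simp
    also have "\<dots> \<le> (\<integral>\<^sup>+S. ennreal ((1 + n) ^ ?j) * ennreal (inverse ((1 + trace S) ^ ?j)) \<partial>?M)"
    proof (intro nn_integral_mono)
      fix S assume S: "S \<in> space ?M"
      show "indicator (?A n) S \<le> ennreal ((1 + n) ^ ?j) * ennreal (inverse ((1 + trace S) ^ ?j))"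
      proof (cases "trace S \<le> n")
        case True
        have t: "0 < trace S" using S spd_entry_le_trace(3) by auto
        have "(1 + trace S) ^ ?j \<le> (1 + real n) ^ ?j" using True t by (intro power_mono) auto
        then have "1 \<le> (1 + real n) ^ ?j * inverse ((1 + trace S) ^ ?j)"
          using t by (simp add: field_simps)
        then show ?thesis using t
          by (auto simp: indicator_def simp flip: ennreal_mult ennreal_1)
      qed simp
    qed
    also have "\<dots> = ennreal ((1 + n) ^ ?j) * (\<integral>\<^sup>+S. ennreal (inverse ((1 + trace S) ^ ?j)) \<partial>?M)"
      by (rule nn_integral_cmult) measurable
    also have "\<dots> < \<infinity>" using nn_integral_spd_decay_finite[where 'r = 'r] by (simp add: ennreal_mult_less_top)
    finally show ?thesis by simp
  qed
  show "\<exists>A. countable A \<and> A \<subseteq> sets ?M \<and> \<Union> A = space ?M \<and> (\<forall>a\<in>A. emeasure ?M a \<noteq> \<infinity>)"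
  proof (intro exI[of _ "range ?A"] conjI ballI)
    show "\<Union> (range ?A) = space ?M"
      using real_arch_simple by auto
  qed (use m fin in auto)
qed

lemma continuous_on_matrix_inv:
  "continuous_on {S :: real^'r^'r. sym_pos_def S} matrix_inv"
proof -
  have eq: "matrix_inv S = (\<chi> k l. det ((\<chi> i j. if j = k then axis l 1 $ i else S $ i $ j) :: real^'r^'r) / det S)"
    if S: "sym_pos_def S" for S :: "real^'r^'r"
  proof (unfold vec_eq_iff, intro allI)
    fix k l
    have "S *v (matrix_inv S *v axis l 1) = axis l 1"
      by (simp add: matrix_vector_mul_assoc sym_pos_def_invertible[OF S])
    then have "matrix_inv S *v axis l 1 = (\<chi> k. det ((\<chi> i j. if j = k then axis l 1 $ i else S $ i $ j) :: real^'r^'r) / det S)"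
      using cramer[OF sym_pos_def_invertible(3)[OF S]] by blast
    then have "(matrix_inv S *v axis l 1) $ k = det ((\<chi> i j. if j = k then axis l 1 $ i else S $ i $ j) :: real^'r^'r) / det S"
      by simp
    then show "matrix_inv S $ k $ l = (\<chi> k l. det ((\<chi> i j. if j = k then axis l 1 $ i else S $ i $ j) :: real^'r^'r) / det S) $ k $ l"
      by (simp add: matrix_vector_mult_basis column_def)
  qed
  have "continuous_on {S :: real^'r^'r. sym_pos_def S}
      (\<lambda>S. \<chi> k l. det ((\<chi> i j. if j = k then axis l 1 $ i else S $ i $ j) :: real^'r^'r) / det S)"
  proof (intro continuous_intros continuous_on_det)
    fix k l i j :: 'r
    show "continuous_on {S :: real^'r^'r. sym_pos_def S} (\<lambda>S. if j = k then axis l 1 $ i else S $ i $ j)"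
      by (cases "j = k") (auto intro!: continuous_intros)
  qed (auto dest: sym_pos_def_invertible(3))
  then show ?thesis
    by (rule continuous_on_eq) (auto simp: eq)
qed

lemma trace_matrix_inv_measurable[measurable]:
  "(\<lambda>S. trace (matrix_inv S)) \<in> borel_measurable (spd_lborel :: (real^'r^'r) measure)"
  by (intro continuous_on_spd_measurable continuous_intros continuous_on_matrix_inv)

text \<open>
  A neighbourhood of the identity consists of positive definite matrices, so the reference measure is
  not zero; hence one of the sets that exhaust the space is not null.
\<close>

lemma spd_trace_bounds_positive:
  obtains k where "1 \<le> k"
    "0 < emeasure (spd_lborel :: (real^'r^'r) measure) {S. sym_pos_def S \<and> trace S \<le> k \<and> trace (matrix_inv S) \<le> k}"
proof -
  let ?M = "spd_lborel :: (real^'r^'r) measure"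
  let ?A = "\<lambda>n::nat. {S \<in> space ?M. trace S \<le> 1 + real n \<and> trace (matrix_inv S) \<le> 1 + real n}"
  have m: "?A n \<in> sets ?M" for n by measurable
  have "emeasure ?M (space ?M) \<noteq> 0"
  proof -
    define v0 :: "real^'r uprod" where "v0 = (\<chi> k. case_uprod (Abs_commute (\<lambda>i j. if i = j then 1 else 0)) k)"
    have v0: "sym_of_entries v0 = mat 1"
      by (simp add: v0_def sym_of_entries_def mat_def vec_eq_iff Abs_commute_inverse)
    \<comment> \<open>A perturbation by \<open>\<delta>\<close> in each entry changes the form of the identity by at most \<open>|x|^2 / 2\<close>.\<close>
    define \<delta> where "\<delta> = 1 / (2 * real CARD('r))"
    have \<delta>: "0 < \<delta>" by (simp add: \<delta>_def)
    have spd: "sym_pos_def (sym_of_entries v :: real^'r^'r)" if v: "v \<in> ball v0 \<delta>" for v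
    proof -
      let ?S = "sym_of_entries v :: real^'r^'r"
      have ent: "\<bar>?S $ i $ j - mat 1 $ i $ j\<bar> \<le> \<delta>" for i j
      proof -
        have "\<bar>(v - v0) $ Upair i j\<bar> \<le> norm (v - v0)" by (rule component_le_norm_cart)
        also have "\<dots> \<le> \<delta>" using v by (simp add: dist_norm norm_minus_commute)
        finally show ?thesis using v0 by (simp add: sym_of_entries_def vec_eq_iff)
      qed
      have "transpose ?S = ?S" by (auto simp: transpose_def sym_of_entries_def vec_eq_iff intro!: arg_cong[where f = "($) v"])
      moreover have "0 < x \<bullet> (?S *v x)" if "x \<noteq> 0" for x
      proof -
        have "x \<bullet> x - x \<bullet> (?S *v x) = x \<bullet> ((mat 1 - ?S) *v x)"
          by (simp add: matrix_vector_mult_diff_rdistrib inner_diff_right)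
        also have "\<dots> \<le> CARD('r) * \<delta> * (x \<bullet> x)"
          using ent by (intro form_le_entries) (simp add: abs_minus_commute)
        finally have "x \<bullet> x - x \<bullet> (?S *v x) \<le> (x \<bullet> x) / 2" by (simp add: \<delta>_def)
        moreover have "0 < x \<bullet> x" using that by simp
        ultimately show ?thesis by linarith
      qed
      ultimately show ?thesis by (simp add: sym_pos_def_def)
    qed
    have "0 < emeasure lborel (ball v0 \<delta>)"
      using \<delta> by (simp add: emeasure_ball unit_ball_vol_pos zero_less_mult_iff)
    also have "\<dots> = (\<integral>\<^sup>+v. indicator (ball v0 \<delta>) v \<partial>lborel)" by simp
    also have "\<dots> \<le> (\<integral>\<^sup>+v. 1 * indicator {S :: real^'r^'r. sym_pos_def S} (sym_of_entries v) \<partial>lborel)"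
      using spd by (intro nn_integral_mono) (auto simp: indicator_def)
    also have "\<dots> = (\<integral>\<^sup>+S. 1 \<partial>?M)" by (rule nn_integral_spd_lborel[symmetric]) simp
    finally show ?thesis by simp
  qed
  moreover have "space ?M = (\<Union>n. ?A n)"
  proof -
    have "\<exists>n. trace S \<le> 1 + real n \<and> trace (matrix_inv S) \<le> 1 + real n" for S :: "real^'r^'r"
    proof -
      obtain n where "max (trace S) (trace (matrix_inv S)) \<le> real n" using real_arch_simple by blast
      then show ?thesis by (intro exI[of _ n]) auto
    qed
    then show ?thesis by auto
  qed
  ultimately have "emeasure ?M (\<Union>n. ?A n) \<noteq> 0" by metis
  then obtain n where "emeasure ?M (?A n) \<noteq> 0"
    using emeasure_UN_eq_0[of ?M ?A] m by blast
  then show ?thesis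
    using that[of "1 + real n"] by (simp add: zero_less_iff_neq_zero)
qed

section \<open>Regression with a well-conditioned design\<close>

lemma trace_mult_gram: "trace (P ** gram n w) = (\<Sum>t=1..int n. w t \<bullet> (P *v w t))"
proof -
  have "trace (P ** gram n w) = (\<Sum>i\<in>UNIV. \<Sum>k\<in>UNIV. \<Sum>t=1..int n. P $ i $ k * (w t $ k * w t $ i))"
    by (simp add: trace_def matrix_matrix_mult_def gram_def sum_distrib_left)
  also have "\<dots> = (\<Sum>t=1..int n. \<Sum>i\<in>UNIV. \<Sum>k\<in>UNIV. P $ i $ k * (w t $ k * w t $ i))"
    by (subst sum.swap, intro sum.cong refl, subst sum.swap, simp)
  also have "\<dots> = (\<Sum>t=1..int n. w t \<bullet> (P *v w t))"
    by (simp add: inner_vec_def matrix_vector_mult_def sum_distrib_left mult_ac)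
  finally show ?thesis .
qed

text \<open>
  A vector in the space of rows of \<open>W = [Y, Z, X]\<close>.
\<close>

definition blocks :: "real^'r::finite \<Rightarrow> real^('q::finite \<times> 'r) \<Rightarrow> real^'p::finite \<Rightarrow> real^('r + ('q \<times> 'r) + 'p)" where
  "blocks c d e = (\<chi> s. case s of Inl i \<Rightarrow> c $ i | Inr (Inl k) \<Rightarrow> d $ k | Inr (Inr i) \<Rightarrow> e $ i)"

lemma sum_UNIV_sum_type:
  fixes f :: "'a::finite + 'b::finite \<Rightarrow> real"
  shows "(\<Sum>s\<in>UNIV. f s) = (\<Sum>i\<in>UNIV. f (Inl i)) + (\<Sum>j\<in>UNIV. f (Inr j))"
  using sum.Plus[of "UNIV :: 'a set" "UNIV :: 'b set" f] by (simp add: UNIV_Plus_UNIV)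

lemma inner_blocks:
  "blocks c d e \<bullet> blocks c' d' e' = c \<bullet> c' + d \<bullet> d' + e \<bullet> e'"
  by (simp add: inner_vec_def sum_UNIV_sum_type blocks_def add.assoc)

lemma data_row_blocks: "data_row y x t = blocks (y t) (lags y t) (x t)"
  by (simp add: data_row_def blocks_def)

lemma unvec_inner: "unvec u \<bullet> unvec v = u \<bullet> v"
proof -
  have "unvec u \<bullet> unvec v = (\<Sum>k\<in>UNIV. \<Sum>c\<in>UNIV. u $ (c, k) * v $ (c, k))"
    by (simp add: inner_vec_def unvec_def)
  also have "\<dots> = (\<Sum>c\<in>UNIV. \<Sum>k\<in>UNIV. u $ (c, k) * v $ (c, k))" by (rule sum.swap)
  also have "\<dots> = (\<Sum>z\<in>UNIV \<times> UNIV. u $ z * v $ z)" by (simp add: sum.cartesian_product case_prod_beta)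
  finally show ?thesis by (simp add: inner_vec_def)
qed

lemma unvec_add: "unvec (u + v) = unvec u + unvec v"
  and unvec_scaleR: "unvec (c *\<^sub>R u) = c *\<^sub>R unvec u"
  by (simp_all add: unvec_def vec_eq_iff)

definition fitted :: "(int \<Rightarrow> real^'r) \<Rightarrow> (int \<Rightarrow> real^'p) \<Rightarrow>
    (real^('r \<times> ('q::{finite,linorder} \<times> 'r))) \<times> (real^'r^'p) \<Rightarrow> int \<Rightarrow> real^'r" where
  "fitted y x z t = lags y t v* unvec (fst z) + x t v* snd z"

lemma residual_fitted: "residual y x \<alpha> B t = y t - fitted y x (\<alpha>, B) t"
  by (simp add: residual_def fitted_def)

lemma inner_fitted: "b \<bullet> fitted y x z t = data_row y x t \<bullet> blocks 0 (unvec (fst z) *v b) (snd z *v b)"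
  by (simp add: data_row_blocks inner_blocks fitted_def inner_add_right dot_lmul_matrix[symmetric] inner_commute[of b])

lemma inner_residual:
  "b \<bullet> residual y x \<alpha> B t = data_row y x t \<bullet> blocks b (- (unvec \<alpha> *v b)) (- (B *v b))"
  by (simp add: residual_fitted inner_diff_right inner_fitted data_row_blocks inner_blocks inner_commute[of b])

lemma vector_matrix_mult_add_right: "x v* (A + B) = x v* A + x v* B"
  and vector_matrix_mult_scaleR_right: "x v* (c *\<^sub>R A) = c *\<^sub>R (x v* (A :: real^'a^'b))"
  by (simp_all add: vector_matrix_mult_def vec_eq_iff distrib_left sum.distrib sum_distrib_left mult_ac)

lemma fitted_add: "fitted y x (z + w) t = fitted y x z t + fitted y x w t"
  by (simp add: fitted_def unvec_add vector_matrix_mult_add_right)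

lemma fitted_scaleR: "fitted y x (c *\<^sub>R z) t = c *\<^sub>R fitted y x z t"
  by (simp add: fitted_def unvec_scaleR vector_matrix_mult_scaleR_right scaleR_add_right)

text \<open>
  The trace of \<open>V P V\<^sup>T\<close>.
\<close>

definition row_form :: "real^'r^'r \<Rightarrow> real^'r^'k \<Rightarrow> real" where
  "row_form P V = (\<Sum>i\<in>UNIV. V $ i \<bullet> (P *v V $ i))"

lemma row_form_upper:
  fixes P :: "real^'r^'r" and V :: "real^'r^'k"
  assumes "sym_pos_def P"
  shows "row_form P V \<le> CARD('r) * trace P * (V \<bullet> V)"
  unfolding row_form_def inner_vec_def[of V V] sum_distrib_left
  by (intro sum_mono form_le_trace assms)

lemma row_form_lower:
  fixes S :: "real^'r^'r" and V :: "real^'r^'k"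
  assumes "sym_pos_def S"
  shows "V \<bullet> V \<le> CARD('r) * trace S * row_form (matrix_inv S) V"
  unfolding row_form_def inner_vec_def[of V V] sum_distrib_left
  by (intro sum_mono inner_le_trace_inverse_form assms)

lemma row_form_nonneg: "sym_pos_def P \<Longrightarrow> 0 \<le> row_form P V"
  unfolding row_form_def by (intro sum_nonneg sym_pos_def_nonneg)

text \<open>
  The exponent of the likelihood, \<open>tr [S\<^sup>-\<^sup>1 E\<^sup>T E]\<close> for the residual matrix \<open>E\<close> at \<open>z = (\<alpha>, \<B>)\<close>.
\<close>

definition weighted_rss :: "nat \<Rightarrow> (int \<Rightarrow> real^'r) \<Rightarrow> (int \<Rightarrow> real^'p) \<Rightarrow> real^'r^'r \<Rightarrow>
    (real^('r \<times> ('q::{finite,linorder} \<times> 'r))) \<times> (real^'r^'p) \<Rightarrow> real" where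
  "weighted_rss n y x S z = (\<Sum>t=1..int n. residual y x (fst z) (snd z) t \<bullet> (matrix_inv S *v residual y x (fst z) (snd z) t))"

definition weighted_fit :: "nat \<Rightarrow> (int \<Rightarrow> real^'r) \<Rightarrow> (int \<Rightarrow> real^'p) \<Rightarrow> real^'r^'r \<Rightarrow>
    (real^('r \<times> ('q::{finite,linorder} \<times> 'r))) \<times> (real^'r^'p) \<Rightarrow> real" where
  "weighted_fit n y x S z = (\<Sum>t=1..int n. fitted y x z t \<bullet> (matrix_inv S *v fitted y x z t))"

lemma weighted_fit_scaleR: "weighted_fit n y x S (c *\<^sub>R z) = c\<^sup>2 * weighted_fit n y x S z"
  by (simp add: weighted_fit_def fitted_scaleR matrix_vector_mult_scaleR power2_eq_square sum_distrib_left mult.assoc)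

lemma weighted_fit_nonneg: "sym_pos_def S \<Longrightarrow> 0 \<le> weighted_fit n y x S z"
  unfolding weighted_fit_def by (intro sum_nonneg sym_pos_def_nonneg sym_pos_def_matrix_inv)

lemma inner_prod_pair: "(z :: 'a::real_inner \<times> 'b::real_inner) \<bullet> z = fst z \<bullet> fst z + snd z \<bullet> snd z"
  by (simp add: inner_prod_def)

text \<open>
  The Gram matrix of \<open>W\<close>, divided by \<open>n\<close>, has all its eigenvalues in \<open>[1/K, K]\<close>. The parameter \<open>Q\<close> carries
  the index type of the lags, which the types of \<open>y\<close> and \<open>x\<close> do not determine.
\<close>

locale design =
  fixes n :: nat and y :: "int \<Rightarrow> real^'r" and x :: "int \<Rightarrow> real^'p"
    and K :: real and Q :: "'q::{finite,linorder} itself"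
  assumes K: "1 \<le> K" and n: "1 \<le> n"
    and lower: "\<And>\<xi> :: real^('r + ('q \<times> 'r) + 'p).
      real n / K * (\<xi> \<bullet> \<xi>) \<le> (\<Sum>t=1..int n. (data_row y x t \<bullet> \<xi>)\<^sup>2)"
    and upper: "\<And>\<xi> :: real^('r + ('q \<times> 'r) + 'p).
      (\<Sum>t=1..int n. (data_row y x t \<bullet> \<xi>)\<^sup>2) \<le> K * real n * (\<xi> \<bullet> \<xi>)"
begin

abbreviation rss :: "real^'r^'r \<Rightarrow> (real^('r \<times> ('q \<times> 'r))) \<times> (real^'r^'p) \<Rightarrow> real" where
  "rss \<equiv> weighted_rss n y x"
abbreviation fit :: "real^'r^'r \<Rightarrow> (real^('r \<times> ('q \<times> 'r))) \<times> (real^'r^'p) \<Rightarrow> real" where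
  "fit \<equiv> weighted_fit n y x"

lemma form_as_squares:
  fixes S :: "real^'r^'r"
  assumes S: "sym_pos_def S" and F: "finite F" "\<And>z. matrix_inv S *v z = (\<Sum>b\<in>F. (b \<bullet> z) *\<^sub>R b)"
  shows "(\<Sum>t=1..int n. w t \<bullet> (matrix_inv S *v w t)) = (\<Sum>b\<in>F. \<Sum>t=1..int n. (b \<bullet> w t)\<^sup>2)"
    and "row_form (matrix_inv S) V = (\<Sum>b\<in>F. (V *v b) \<bullet> (V *v b))"
    and "trace (matrix_inv S) = (\<Sum>b\<in>F. b \<bullet> b)"
proof -
  have form: "v \<bullet> (matrix_inv S *v v) = (\<Sum>b\<in>F. (b \<bullet> v)\<^sup>2)" for v
    by (simp add: F(2) inner_sum_right power2_eq_square inner_commute)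
  show "(\<Sum>t=1..int n. w t \<bullet> (matrix_inv S *v w t)) = (\<Sum>b\<in>F. \<Sum>t=1..int n. (b \<bullet> w t)\<^sup>2)"
    unfolding form by (rule sum.swap)
  have "(V *v b) \<bullet> (V *v b) = (\<Sum>i\<in>UNIV. (b \<bullet> V $ i)\<^sup>2)" for b
    unfolding inner_vec_def[of "V *v b"] by (simp add: matrix_mult_dot power2_eq_square inner_commute)
  then show "row_form (matrix_inv S) V = (\<Sum>b\<in>F. (V *v b) \<bullet> (V *v b))"
    unfolding row_form_def form by (simp add: sum.swap[of _ F])
  show "trace (matrix_inv S) = (\<Sum>b\<in>F. b \<bullet> b)"
  proof -
    have "b \<bullet> b = (\<Sum>i\<in>UNIV. (b $ i)\<^sup>2)" for b :: "real^'r"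
      by (simp add: inner_vec_def power2_eq_square)
    then have sq: "\<And>b :: real^'r. b \<bullet> b = (\<Sum>i\<in>UNIV. (b $ i)\<^sup>2)" .
    show ?thesis
      unfolding trace_inner_axis form sq by (subst sum.swap) (simp add: inner_axis)
  qed
qed

text \<open>
  With \<open>S\<^sup>-\<^sup>1\<close> the sum of the \<open>b b\<^sup>T\<close>, the exponent is the sum over \<open>b\<close> of \<open>|W \<xi>\<^sub>b|^2\<close> with
  \<open>\<xi>\<^sub>b = (b, - \<A> b, - \<B> b)\<close>, so the bounds on \<open>|W \<xi>|^2\<close> apply term by term. Replacing \<open>S\<^sup>-\<^sup>1\<close> by its smallest
  eigenvalue would lose the summand \<open>tr S\<^sup>-\<^sup>1\<close>, which is needed against the determinant.
\<close>

lemma rss_bounds: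
  assumes S: "sym_pos_def S"
  shows "real n / K * (trace (matrix_inv S) + row_form (matrix_inv S) (unvec (fst z)) + row_form (matrix_inv S) (snd z)) \<le> rss S z"
    and "rss S z \<le> K * real n * (trace (matrix_inv S) + row_form (matrix_inv S) (unvec (fst z)) + row_form (matrix_inv S) (snd z))"
proof -
  obtain F where F: "finite F" "\<And>z. matrix_inv S *v z = (\<Sum>b\<in>F. (b \<bullet> z) *\<^sub>R b)"
    using inverse_sum_of_squares[OF S] by metis
  let ?\<xi> = "\<lambda>b. blocks b (- (unvec (fst z) *v b)) (- (snd z *v b)) :: real^('r + ('q \<times> 'r) + 'p)"
  have rss: "rss S z = (\<Sum>b\<in>F. \<Sum>t=1..int n. (data_row y x t \<bullet> ?\<xi> b)\<^sup>2)"
    unfolding weighted_rss_def form_as_squares(1)[OF S F] inner_residual ..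
  have sq: "trace (matrix_inv S) + row_form (matrix_inv S) (unvec (fst z)) + row_form (matrix_inv S) (snd z)
      = (\<Sum>b\<in>F. ?\<xi> b \<bullet> ?\<xi> b)"
    by (simp add: form_as_squares(2,3)[OF S F] inner_blocks sum.distrib)
  show "real n / K * (trace (matrix_inv S) + row_form (matrix_inv S) (unvec (fst z)) + row_form (matrix_inv S) (snd z)) \<le> rss S z"
    unfolding sq rss sum_distrib_left by (intro sum_mono lower)
  show "rss S z \<le> K * real n * (trace (matrix_inv S) + row_form (matrix_inv S) (unvec (fst z)) + row_form (matrix_inv S) (snd z))"
    unfolding sq rss sum_distrib_left by (intro sum_mono upper)
qed

text \<open>
  The argument of \<open>rss_bounds\<close> with \<open>0\<close> as the first block of \<open>\<xi>\<^sub>b\<close>. The row forms are comparable with the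
  squared norm of \<open>z\<close>, at the price of the traces.
\<close>

lemma fit_bounds:
  assumes S: "sym_pos_def S"
  shows "real n / (K * CARD('r) * trace S) * (z \<bullet> z) \<le> fit S z"
    and "fit S z \<le> K * real n * CARD('r) * trace (matrix_inv S) * (z \<bullet> z)"
proof -
  obtain F where F: "finite F" "\<And>z. matrix_inv S *v z = (\<Sum>b\<in>F. (b \<bullet> z) *\<^sub>R b)"
    using inverse_sum_of_squares[OF S] by metis
  let ?\<xi> = "\<lambda>b. blocks 0 (unvec (fst z) *v b) (snd z *v b) :: real^('r + ('q \<times> 'r) + 'p)"
  have fit: "fit S z = (\<Sum>b\<in>F. \<Sum>t=1..int n. (data_row y x t \<bullet> ?\<xi> b)\<^sup>2)"
    unfolding weighted_fit_def form_as_squares(1)[OF S F] inner_fitted ..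
  let ?R = "row_form (matrix_inv S) (unvec (fst z)) + row_form (matrix_inv S) (snd z)"
  have sq: "?R = (\<Sum>b\<in>F. ?\<xi> b \<bullet> ?\<xi> b)"
    by (simp add: form_as_squares(2,3)[OF S F] inner_blocks sum.distrib)
  have zz: "z \<bullet> z = unvec (fst z) \<bullet> unvec (fst z) + snd z \<bullet> snd z"
    by (simp add: unvec_inner inner_prod_pair)
  have t: "0 < trace S" by (rule spd_entry_le_trace(3)[OF S])
  have "real n / (K * CARD('r) * trace S) * (z \<bullet> z) \<le> real n / (K * CARD('r) * trace S) * (CARD('r) * trace S * ?R)"
    unfolding zz using row_form_lower[OF S, of "unvec (fst z)"] row_form_lower[OF S, of "snd z"] t K
    by (intro mult_left_mono) (auto simp: distrib_left)
  also have "\<dots> = real n / K * ?R" using t by simp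
  also have "\<dots> \<le> fit S z" unfolding sq fit sum_distrib_left by (intro sum_mono lower)
  finally show "real n / (K * CARD('r) * trace S) * (z \<bullet> z) \<le> fit S z" .
  have "fit S z \<le> K * real n * ?R" unfolding sq fit sum_distrib_left by (intro sum_mono upper)
  also have "\<dots> \<le> K * real n * (CARD('r) * trace (matrix_inv S) * (z \<bullet> z))"
    unfolding zz
    using row_form_upper[OF sym_pos_def_matrix_inv[OF S], of "unvec (fst z)"]
      row_form_upper[OF sym_pos_def_matrix_inv[OF S], of "snd z"] K
    by (intro mult_left_mono) (auto simp: distrib_left)
  finally show "fit S z \<le> K * real n * CARD('r) * trace (matrix_inv S) * (z \<bullet> z)" by (simp add: mult.assoc)
qed

text \<open>
  Regressing each column of \<open>Y\<close> on \<open>[Z, X]\<close> gives a centre that does not depend on \<open>S\<close>, with residuals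
  orthogonal to all fitted values. Its size is bounded because, for the \<open>j\<close>-th column with coefficients
  \<open>\<beta>\<^sub>j\<close>, \<open>n/K (1 + |\<beta>\<^sub>j|^2) \<le> |Y\<^sub>j - [Z, X] \<beta>\<^sub>j|^2 \<le> |Y\<^sub>j|^2 \<le> K n\<close>.
\<close>

lemma least_squares:
  obtains zh :: "(real^('r \<times> ('q \<times> 'r))) \<times> (real^'r^'p)"
  where "\<And>S z. sym_pos_def S \<Longrightarrow> rss S z = rss S zh + fit S (z - zh)"
    and "fst zh \<bullet> fst zh \<le> CARD('r) * K\<^sup>2"
proof -
  define reg :: "int \<Rightarrow> (real^('q \<times> 'r)) \<times> (real^'p)" where "reg t = (lags y t, x t)" for t
  define H where "H \<beta> = (\<Sum>t=1..int n. (reg t \<bullet> \<beta>) *\<^sub>R reg t)" for \<beta>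
  have reg_blocks: "reg t \<bullet> \<beta> = data_row y x t \<bullet> blocks 0 (fst \<beta>) (snd \<beta>)" for t \<beta>
    by (simp add: reg_def data_row_blocks inner_blocks inner_prod_def)
  have linH: "linear H"
    unfolding H_def by (intro linearI) (simp_all add: inner_add_right scaleR_add_left sum.distrib scaleR_sum_right)
  have "\<beta> = 0" if "H \<beta> = 0" for \<beta>
  proof -
    have "real n / K * (\<beta> \<bullet> \<beta>) \<le> (\<Sum>t=1..int n. (reg t \<bullet> \<beta>)\<^sup>2)"
      unfolding reg_blocks using lower[of "blocks 0 (fst \<beta>) (snd \<beta>)"]
      by (simp add: inner_blocks inner_prod_pair)
    also have "\<dots> = H \<beta> \<bullet> \<beta>"
      by (simp add: H_def inner_sum_left power2_eq_square)
    finally have "real n / K * (\<beta> \<bullet> \<beta>) \<le> 0" using that by simp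
    then have "\<beta> \<bullet> \<beta> \<le> 0" using K n by (simp add: mult_le_0_iff divide_le_0_iff)
    then show ?thesis using inner_ge_zero[of \<beta>] by simp
  qed
  then have "inj H" using linH linear_injective_0 by blast
  then have surj: "surj H" using linH linear_injective_imp_surjective by blast
  have "\<forall>j. \<exists>\<beta>. H \<beta> = (\<Sum>t=1..int n. (y t $ j) *\<^sub>R reg t)"
    using surj by (metis surjD)
  then obtain \<beta> where \<beta>: "\<And>j. H (\<beta> j) = (\<Sum>t=1..int n. (y t $ j) *\<^sub>R reg t)" by metis
  define zh :: "(real^('r \<times> ('q \<times> 'r))) \<times> (real^'r^'p)"
    where "zh = ((\<chi> ck. fst (\<beta> (fst ck)) $ snd ck), (\<chi> i j. snd (\<beta> j) $ i))"
  define e where "e t = residual y x (fst zh) (snd zh) t" for t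
  have fitted_comp: "fitted y x zh t $ j = reg t \<bullet> \<beta> j" for t j
    by (simp add: fitted_def zh_def reg_def inner_prod_def vector_matrix_mult_def unvec_def inner_vec_def mult.commute)
  have e_comp: "e t $ j = y t $ j - reg t \<bullet> \<beta> j" for t j
    by (simp add: e_def residual_fitted fitted_comp)
  have orth: "(\<Sum>t=1..int n. (e t $ j) *\<^sub>R reg t) = 0" for j
    using \<beta>[of j] by (simp add: e_comp scaleR_diff_left sum_subtractf H_def)
  have orth': "(\<Sum>t=1..int n. (e t $ j) * (reg t \<bullet> v)) = 0" for j v
    using arg_cong[OF orth[of j], of "\<lambda>w. w \<bullet> v"] by (simp add: inner_sum_left)
  have bnd: "\<beta> j \<bullet> \<beta> j \<le> K\<^sup>2" for j
  proof -
    let ?\<xi> = "blocks (axis j 1) (- fst (\<beta> j)) (- snd (\<beta> j)) :: real^('r + ('q \<times> 'r) + 'p)"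
    have ax: "axis j 1 \<bullet> axis j (1::real) = (1::real)" for j :: 'r by (simp add: inner_axis_axis)
    have "data_row y x t \<bullet> ?\<xi> = e t $ j" for t
      by (simp add: data_row_blocks inner_blocks e_comp reg_def inner_prod_def inner_axis)
    then have "real n / K * (1 + \<beta> j \<bullet> \<beta> j) \<le> (\<Sum>t=1..int n. (e t $ j)\<^sup>2)"
      using lower[of ?\<xi>] by (simp add: inner_blocks ax inner_prod_pair add.assoc)
    also have "\<dots> \<le> (\<Sum>t=1..int n. (e t $ j)\<^sup>2) + (\<Sum>t=1..int n. (reg t \<bullet> \<beta> j)\<^sup>2)"
      by (simp add: sum_nonneg)
    also have "\<dots> = (\<Sum>t=1..int n. (e t $ j)\<^sup>2 + 2 * (e t $ j * (reg t \<bullet> \<beta> j)) + (reg t \<bullet> \<beta> j)\<^sup>2)"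
      using orth'[of j "\<beta> j"] by (simp add: sum.distrib sum_distrib_left[symmetric])
    also have "\<dots> = (\<Sum>t=1..int n. (y t $ j)\<^sup>2)"
      by (intro sum.cong refl) (simp add: e_comp power2_eq_square algebra_simps)
    also have "\<dots> = (\<Sum>t=1..int n. (data_row y x t \<bullet> (blocks (axis j 1) 0 0 :: real^('r + ('q \<times> 'r) + 'p)))\<^sup>2)"
      by (simp add: data_row_blocks inner_blocks inner_axis)
    also have "\<dots> \<le> K * real n * (blocks (axis j 1) 0 0 \<bullet> (blocks (axis j 1) 0 0 :: real^('r + ('q \<times> 'r) + 'p)))"
      by (rule upper)
    also have "\<dots> = K * real n" by (simp add: inner_blocks ax)
    finally have "real n * (1 + \<beta> j \<bullet> \<beta> j) \<le> real n * K\<^sup>2"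
      using K n by (simp add: field_simps power2_eq_square)
    then have "1 + \<beta> j \<bullet> \<beta> j \<le> K\<^sup>2" using n by simp
    then show ?thesis by simp
  qed
  have "fst zh \<bullet> fst zh = unvec (fst zh) \<bullet> unvec (fst zh)" by (simp add: unvec_inner)
  also have "\<dots> = (\<Sum>k\<in>UNIV. \<Sum>j\<in>UNIV. fst (\<beta> j) $ k * fst (\<beta> j) $ k)"
    by (simp add: inner_vec_def unvec_def zh_def)
  also have "\<dots> = (\<Sum>j\<in>UNIV. fst (\<beta> j) \<bullet> fst (\<beta> j))"
    by (subst sum.swap) (simp add: inner_vec_def)
  also have "\<dots> \<le> (\<Sum>j\<in>(UNIV :: 'r set). K\<^sup>2)"
  proof (intro sum_mono)
    fix j
    show "fst (\<beta> j) \<bullet> fst (\<beta> j) \<le> K\<^sup>2"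
      using bnd[of j] inner_ge_zero[of "snd (\<beta> j)"] unfolding inner_prod_pair by linarith
  qed
  finally have "fst zh \<bullet> fst zh \<le> CARD('r) * K\<^sup>2" by simp
  moreover have "rss S z = rss S zh + fit S (z - zh)" if S: "sym_pos_def S" for S z
  proof -
    obtain F where F: "finite F" "\<And>z. matrix_inv S *v z = (\<Sum>b\<in>F. (b \<bullet> z) *\<^sub>R b)"
      using inverse_sum_of_squares[OF S] by metis
    have cross: "(\<Sum>t=1..int n. (b \<bullet> e t) * (b \<bullet> fitted y x w t)) = 0" for b and w :: "(real^('r \<times> ('q \<times> 'r))) \<times> (real^'r^'p)"
    proof -
      let ?v = "(unvec (fst w) *v b, snd w *v b)"
      have "b \<bullet> fitted y x w t = reg t \<bullet> ?v" for t
        by (simp add: inner_fitted reg_blocks)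
      then have "(\<Sum>t=1..int n. (b \<bullet> e t) * (b \<bullet> fitted y x w t)) =
          (\<Sum>t=1..int n. \<Sum>j\<in>UNIV. b $ j * (e t $ j * (reg t \<bullet> ?v)))"
        by (simp add: inner_vec_def[of b] sum_distrib_right mult.assoc)
      also have "\<dots> = (\<Sum>j\<in>UNIV. b $ j * (\<Sum>t=1..int n. e t $ j * (reg t \<bullet> ?v)))"
        by (subst sum.swap) (simp add: sum_distrib_left)
      finally show ?thesis by (simp add: orth')
    qed
    have res: "residual y x (fst z) (snd z) t = e t - fitted y x (z - zh) t" for t
      using fitted_add[of y x "z - zh" zh t] by (simp add: e_def residual_fitted)
    have "(b \<bullet> residual y x (fst z) (snd z) t)\<^sup>2 =
        (b \<bullet> e t)\<^sup>2 + (b \<bullet> fitted y x (z - zh) t)\<^sup>2 - 2 * ((b \<bullet> e t) * (b \<bullet> fitted y x (z - zh) t))" for b t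
      unfolding res inner_diff_right by (simp add: power2_eq_square algebra_simps)
    then have "(\<Sum>t=1..int n. (b \<bullet> residual y x (fst z) (snd z) t)\<^sup>2) =
        (\<Sum>t=1..int n. (b \<bullet> e t)\<^sup>2) + (\<Sum>t=1..int n. (b \<bullet> fitted y x (z - zh) t)\<^sup>2)" for b
      using cross[of b "z - zh"] by (simp add: sum.distrib sum_subtractf sum_distrib_left[symmetric])
    then show ?thesis
      unfolding weighted_rss_def weighted_fit_def form_as_squares(1)[OF S F]
      by (simp add: sum.distrib e_def)
  qed
  ultimately show ?thesis by (rule that[rotated])
qed

end

section \<open>Gaussian weights\<close>

lemma two_exp_mean_le: "2 * exp ((a + b) / 2) \<le> exp a + exp (b::real)"
proof -
  have "0 \<le> (exp (a / 2) - exp (b / 2))\<^sup>2" by simp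
  also have "\<dots> = exp (a / 2) * exp (a / 2) + exp (b / 2) * exp (b / 2) - 2 * (exp (a / 2) * exp (b / 2))"
    by (simp add: power2_eq_square algebra_simps)
  also have "\<dots> = exp a + exp b - 2 * exp ((a + b) / 2)"
    by (simp flip: exp_add add: add_divide_distrib)
  finally show ?thesis by simp
qed

lemma fst_borel_measurable[measurable]:
  "fst \<in> borel_measurable (borel :: ('e::euclidean_space \<times> 'f::euclidean_space) measure)"
  by (intro borel_measurable_continuous_onI continuous_intros)

text \<open>
  \<open>N\<close> is the exponent of the prior, \<open>Q\<close> that of the likelihood around its centre, and \<open>w\<close> the offset of this
  centre from the prior mean. Averaging over \<open>z\<close> and \<open>- z\<close> removes the offset from the total mass at the
  cost of a factor \<open>exp (- N w / 2)\<close>. The mass where \<open>N > R\<close> is at most \<open>exp (- R / 4)\<close> times an integral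
  with a wider prior, which the substitution \<open>z \<mapsto> 2 z\<close> compares with the original one, as \<open>Q\<close> increases
  along rays. Both comparisons are uniform in \<open>Q\<close>, hence in \<open>n\<close> and \<open>\<Sigma>\<close>.
\<close>

lemma prior_weighted_mass:
  fixes N :: "'e::euclidean_space \<Rightarrow> real" and Q :: "'e \<times> 'f::euclidean_space \<Rightarrow> real"
  assumes N[measurable]: "N \<in> borel_measurable borel" and Q[measurable]: "Q \<in> borel_measurable borel"
    and parallelogram: "\<And>u v. N (u + v) + N (u - v) = 2 * N u + 2 * N v" and N0: "\<And>u. 0 \<le> N u"
    and Q2: "\<And>c z. Q (c *\<^sub>R z) = c\<^sup>2 * Q z" and Q0: "\<And>z. 0 \<le> Q z"
    and R: "2 * 2 ^ DIM('e \<times> 'f) * exp (3 / 4 * N w) \<le> exp (R / 4)"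
    and fin: "(\<integral>\<^sup>+z. ennreal (exp (- (1/2) * N (fst z + w)) * exp (- (1/2) * Q z)) \<partial>lborel) < \<infinity>"
  shows "(\<integral>\<^sup>+z. ennreal (exp (- (1/2) * N (fst z + w)) * exp (- (1/2) * Q z)) \<partial>lborel) \<le>
    2 * (\<integral>\<^sup>+z. ennreal (exp (- (1/2) * N (fst z + w)) * exp (- (1/2) * Q z)) * indicator {u. N u \<le> R} (fst z + w) \<partial>lborel)"
proof -
  let ?D = "DIM('e \<times> 'f)"
  define f where "f z = exp (- (1/2) * N (fst z + w)) * exp (- (1/2) * Q z)" for z
  define h where "h z = exp (- (1/2) * N (fst z)) * exp (- (1/2) * Q z)" for z
  have fm[measurable]: "f \<in> borel_measurable borel" unfolding f_def by measurable
  have hm[measurable]: "h \<in> borel_measurable borel" unfolding h_def by measurable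
  have N_zero: "N 0 = 0" using parallelogram[of 0 0] by simp
  have N_even: "N (- u) = N u" for u using parallelogram[of 0 u] N_zero by simp
  have N_double: "N (2 *\<^sub>R u) = 4 * N u" for u using parallelogram[of u u] N_zero by (simp add: scaleR_2)
  define I where "I = (\<integral>\<^sup>+z. ennreal (h z) \<partial>lborel)"
  define T where "T = (\<integral>\<^sup>+z. ennreal (f z) \<partial>lborel)"
  let ?A = "\<integral>\<^sup>+z. ennreal (f z) * indicator {u. N u \<le> R} (fst z + w) \<partial>lborel"
  let ?B = "\<integral>\<^sup>+z. ennreal (f z) * indicator {u. R < N u} (fst z + w) \<partial>lborel"
  have T_lower: "ennreal (exp (- (1/2) * N w)) * I \<le> T"
  proof -
    have "2 * (ennreal (exp (- (1/2) * N w)) * I) = (\<integral>\<^sup>+z. ennreal (2 * exp (- (1/2) * N w)) * ennreal (h z) \<partial>lborel)"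
      by (subst nn_integral_cmult) (simp_all add: I_def ennreal_mult mult.assoc)
    also have "\<dots> \<le> (\<integral>\<^sup>+z. ennreal (f z) + ennreal (f (- z)) \<partial>lborel)"
    proof (intro nn_integral_mono)
      fix z :: "'e \<times> 'f"
      let ?u = "fst z"
      have "N (- ?u + w) = N (?u - w)" using N_even[of "?u - w"] by simp
      moreover have "Q (- z) = Q z" using Q2[of "-1" z] by simp
      ultimately have f_neg: "f (- z) = exp (- (1/2) * N (?u - w)) * exp (- (1/2) * Q z)"
        by (simp add: f_def)
      have "2 * exp (((- (1/2) * N (?u + w)) + (- (1/2) * N (?u - w))) / 2) \<le>
          exp (- (1/2) * N (?u + w)) + exp (- (1/2) * N (?u - w))"
        by (rule two_exp_mean_le)
      also have "((- (1/2) * N (?u + w)) + (- (1/2) * N (?u - w))) / 2 = - (1/2) * N w + - (1/2) * N ?u"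
        using parallelogram[of ?u w] by simp
      finally have "(2 * (exp (- (1/2) * N w) * exp (- (1/2) * N ?u))) * exp (- (1/2) * Q z) \<le>
          (exp (- (1/2) * N (?u + w)) + exp (- (1/2) * N (?u - w))) * exp (- (1/2) * Q z)"
        unfolding exp_add[symmetric] by (intro mult_right_mono) auto
      then have "2 * exp (- (1/2) * N w) * h z \<le> f z + f (- z)"
        unfolding h_def f_neg unfolding f_def by (simp only: distrib_right mult.assoc)
      then show "ennreal (2 * exp (- (1/2) * N w)) * ennreal (h z) \<le> ennreal (f z) + ennreal (f (- z))"
        by (simp add: h_def f_def flip: ennreal_mult ennreal_plus)
    qed
    also have "\<dots> = T + (\<integral>\<^sup>+z. ennreal (f (- z)) \<partial>lborel)"
      unfolding T_def by (subst nn_integral_add) auto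
    also have "(\<integral>\<^sup>+z. ennreal (f (- z)) \<partial>lborel) = T"
      unfolding T_def using nn_integral_lborel_affine[of "\<lambda>z. ennreal (f z)" "-1" 0] by simp
    also have "T + T = 2 * T" by (simp add: mult_2)
    finally show ?thesis by (subst (asm) ennreal_mult_le_mult_iff) auto
  qed
  have B_upper: "?B \<le> ennreal (exp (- R / 4 + N w / 4) * 2 ^ ?D) * I"
  proof -
    let ?h = "\<lambda>z. exp (- (1/8) * N (fst z)) * exp (- (1/2) * Q z)"
    have "?B \<le> (\<integral>\<^sup>+z. ennreal (exp (- R / 4 + N w / 4)) * ennreal (?h z) \<partial>lborel)"
    proof (intro nn_integral_mono)
      fix z :: "'e \<times> 'f"
      let ?u = "fst z"
      show "ennreal (f z) * indicator {u. R < N u} (?u + w) \<le> ennreal (exp (- R / 4 + N w / 4)) * ennreal (?h z)"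
      proof (cases "R < N (?u + w)")
        case True
        have "N ?u \<le> 2 * N (?u + w) + 2 * N w"
          using parallelogram[of "?u + w" w] N0[of "?u + w + w"] by simp
        then have "- (1/2) * N (?u + w) \<le> (- R / 4 + N w / 4) + - (1/8) * N ?u" using True by simp
        then have "f z \<le> exp (- R / 4 + N w / 4) * ?h z"
          unfolding f_def by (simp flip: exp_add)
        then show ?thesis using True by (simp flip: ennreal_mult)
      qed simp
    qed
    also have "\<dots> = ennreal (exp (- R / 4 + N w / 4)) * (\<integral>\<^sup>+z. ennreal (?h z) \<partial>lborel)"
      by (rule nn_integral_cmult) measurable
    also have "(\<integral>\<^sup>+z. ennreal (?h z) \<partial>lborel) = ennreal (2 ^ ?D) * (\<integral>\<^sup>+z. ennreal (?h (2 *\<^sub>R z)) \<partial>lborel)"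
      using nn_integral_lborel_affine[of "\<lambda>z. ennreal (?h z)" 2 0] by simp
    also have "\<dots> \<le> ennreal (2 ^ ?D) * I"
      unfolding I_def h_def
      by (intro mult_left_mono nn_integral_mono ennreal_leI) (auto simp: N_double Q2 Q0 intro!: mult_mono)
    finally show ?thesis by (simp add: ennreal_mult mult.assoc mult_left_mono)
  qed
  have B_half: "2 * ?B \<le> T"
  proof -
    let ?c = "exp (- R / 4 + N w / 4) * 2 ^ ?D"
    have "2 * ?c \<le> exp (- (1/2) * N w)"
    proof -
      have "2 * ?c = exp (- R / 4) * exp (- (1/2) * N w) * (2 * 2 ^ ?D * exp (3 / 4 * N w))"
        by (simp add: mult_ac flip: exp_add)
      also have "\<dots> \<le> exp (- R / 4) * exp (- (1/2) * N w) * exp (R / 4)"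
        using R by (intro mult_left_mono) auto
      also have "\<dots> = exp (- (1/2) * N w)" by (simp flip: exp_add)
      finally show ?thesis .
    qed
    then have "ennreal (2 * ?c) * I \<le> ennreal (exp (- (1/2) * N w)) * I"
      by (intro mult_right_mono ennreal_leI) auto
    with T_lower have "ennreal (2 * ?c) * I \<le> T" by (rule order_trans[rotated])
    moreover have "2 * ?B \<le> 2 * (ennreal ?c * I)" using B_upper by (intro mult_left_mono) auto
    moreover have "2 * (ennreal ?c * I) = ennreal (2 * ?c) * I"
      by (simp add: ennreal_mult mult.assoc)
    ultimately show ?thesis by simp
  qed
  have "T = (\<integral>\<^sup>+z. ennreal (f z) * indicator {u. N u \<le> R} (fst z + w) + ennreal (f z) * indicator {u. R < N u} (fst z + w) \<partial>lborel)"
    unfolding T_def by (intro nn_integral_cong) (auto split: split_indicator)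
  also have "\<dots> = ?A + ?B"
    by (rule nn_integral_add) measurable
  finally have "T + T = 2 * ?A + 2 * ?B" by (simp add: mult_2 add_ac)
  also have "\<dots> \<le> T + 2 * ?A" using B_half by (simp add: add.commute add_left_mono)
  finally have "T = \<infinity> \<or> T \<le> 2 * ?A" unfolding ennreal_add_left_cancel_le .
  moreover have "T \<noteq> \<infinity>" using fin unfolding T_def f_def by auto
  ultimately have "T \<le> 2 * ?A" by blast
  then show ?thesis by (simp add: T_def f_def)
qed

text \<open>
  The total mass is at most that of a Gaussian with precision \<open>n k1\<close>, of order \<open>n^(-(e+f)/2)\<close> with
  \<open>e\<close> and \<open>f\<close> the dimensions of the blocks. For \<open>\<alpha>\<close> within \<open>1 / sqrt n\<close> of the centre, the integrand is at
  least a constant for all \<open>b\<close> in a ball of radius \<open>1 / sqrt n\<close>, whose volume is of order \<open>n^(-f/2)\<close>.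
\<close>

lemma gaussian_ball_density:
  fixes N :: "'e::euclidean_space \<Rightarrow> real" and Q :: "'e \<times> 'f::euclidean_space \<Rightarrow> real" and n :: real
  assumes N[measurable]: "N \<in> borel_measurable borel" and Q[measurable]: "Q \<in> borel_measurable borel"
    and N0: "\<And>u. 0 \<le> N u"
    and n: "0 < n" and k1: "0 < k1"
    and Q_lower: "\<And>z. n * k1 * (z \<bullet> z) \<le> Q z" and Q_upper: "\<And>z. Q z \<le> n * k2 * (z \<bullet> z)"
    and N1: "N \<alpha> \<le> N1" and \<alpha>: "norm (\<alpha> - ah) < 1 / sqrt n" and k2: "0 \<le> k2"
    and G: "(\<integral>\<^sup>+(z :: 'e \<times> 'f). ennreal (exp (- (k1 / 2) * (z \<bullet> z))) \<partial>lborel) \<le> ennreal G" "0 < G"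
  shows "ennreal (exp (- N1 / 2 - k2) * unit_ball_vol DIM('f) * sqrt n ^ DIM('e) / G) *
      (\<integral>\<^sup>+z. ennreal (exp (- (1/2) * N (fst z)) * exp (- (1/2) * Q (z - (ah, bh)))) \<partial>lborel)
    \<le> (\<integral>\<^sup>+b. ennreal (exp (- (1/2) * N \<alpha>) * exp (- (1/2) * Q ((\<alpha>, b) - (ah, bh)))) \<partial>lborel)"
proof -
  let ?E = "DIM('e)" and ?F = "DIM('f)"
  let ?s = "1 / sqrt n"
  have s: "0 < ?s" "?s\<^sup>2 = 1 / n" using n by (auto simp: power_divide)
  have sub[measurable]: "(\<lambda>z :: 'e \<times> 'f. z - (ah, bh)) \<in> borel_measurable borel"
    by (intro borel_measurable_continuous_onI continuous_intros)
  have "(\<integral>\<^sup>+z. ennreal (exp (- (1/2) * N (fst z)) * exp (- (1/2) * Q (z - (ah, bh)))) \<partial>lborel)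
      \<le> (\<integral>\<^sup>+z. ennreal (exp (- (1/2) * Q (z - (ah, bh)))) \<partial>lborel)"
    using N0 by (intro nn_integral_mono ennreal_leI) (simp add: mult_left_le_one_le)
  also have "\<dots> = (\<integral>\<^sup>+z. ennreal (exp (- (1/2) * Q z)) \<partial>lborel)"
    by (subst nn_integral_lborel_affine[of _ 1 "(ah, bh)"]) auto
  also have "\<dots> \<le> (\<integral>\<^sup>+(z :: 'e \<times> 'f). ennreal (exp (- (n * k1 / 2) * (z \<bullet> z))) \<partial>lborel)"
    using Q_lower by (intro nn_integral_mono ennreal_leI) (simp add: mult.assoc)
  also have "\<dots> = ennreal (?s ^ (?E + ?F)) * (\<integral>\<^sup>+(z :: 'e \<times> 'f). ennreal (exp (- (k1 / 2) * (z \<bullet> z))) \<partial>lborel)"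
    using s n by (subst nn_integral_lborel_affine[of _ ?s 0]) (auto simp: power2_eq_square)
  also have "\<dots> \<le> ennreal (?s ^ (?E + ?F)) * ennreal G" by (intro mult_left_mono G) auto
  also have "\<dots> = ennreal (?s ^ (?E + ?F) * G)" using s G by (simp add: ennreal_mult)
  finally have upper: "(\<integral>\<^sup>+z. ennreal (exp (- (1/2) * N (fst z)) * exp (- (1/2) * Q (z - (ah, bh)))) \<partial>lborel)
      \<le> ennreal (?s ^ (?E + ?F) * G)" .
  let ?c = "exp (- N1 / 2 - k2) * unit_ball_vol ?F * sqrt n ^ ?E / G"
  have "ennreal ?c * (\<integral>\<^sup>+z. ennreal (exp (- (1/2) * N (fst z)) * exp (- (1/2) * Q (z - (ah, bh)))) \<partial>lborel)
      \<le> ennreal ?c * ennreal (?s ^ (?E + ?F) * G)"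
    by (intro mult_left_mono upper) auto
  also have "\<dots> = ennreal (exp (- N1 / 2 - k2)) * ennreal (unit_ball_vol ?F * ?s ^ ?F)"
  proof -
    have "sqrt n ^ ?E * ?s ^ ?E = 1" using n by (simp flip: power_mult_distrib)
    then have "?c * (?s ^ (?E + ?F) * G) = exp (- N1 / 2 - k2) * (unit_ball_vol ?F * ?s ^ ?F)"
      using G(2) by (simp add: power_add mult_ac)
    moreover have "0 \<le> ?c" "0 \<le> ?s ^ (?E + ?F) * G" using G(2) s n unit_ball_vol_pos[of "real ?F"] by auto
    ultimately show ?thesis using s by (simp add: ennreal_mult[symmetric])
  qed
  also have "\<dots> = (\<integral>\<^sup>+b. ennreal (exp (- N1 / 2 - k2)) * indicator (ball bh ?s) b \<partial>lborel)"
    by (subst nn_integral_cmult_indicator) (use s in \<open>auto simp: emeasure_ball\<close>)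
  also have "\<dots> \<le> (\<integral>\<^sup>+b. ennreal (exp (- (1/2) * N \<alpha>) * exp (- (1/2) * Q ((\<alpha>, b) - (ah, bh)))) \<partial>lborel)"
  proof (intro nn_integral_mono)
    fix b
    show "ennreal (exp (- N1 / 2 - k2)) * indicator (ball bh ?s) b \<le>
      ennreal (exp (- (1/2) * N \<alpha>) * exp (- (1/2) * Q ((\<alpha>, b) - (ah, bh))))"
    proof (cases "b \<in> ball bh ?s")
      case True
      let ?z = "(\<alpha>, b) - (ah, bh)"
      have "(norm (\<alpha> - ah))\<^sup>2 \<le> ?s\<^sup>2" using \<alpha> by (intro power_mono) auto
      moreover have "(norm (b - bh))\<^sup>2 \<le> ?s\<^sup>2"
        using True by (intro power_mono) (auto simp: dist_norm norm_minus_commute)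
      ultimately have "?z \<bullet> ?z \<le> 2 / n" using s unfolding inner_prod_pair by (simp add: dot_square_norm)
      then have "n * k2 * (?z \<bullet> ?z) \<le> n * k2 * (2 / n)" using n k2 by (intro mult_left_mono) auto
      then have "Q ?z \<le> 2 * k2" using Q_upper[of ?z] n by simp
      then have "- N1 / 2 - k2 \<le> - (1/2) * N \<alpha> + - (1/2) * Q ?z" using N1 by simp
      then show ?thesis using True by (simp add: ennreal_leI flip: exp_add)
    qed simp
  qed
  finally show ?thesis .
qed

section \<open>The unnormalised posterior\<close>

definition penalty :: "real^'k^'k \<Rightarrow> real^'k \<Rightarrow> real" where
  "penalty C u = u \<bullet> (C *v u)"

lemma penalty_parallelogram:
  "penalty C (u + v) + penalty C (u - v) = 2 * penalty C u + 2 * penalty C v"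
  by (simp add: penalty_def matrix_vector_right_distrib matrix_vector_mult_diff_distrib inner_add_left
      inner_add_right inner_diff_left inner_diff_right)

lemma penalty_nonneg: "sym_pos_def C \<Longrightarrow> 0 \<le> penalty C u"
  unfolding penalty_def by (rule sym_pos_def_nonneg)

lemma penalty_add_le: "sym_pos_def C \<Longrightarrow> penalty C (u + v) \<le> 2 * penalty C u + 2 * penalty C v"
  using penalty_parallelogram[of C u v] penalty_nonneg[of C "u - v"] by simp

lemma penalty_uminus: "penalty C (- u) = penalty C u"
  using matrix_vector_mult_scaleR[of C "-1" u] by (simp add: penalty_def)

lemma penalty_diff_le: "sym_pos_def C \<Longrightarrow> penalty C (u - v) \<le> 2 * penalty C u + 2 * penalty C v"
  using penalty_add_le[of C u "- v"] by (simp add: penalty_uminus)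

lemma penalty_measurable[measurable]: "penalty C \<in> borel_measurable borel"
  unfolding penalty_def by (intro borel_measurable_continuous_onI continuous_intros)

lemma trace_mult_inverse_bounds:
  fixes D S :: "real^'r^'r"
  assumes D: "sym_pos_semidef D" and S: "sym_pos_def S"
  shows "0 \<le> trace (D ** matrix_inv S)"
    and "trace (D ** matrix_inv S) \<le> (\<Sum>i\<in>UNIV. \<Sum>j\<in>UNIV. \<bar>D $ i $ j\<bar>) * trace (matrix_inv S)"
proof -
  obtain F where F: "finite F" "\<And>z. matrix_inv S *v z = (\<Sum>b\<in>F. (b \<bullet> z) *\<^sub>R b)"
    using inverse_sum_of_squares[OF S] by metis
  have ent: "matrix_inv S $ j $ i = (\<Sum>b\<in>F. b $ i * b $ j)" for i j
    by (subst entry_inner_axis[symmetric]) (simp add: F inner_sum_right inner_axis inner_axis' mult.commute)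
  have "trace (D ** matrix_inv S) = (\<Sum>i\<in>UNIV. \<Sum>j\<in>UNIV. \<Sum>b\<in>F. b $ i * (D $ i $ j * b $ j))"
    by (simp add: trace_def matrix_matrix_mult_def ent sum_distrib_left mult_ac)
  also have "\<dots> = (\<Sum>b\<in>F. b \<bullet> (D *v b))"
    by (simp add: inner_vec_def matrix_vector_mult_def sum_distrib_left sum.swap[of _ F])
  also have "0 \<le> \<dots>" using D by (intro sum_nonneg) (simp add: sym_pos_semidef_def)
  finally show "0 \<le> trace (D ** matrix_inv S)" .
  have "trace (D ** matrix_inv S) \<le> (\<Sum>i\<in>UNIV. \<Sum>j\<in>UNIV. \<bar>D $ i $ j\<bar> * trace (matrix_inv S))"
  proof -
    have "trace (D ** matrix_inv S) = (\<Sum>i\<in>UNIV. \<Sum>j\<in>UNIV. D $ i $ j * matrix_inv S $ j $ i)"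
      by (simp add: trace_def matrix_matrix_mult_def)
    also have "\<dots> \<le> (\<Sum>i\<in>UNIV. \<Sum>j\<in>UNIV. \<bar>D $ i $ j\<bar> * trace (matrix_inv S))"
    proof (intro sum_mono)
      fix i j
      have "D $ i $ j * matrix_inv S $ j $ i \<le> \<bar>D $ i $ j\<bar> * \<bar>matrix_inv S $ j $ i\<bar>"
        by (metis abs_ge_self abs_mult)
      also have "\<dots> \<le> \<bar>D $ i $ j\<bar> * trace (matrix_inv S)"
        by (intro mult_left_mono spd_entry_le_trace(1) sym_pos_def_matrix_inv S) simp
      finally show "D $ i $ j * matrix_inv S $ j $ i \<le> \<bar>D $ i $ j\<bar> * trace (matrix_inv S)" .
    qed
    finally show ?thesis .
  qed
  then show "trace (D ** matrix_inv S) \<le> (\<Sum>i\<in>UNIV. \<Sum>j\<in>UNIV. \<bar>D $ i $ j\<bar>) * trace (matrix_inv S)"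
    by (simp add: sum_distrib_right)
qed

definition unnorm :: "real^('r::finite \<times> ('q::{finite,linorder} \<times> 'r)) \<Rightarrow> real^('r \<times> ('q \<times> 'r))^('r \<times> ('q \<times> 'r)) \<Rightarrow>
    real^'r^'r \<Rightarrow> real \<Rightarrow> nat \<Rightarrow> (int \<Rightarrow> real^'r) \<Rightarrow> (int \<Rightarrow> real^'p) \<Rightarrow>
    real^('r \<times> ('q \<times> 'r)) \<Rightarrow> real^'r^'p \<Rightarrow> real^'r^'r \<Rightarrow> real" where
  "unnorm m C D a n y x \<alpha> B S = likelihood n y x \<alpha> B S * prior m C D a \<alpha> S"

text \<open>
  Likelihood times prior, with the exponent of the likelihood in the form bounded by \<open>rss_bounds\<close>.
\<close>

lemma unnorm_eq:
  fixes S :: "real^'r^'r"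
  assumes S: "sym_pos_def S"
  shows "unnorm m C D a n y x \<alpha> B S = (2 * pi) powr (- (real n * real CARD('r) / 2)) * det S powr (- ((real n + a) / 2)) *
    exp (- (1/2) * weighted_rss n y x S (\<alpha>, B)) * exp (- (1/2) * trace (D ** matrix_inv S)) * exp (- (1/2) * penalty C (\<alpha> - m))"
proof -
  have "det S powr (- ((real n + a) / 2)) = det S powr (- (real n / 2)) * det S powr (- (a / 2))"
    by (simp add: powr_add[symmetric] add_divide_distrib)
  then show ?thesis
    by (simp add: unnorm_def likelihood_def prior_def trace_mult_gram weighted_rss_def penalty_def)
qed

lemma unnorm_pos: "sym_pos_def S \<Longrightarrow> 0 < unnorm m C D a n y x \<alpha> B S"
  by (simp add: unnorm_eq sym_pos_def_det_pos order_less_imp_not_eq2 sym_pos_def_invertible(3))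

text \<open>
  The exponential rate, up to a factor \<open>n/4\<close>, at which the posterior density decays in \<open>S\<close>. It is bounded
  exactly on the sets where neither \<open>tr S\<close> nor \<open>tr S\<^sup>-\<^sup>1\<close> is large.
\<close>

definition spread :: "real \<Rightarrow> real^'r^'r \<Rightarrow> real" where
  "spread K S = ln (1 + trace S) + trace (matrix_inv S) / K"

lemma spread_measurable[measurable]: "spread K \<in> borel_measurable (spd_lborel :: (real^'r^'r) measure)"
  unfolding spread_def by measurable

text \<open>
  An integrable majorant for the dependence on \<open>B\<close> and \<open>S\<close> that does not change with \<open>n\<close>.
\<close>

definition envelope :: "real^'r^'p \<Rightarrow> real^'r^'r \<Rightarrow> real" where
  "envelope B S = inverse ((1 + B \<bullet> B) ^ DIM(real^'r^'p)) * inverse ((1 + trace S) ^ (2 * CARD('r uprod)))"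

text \<open>
  The likelihood contributes \<open>exp (- n \<tau> / (2 K))\<close> with \<open>\<tau> = tr S\<^sup>-\<^sup>1\<close>. Half of this exponent pays for the
  determinant by \<open>trace_le_exp_trace_inverse\<close>, which leaves a power of \<open>1 / (1 + tr S)\<close> of order \<open>n/2\<close>. A
  fixed number of these powers makes the envelope integrable and absorbs the dependence of the decay in
  \<open>B\<close> on \<open>tr S\<close>; at least \<open>n/4\<close> of them remain for the rate \<open>spread\<close>.
\<close>

lemma unnorm_upper:
  fixes K a :: real and D :: "real^'r^'r"
    and m :: "real^('r \<times> ('q::{finite,linorder} \<times> 'r))"
  assumes K: "1 \<le> K" and a: "0 \<le> a" and D: "sym_pos_semidef D"
  obtains c c1 :: real where "1 \<le> c" "1 \<le> c1"
    "\<And>n y (x :: int \<Rightarrow> real^'p) \<alpha> B (S :: real^'r^'r). design TYPE('q) n y x K \<Longrightarrow> a \<le> real n \<Longrightarrow>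
      4 * (DIM(real^'r^'p) + 2 * CARD('r uprod)) \<le> n \<Longrightarrow> sym_pos_def S \<Longrightarrow>
      unnorm m C D a n y x \<alpha> B S \<le> (2 * pi) powr (- (real n * real CARD('r) / 2)) * (c1 * c ^ n * exp (- (real n / 4) * spread K S)) *
        (envelope B S * exp (- (1/2) * penalty C (\<alpha> - m)))"
proof -
  define s where "s = 1 / (4 * K)"
  have s: "0 < s" using K by (simp add: s_def)
  obtain c where c: "1 \<le> c"
    "\<And>S :: real^'r^'r. sym_pos_def S \<Longrightarrow> 1 + trace S \<le> c * exp (s * trace (matrix_inv S)) * det S"
    using trace_le_exp_trace_inverse[OF s] by blast
  let ?J = "DIM(real^'r^'p)" and ?d = "2 * CARD('r uprod)" and ?r = "real CARD('r)"
  have "0 < 1 / (2 * K * ?r)" using K by simp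
  then obtain c1 where c1: "1 \<le> c1" "\<And>v. 0 \<le> v \<Longrightarrow> (1 + v) ^ ?J \<le> c1 * exp (1 / (2 * K * ?r) * v)"
    using one_plus_power_le_exp by blast
  have "unnorm m C D a n y x \<alpha> B S \<le> (2 * pi) powr (- (real n * real CARD('r) / 2)) * (c1 * c ^ n * exp (- (real n / 4) * spread K S)) *
        (envelope B S * exp (- (1/2) * penalty C (\<alpha> - m)))"
    if des: "design TYPE('q) n y x K" and an: "a \<le> real n" and Jn: "4 * (?J + ?d) \<le> n" and S: "sym_pos_def S"
    for n y and x :: "int \<Rightarrow> real^'p" and \<alpha> B and S :: "real^'r^'r"
  proof -
    interpret design n y x K "TYPE('q)" by fact
    define T where "T = 1 + trace S"
    define \<tau> where "\<tau> = trace (matrix_inv S)"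
    define h where "h = (real n + a) / 2"
    define e where "e = exp (s * \<tau>)"
    have tr: "0 < trace S" by (rule spd_entry_le_trace(3)[OF S])
    have T: "1 < T" using tr by (simp add: T_def)
    have \<tau>: "0 < \<tau>" unfolding \<tau>_def by (rule spd_entry_le_trace(3)[OF sym_pos_def_matrix_inv[OF S]])
    have h: "0 \<le> h" "h \<le> n" "n / 2 \<le> h" using a an by (auto simp: h_def)
    have det: "det S powr (- h) \<le> c ^ n * (T powr (- (n / 2)) * exp (n * \<tau> / (4 * K)))"
    proof -
      have ce: "0 < c * e" using c(1) by (simp add: e_def)
      have "T / (c * e) \<le> det S" using c(2)[OF S] ce by (simp add: T_def e_def \<tau>_def field_simps)
      then have "det S powr (- h) \<le> (T / (c * e)) powr (- h)"
        using T ce h by (intro powr_mono2') auto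
      also have "\<dots> = c powr h * T powr (- h) * e powr h"
        using T ce c(1) by (simp add: powr_divide powr_mult powr_minus field_simps e_def)
      also have "\<dots> \<le> c powr n * T powr (- (n / 2)) * exp (n * \<tau> / (4 * K))"
      proof (intro mult_mono)
        show "c powr h \<le> c powr n" using c(1) h by (intro powr_mono) auto
        show "T powr (- h) \<le> T powr (- (n / 2))" using T h by (intro powr_mono) auto
        have "s * \<tau> * h \<le> s * \<tau> * n" using s \<tau> h by (intro mult_left_mono) auto
        then show "e powr h \<le> exp (n * \<tau> / (4 * K))"
          by (simp add: e_def powr_def s_def mult_ac)
      qed auto
      finally show ?thesis using c(1) by (simp add: powr_realpow mult.assoc)
    qed
    define v where "v = (B \<bullet> B) / trace S"
    have v: "0 \<le> v" using tr by (simp add: v_def)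
    have fit: "exp (- (1/2) * rss S (\<alpha>, B)) \<le> exp (- (n * \<tau> / (2 * K))) * (c1 * (T ^ ?J * inverse ((1 + B \<bullet> B) ^ ?J)))"
    proof -
      let ?b = "row_form (matrix_inv S) B"
      have "v / ?r \<le> ?b" using row_form_lower[OF S, of B] tr by (simp add: v_def field_simps)
      then have "\<tau> + v / ?r \<le> \<tau> + row_form (matrix_inv S) (unvec \<alpha>) + ?b"
        using row_form_nonneg[OF sym_pos_def_matrix_inv[OF S], of "unvec \<alpha>"] by simp
      then have "n / K * (\<tau> + v / ?r) \<le> n / K * (\<tau> + row_form (matrix_inv S) (unvec \<alpha>) + ?b)"
        using K by (intro mult_left_mono) auto
      then have "n / K * (\<tau> + v / ?r) \<le> rss S (\<alpha>, B)"
        using rss_bounds(1)[OF S, of "(\<alpha>, B)"] by (simp add: \<tau>_def)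
      moreover have "1 / K * (v / ?r) \<le> n / K * (v / ?r)"
        using n K v by (intro mult_right_mono divide_right_mono) auto
      ultimately have "- (1/2) * rss S (\<alpha>, B) \<le> - (n * \<tau> / (2 * K)) + - (1 / (2 * K * ?r) * v)"
        by (simp add: algebra_simps)
      then have "exp (- (1/2) * rss S (\<alpha>, B)) \<le> exp (- (n * \<tau> / (2 * K))) * exp (- (1 / (2 * K * ?r) * v))"
        by (simp flip: exp_add)
      moreover have "exp (- (1 / (2 * K * ?r) * v)) \<le> c1 * (T ^ ?J * inverse ((1 + B \<bullet> B) ^ ?J))"
      proof -
        have "1 + B \<bullet> B = 1 + trace S * v" using tr by (simp add: v_def)
        also have "\<dots> \<le> T * (1 + v)" using tr v by (simp add: T_def algebra_simps)
        finally have "(1 + B \<bullet> B) ^ ?J \<le> (T * (1 + v)) ^ ?J" by (intro power_mono) auto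
        also have "\<dots> \<le> T ^ ?J * (c1 * exp (1 / (2 * K * ?r) * v))"
          unfolding power_mult_distrib using c1(2)[OF v] T by (intro mult_left_mono) auto
        finally have *: "(1 + B \<bullet> B) ^ ?J \<le> T ^ ?J * (c1 * exp (1 / (2 * K * ?r) * v))" .
        have pos: "0 < (1 + B \<bullet> B) ^ ?J" by (intro zero_less_power) (simp add: add_pos_nonneg)
        have "exp (- (1 / (2 * K * ?r) * v)) * (1 + B \<bullet> B) ^ ?J \<le>
            exp (- (1 / (2 * K * ?r) * v)) * (T ^ ?J * (c1 * exp (1 / (2 * K * ?r) * v)))"
          by (intro mult_left_mono *) simp
        also have "\<dots> = c1 * T ^ ?J" by (simp add: exp_minus)
        finally show ?thesis using pos by (simp add: field_simps)
      qed
      ultimately show ?thesis by (meson exp_ge_zero mult_left_mono order_trans)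
    qed
    have Tpow: "T powr (- (n / 2)) * T ^ ?J \<le> T powr (- (n / 4)) * inverse (T ^ ?d)"
    proof -
      have "T powr (- (n / 2)) * T ^ ?J * T ^ ?d = T powr (- (n / 2) + ?J + ?d)"
        using T by (simp only: powr_add powr_realpow)
      also have "\<dots> \<le> T powr (- (n / 4))"
      proof (intro powr_mono)
        have "4 * (real ?J + real ?d) \<le> real n" using Jn by (metis of_nat_add of_nat_le_iff of_nat_mult of_nat_numeral)
        then show "- (n / 2) + ?J + ?d \<le> - (n / 4)" by simp
      qed (use T in simp)
      finally show ?thesis using T by (simp add: field_simps)
    qed
    have sp: "T powr (- (n / 4)) * exp (- (n * \<tau> / (4 * K))) = exp (- (n / 4) * spread K S)"
      using T by (simp add: powr_def spread_def T_def[symmetric] \<tau>_def[symmetric] algebra_simps flip: exp_add)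
    let ?p0 = "(2 * pi) powr (- (real n * real CARD('r) / 2))"
    let ?N = "exp (- (1/2) * penalty C (\<alpha> - m))"
    have "unnorm m C D a n y x \<alpha> B S = ?p0 * det S powr (- h) * exp (- (1/2) * rss S (\<alpha>, B)) * exp (- (1/2) * trace (D ** matrix_inv S)) * ?N"
      by (simp add: unnorm_eq[OF S] h_def)
    also have "\<dots> \<le> ?p0 * (c ^ n * (T powr (- (n / 2)) * exp (n * \<tau> / (4 * K)))) *
        (exp (- (n * \<tau> / (2 * K))) * (c1 * (T ^ ?J * inverse ((1 + B \<bullet> B) ^ ?J)))) * 1 * ?N"
      using trace_mult_inverse_bounds(1)[OF D S] c c1 T
      by (intro mult_mono det fit order_refl mult_nonneg_nonneg) auto
    also have "\<dots> = ?p0 * (c1 * c ^ n * (exp (n * \<tau> / (4 * K)) * exp (- (n * \<tau> / (2 * K))))) *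
        ((T powr (- (n / 2)) * T ^ ?J) * inverse ((1 + B \<bullet> B) ^ ?J)) * ?N"
      by (simp add: mult_ac)
    also have "exp (n * \<tau> / (4 * K)) * exp (- (n * \<tau> / (2 * K))) = exp (- (n * \<tau> / (4 * K)))"
      by (simp flip: exp_add add: field_simps)
    also have "?p0 * (c1 * c ^ n * exp (- (n * \<tau> / (4 * K)))) * ((T powr (- (n / 2)) * T ^ ?J) * inverse ((1 + B \<bullet> B) ^ ?J)) * ?N
      \<le> ?p0 * (c1 * c ^ n * exp (- (n * \<tau> / (4 * K)))) * ((T powr (- (n / 4)) * inverse (T ^ ?d)) * inverse ((1 + B \<bullet> B) ^ ?J)) * ?N"
      using c(1) c1(1) by (intro mult_right_mono mult_left_mono Tpow) auto
    also have "\<dots> = ?p0 * (c1 * c ^ n * (T powr (- (n / 4)) * exp (- (n * \<tau> / (4 * K))))) * (envelope B S * ?N)"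
      by (simp add: envelope_def T_def mult_ac)
    finally show ?thesis unfolding sp .
  qed
  with c(1) c1(1) show ?thesis by (rule that)
qed

text \<open>
  On a bounded set of parameters, the exponent of the likelihood and the logarithm of the power of the
  determinant are at most linear in \<open>n\<close>.
\<close>

lemma unnorm_lower:
  fixes K a k A R :: real and D :: "real^'r^'r"
    and m :: "real^('r \<times> ('q::{finite,linorder} \<times> 'r))"
  assumes K: "1 \<le> K" and a: "0 \<le> a" and D: "sym_pos_semidef D" and C: "sym_pos_def C" and k: "1 \<le> k"
    and A: "0 \<le> A"
  obtains L :: real where
    "\<And>n y (x :: int \<Rightarrow> real^'p) \<alpha> B (S :: real^'r^'r). design TYPE('q) n y x K \<Longrightarrow> a \<le> real n \<Longrightarrow> sym_pos_def S \<Longrightarrow>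
      trace S \<le> k \<Longrightarrow> trace (matrix_inv S) \<le> k \<Longrightarrow> \<alpha> \<bullet> \<alpha> \<le> A \<Longrightarrow> penalty C (\<alpha> - m) \<le> R \<Longrightarrow> B \<bullet> B \<le> 1 \<Longrightarrow>
      (2 * pi) powr (- (real n * real CARD('r) / 2)) * exp (- L * real n) \<le> unnorm m C D a n y x \<alpha> B S"
proof -
  let ?r = "real CARD('r)"
  define e1 :: real where "e1 = fact CARD('r) * k ^ CARD('r)"
  have "1 * 1 \<le> e1" unfolding e1_def by (intro mult_mono fact_ge_1 one_le_power k) auto
  then have e1: "1 \<le> e1" by simp
  define d0 where "d0 = (\<Sum>i\<in>UNIV. \<Sum>j\<in>UNIV. \<bar>D $ i $ j\<bar>)"
  have d0: "0 \<le> d0" unfolding d0_def by (intro sum_nonneg) auto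
  define l2 where "l2 = K * (k + ?r * k * A + ?r * k)"
  define L where "L = ln e1 + l2 / 2 + d0 * k / 2 + \<bar>R\<bar> / 2"
  have "(2 * pi) powr (- (real n * real CARD('r) / 2)) * exp (- L * real n) \<le> unnorm m C D a n y x \<alpha> B S"
    if des: "design TYPE('q) n y x K" and an: "a \<le> real n" and S: "sym_pos_def S"
      and kS: "trace S \<le> k" "trace (matrix_inv S) \<le> k" and \<alpha>: "\<alpha> \<bullet> \<alpha> \<le> A" "penalty C (\<alpha> - m) \<le> R" and B: "B \<bullet> B \<le> 1"
    for n y and x :: "int \<Rightarrow> real^'p" and \<alpha> B and S :: "real^'r^'r"
  proof -
    interpret design n y x K "TYPE('q)" by fact
    note P = sym_pos_def_matrix_inv[OF S]
    define h where "h = (real n + a) / 2"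
    have h: "0 \<le> h" "h \<le> n" using a an by (auto simp: h_def)
    have tr: "0 < trace (matrix_inv S)" by (rule spd_entry_le_trace(3)[OF P])
    have det: "exp (- (ln e1 * n)) \<le> det S powr (- h)"
    proof -
      have "\<bar>det S\<bar> \<le> e1"
        unfolding e1_def by (intro abs_det_le order_trans[OF spd_entry_le_trace(1)[OF S] kS(1)])
      then have le: "det S \<le> e1" by simp
      have "e1 powr (- n) \<le> e1 powr (- h)" using e1 h by (intro powr_mono) auto
      also have "\<dots> \<le> det S powr (- h)"
        using le sym_pos_def_det_pos[OF S] h by (intro powr_mono2') auto
      finally show ?thesis using e1 by (simp add: powr_def mult.commute)
    qed
    have rss: "rss S (\<alpha>, B) \<le> l2 * n"
    proof -
      have "row_form (matrix_inv S) (unvec \<alpha>) \<le> ?r * trace (matrix_inv S) * (unvec \<alpha> \<bullet> unvec \<alpha>)"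
        by (rule row_form_upper[OF P])
      also have "\<dots> \<le> ?r * k * A"
        unfolding unvec_inner using kS \<alpha> tr A by (intro mult_mono) auto
      finally have 1: "row_form (matrix_inv S) (unvec \<alpha>) \<le> ?r * k * A" .
      have "row_form (matrix_inv S) B \<le> ?r * trace (matrix_inv S) * (B \<bullet> B)"
        by (rule row_form_upper[OF P])
      also have "\<dots> \<le> ?r * k * 1" using kS B tr k by (intro mult_mono) auto
      finally have 2: "row_form (matrix_inv S) B \<le> ?r * k" by simp
      have "rss S (\<alpha>, B) \<le> K * real n * (trace (matrix_inv S) + row_form (matrix_inv S) (unvec \<alpha>) + row_form (matrix_inv S) B)"
        using rss_bounds(2)[OF S, of "(\<alpha>, B)"] by simp
      also have "\<dots> \<le> K * real n * (k + ?r * k * A + ?r * k)"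
        using 1 2 kS K by (intro mult_left_mono) auto
      finally show ?thesis by (simp add: l2_def mult_ac)
    qed
    have D1: "trace (D ** matrix_inv S) \<le> d0 * k * n"
    proof -
      have "trace (D ** matrix_inv S) \<le> d0 * trace (matrix_inv S)"
        unfolding d0_def by (rule trace_mult_inverse_bounds(2)[OF D S])
      also have "\<dots> \<le> d0 * k" using d0 kS by (intro mult_left_mono)
      also have "\<dots> \<le> d0 * k * n" using mult_left_mono[of 1 "real n" "d0 * k"] n d0 k by simp
      finally show ?thesis .
    qed
    have N1: "penalty C (\<alpha> - m) \<le> \<bar>R\<bar> * n"
    proof -
      have "penalty C (\<alpha> - m) \<le> \<bar>R\<bar> * 1" using \<alpha> by simp
      also have "\<dots> \<le> \<bar>R\<bar> * n" using n by (intro mult_left_mono) auto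
      finally show ?thesis .
    qed
    let ?p0 = "(2 * pi) powr (- (real n * real CARD('r) / 2))"
    have "exp (- L * n) = exp (- (ln e1 * n)) * exp (- (1/2) * (l2 * n)) * exp (- (1/2) * (d0 * k * n)) * exp (- (1/2) * (\<bar>R\<bar> * n))"
      by (simp add: L_def algebra_simps flip: exp_add)
    also have "\<dots> \<le> det S powr (- h) * exp (- (1/2) * rss S (\<alpha>, B)) * exp (- (1/2) * trace (D ** matrix_inv S)) * exp (- (1/2) * penalty C (\<alpha> - m))"
      using rss D1 N1 by (intro mult_mono det mult_nonneg_nonneg) auto
    finally have "?p0 * exp (- L * n) \<le> ?p0 * (det S powr (- h) * exp (- (1/2) * rss S (\<alpha>, B)) * exp (- (1/2) * trace (D ** matrix_inv S)) * exp (- (1/2) * penalty C (\<alpha> - m)))"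
      by (intro mult_left_mono) auto
    then show ?thesis by (simp add: unnorm_eq[OF S] h_def mult_ac)
  qed
  then show ?thesis by (rule that)
qed

lemma continuous_on_fitted:
  "continuous_on UNIV (\<lambda>z :: (real^('r::finite \<times> ('q::{finite,linorder} \<times> 'r))) \<times> (real^'r^'p). fitted y x z t)"
  unfolding fitted_def vector_matrix_mult_def unvec_def by (intro continuous_intros)

lemma weighted_fit_measurable[measurable]: "weighted_fit n y x S \<in> borel_measurable borel"
  unfolding weighted_fit_def
  by (intro borel_measurable_continuous_onI continuous_intros continuous_on_fitted)

lemma weighted_rss_measurable:
  "(\<lambda>w :: (real^('r \<times> ('q::{finite,linorder} \<times> 'r))) \<times> (real^'r^'p) \<times> (real^'r^'r).
      weighted_rss n y x (snd (snd w)) (fst w, fst (snd w))) \<in> borel_measurable (lborel \<Otimes>\<^sub>M (lborel \<Otimes>\<^sub>M spd_lborel))"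
    (is "_ \<in> borel_measurable ?J")
proof -
  have fstm: "(\<lambda>w. (fst w, fst (snd w))) \<in> ?J \<rightarrow>\<^sub>M borel"
    unfolding borel_prod[symmetric] by measurable
  have res[measurable]: "(\<lambda>w. residual y x (fst w) (fst (snd w)) t) \<in> ?J \<rightarrow>\<^sub>M borel" for t
  proof -
    have "(\<lambda>z :: (real^('r \<times> ('q \<times> 'r))) \<times> (real^'r^'p). y t - fitted y x z t) \<in> borel \<rightarrow>\<^sub>M borel"
      by (intro borel_measurable_continuous_onI continuous_intros continuous_on_fitted)
    from measurable_compose[OF fstm this] show ?thesis by (simp add: residual_fitted)
  qed
  have inv[measurable]: "(\<lambda>w. matrix_inv (snd (snd w))) \<in> ?J \<rightarrow>\<^sub>M borel"
    by (rule measurable_compose[OF _ continuous_on_spd_measurable[OF continuous_on_matrix_inv]]) measurable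
  have "(\<lambda>w. residual y x (fst w) (fst (snd w)) t \<bullet> (matrix_inv (snd (snd w)) *v residual y x (fst w) (fst (snd w)) t))
      \<in> borel_measurable ?J" for t
    by (intro borel_measurable_continuous_Pair[OF res borel_measurable_continuous_Pair[OF inv res]] continuous_intros)
  then show ?thesis unfolding weighted_rss_def by (simp add: borel_measurable_sum)
qed

lemma unnorm_measurable:
  fixes m :: "real^('r::finite \<times> ('q::{finite,linorder} \<times> 'r))"
  shows "(\<lambda>(\<alpha>, B, S). ennreal (unnorm m C D a n y (x :: int \<Rightarrow> real^'p) \<alpha> B S)) \<in> borel_measurable (lborel \<Otimes>\<^sub>M (lborel \<Otimes>\<^sub>M spd_lborel))"
    (is "_ \<in> borel_measurable ?J")
proof -
  have det: "(\<lambda>S :: real^'r^'r. det S powr c) \<in> borel_measurable spd_lborel" for c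
    by (intro continuous_on_spd_measurable continuous_on_powr continuous_on_det continuous_intros)
       (auto dest: sym_pos_def_invertible(3))
  have tr: "(\<lambda>S :: real^'r^'r. trace (D ** matrix_inv S)) \<in> borel_measurable spd_lborel"
    unfolding matrix_matrix_mult_def trace_def
    by (intro continuous_on_spd_measurable continuous_intros continuous_on_matrix_inv)
  have snd: "(\<lambda>w. snd (snd w)) \<in> ?J \<rightarrow>\<^sub>M spd_lborel" by measurable
  note [measurable] = measurable_compose[OF snd det] measurable_compose[OF snd tr] weighted_rss_measurable
  have pen[measurable]: "(\<lambda>w. penalty C (fst w - m)) \<in> borel_measurable ?J" by measurable
  have "(\<lambda>w. ennreal ((2 * pi) powr (- (real n * real CARD('r) / 2)) * det (snd (snd w)) powr (- ((real n + a) / 2)) *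
      exp (- (1/2) * weighted_rss n y x (snd (snd w)) (fst w, fst (snd w))) *
      exp (- (1/2) * trace (D ** matrix_inv (snd (snd w)))) * exp (- (1/2) * penalty C (fst w - m)))) \<in> borel_measurable ?J"
    by measurable
  then show ?thesis
    by (rule measurable_cong[THEN iffD1, rotated]) (auto simp: space_pair_measure unnorm_eq)
qed

text \<open>
  The condition \<open>a \<le> n\<close> keeps the exponent \<open>(n + a) / 2\<close> of the determinant between \<open>n / 2\<close> and \<open>n\<close>.
\<close>

locale var_posterior = design n y x K Q
  for n :: nat and y :: "int \<Rightarrow> real^'r" and x :: "int \<Rightarrow> real^'p" and K and Q :: "'q::{finite,linorder} itself" +
  fixes m :: "real^('r \<times> ('q \<times> 'r))"
    and C :: "real^('r \<times> ('q \<times> 'r))^('r \<times> ('q \<times> 'r))"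
    and D :: "real^'r^'r"
    and a :: real
  assumes D: "sym_pos_semidef D" and a: "0 \<le> a" "a \<le> real n" and C: "sym_pos_def C"
begin

definition w :: "real^('r \<times> ('q \<times> 'r)) \<Rightarrow> real^'r^'p \<Rightarrow> real^'r^'r \<Rightarrow> ennreal" where
  "w \<alpha> B S = ennreal (unnorm m C D a n y x \<alpha> B S)"

sublocale S: sigma_finite_measure "spd_lborel :: (real^'r^'r) measure"
  by (rule sigma_finite_spd_lborel)

sublocale W: three_block_density lborel lborel spd_lborel w
  by unfold_locales (unfold w_def, rule unnorm_measurable)

abbreviation "decay_B \<equiv> \<lambda>B :: real^'r^'p. ennreal (inverse ((1 + B \<bullet> B) ^ DIM(real^'r^'p)))"
abbreviation "decay_S \<equiv> \<lambda>S :: real^'r^'r. ennreal (inverse ((1 + trace S) ^ (2 * CARD('r uprod))))"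
abbreviation "decay_A \<equiv> \<lambda>\<alpha>. ennreal (exp (- (1/2) * penalty C (\<alpha> - m)))"

lemma decay_A_finite: "(\<integral>\<^sup>+\<alpha>. decay_A \<alpha> \<partial>lborel) < \<infinity>"
proof -
  obtain c where c: "0 < c" "\<And>u. c * (u \<bullet> u) \<le> u \<bullet> (C *v u)"
    using sym_pos_def_coercive[OF C] by blast
  have "(\<integral>\<^sup>+\<alpha>. decay_A \<alpha> \<partial>lborel) = (\<integral>\<^sup>+u. ennreal (exp (- (1/2) * penalty C u)) \<partial>lborel)"
    by (subst nn_integral_lborel_affine[of _ 1 m]) auto
  also have "\<dots> \<le> (\<integral>\<^sup>+(u :: real^('r \<times> ('q \<times> 'r))). ennreal (exp (- (c / 2) * (u \<bullet> u))) \<partial>lborel)"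
    using c(2) by (intro nn_integral_mono ennreal_leI) (simp add: penalty_def)
  also have "\<dots> < \<infinity>" using c(1) by (intro nn_integral_gaussian_finite) simp
  finally show ?thesis .
qed

lemma w_pos: "sym_pos_def S \<Longrightarrow> 0 < w \<alpha> B S"
  by (simp add: w_def unnorm_pos)

lemma spd_lborel_nonnull: "emeasure (spd_lborel :: (real^'r^'r) measure) (space spd_lborel) \<noteq> 0"
proof -
  obtain k where "1 \<le> k" and k: "0 < emeasure (spd_lborel :: (real^'r^'r) measure) {S. sym_pos_def S \<and> trace S \<le> k \<and> trace (matrix_inv S) \<le> k}"
    by (rule spd_trace_bounds_positive)
  have "emeasure (spd_lborel :: (real^'r^'r) measure) {S. sym_pos_def S \<and> trace S \<le> k \<and> trace (matrix_inv S) \<le> k}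
      \<le> emeasure (spd_lborel :: (real^'r^'r) measure) (space spd_lborel)"
    by (rule emeasure_space)
  with k show ?thesis by (auto simp: zero_less_iff_neq_zero)
qed

lemma g_pos: "sym_pos_def S \<Longrightarrow> 0 < W.g \<alpha> S"
  unfolding W.g_def by (rule nn_integral_pos_of_pos) (auto intro: w_pos)

lemma gS_pos: "0 < (\<integral>\<^sup>+S. W.g \<alpha> S \<partial>spd_lborel)"
  by (rule nn_integral_pos_of_pos) (auto intro: g_pos simp: spd_lborel_nonnull[simplified])

lemma gA_pos: "sym_pos_def S \<Longrightarrow> 0 < (\<integral>\<^sup>+\<alpha>. W.g \<alpha> S \<partial>lborel)"
  by (rule nn_integral_pos_of_pos) (auto intro: g_pos)

lemma total_eq: "(\<integral>\<^sup>+z. (case z of (\<alpha>, B, S) \<Rightarrow> w \<alpha> B S) \<partial>W.joint) = (\<integral>\<^sup>+S. \<integral>\<^sup>+\<alpha>. W.g \<alpha> S \<partial>lborel \<partial>spd_lborel)"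
  unfolding W.g_def by (subst W.nn_integral_joint) (auto intro: W.p_measurable)

lemma total_pos: "0 < (\<integral>\<^sup>+z. (case z of (\<alpha>, B, S) \<Rightarrow> w \<alpha> B S) \<partial>W.joint)"
  unfolding total_eq by (rule nn_integral_pos_of_pos) (auto intro: gA_pos simp: spd_lborel_nonnull[simplified])

lemma g_le:
  assumes S: "sym_pos_def S" and z: "0 \<le> \<zeta>"
    and bound: "\<And>B. unnorm m C D a n y x \<alpha> B S \<le> \<zeta> * (envelope B S * exp (- (1/2) * penalty C (\<alpha> - m)))"
  shows "W.g \<alpha> S \<le> ennreal \<zeta> * (\<integral>\<^sup>+B. decay_B B \<partial>lborel) * decay_S S * decay_A \<alpha>"
proof -
  have t: "0 < trace S" by (rule spd_entry_le_trace(3)[OF S])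
  have "W.g \<alpha> S \<le> (\<integral>\<^sup>+B. (ennreal \<zeta> * decay_S S * decay_A \<alpha>) * decay_B B \<partial>lborel)"
    unfolding W.g_def
  proof (intro nn_integral_mono)
    fix B
    have "w \<alpha> B S \<le> ennreal (\<zeta> * (envelope B S * exp (- (1/2) * penalty C (\<alpha> - m))))"
      unfolding w_def by (intro ennreal_leI bound)
    also have "\<dots> = (ennreal \<zeta> * decay_S S * decay_A \<alpha>) * decay_B B"
      using z t by (simp add: envelope_def mult_ac flip: ennreal_mult)
    finally show "w \<alpha> B S \<le> (ennreal \<zeta> * decay_S S * decay_A \<alpha>) * decay_B B" .
  qed
  also have "\<dots> = (ennreal \<zeta> * decay_S S * decay_A \<alpha>) * (\<integral>\<^sup>+B. decay_B B \<partial>lborel)"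
    by (rule nn_integral_cmult) measurable
  finally show ?thesis by (simp add: mult_ac)
qed

lemma finiteness:
  assumes z: "0 \<le> \<zeta>"
    and bound: "\<And>\<alpha> B S. sym_pos_def S \<Longrightarrow> unnorm m C D a n y x \<alpha> B S \<le> \<zeta> * (envelope B S * exp (- (1/2) * penalty C (\<alpha> - m)))"
  shows "sym_pos_def S \<Longrightarrow> W.g \<alpha> S < \<infinity>"
    and "(\<integral>\<^sup>+S. W.g \<alpha> S \<partial>spd_lborel) < \<infinity>"
    and "sym_pos_def S \<Longrightarrow> (\<integral>\<^sup>+\<alpha>. W.g \<alpha> S \<partial>lborel) < \<infinity>"
    and "(\<integral>\<^sup>+z. (case z of (\<alpha>, B, S) \<Rightarrow> w \<alpha> B S) \<partial>W.joint) < \<infinity>"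
proof -
  let ?B = "ennreal \<zeta> * (\<integral>\<^sup>+B. decay_B B \<partial>lborel)"
  have B: "?B < \<infinity>" using nn_integral_decay_finite[where 'a = "real^'r^'p"] by (simp add: ennreal_mult_less_top)
  have g: "W.g \<alpha> S \<le> ?B * decay_S S * decay_A \<alpha>" if "sym_pos_def S" for \<alpha> S
    by (rule g_le[OF that z bound[OF that]])
  show "W.g \<alpha> S < \<infinity>" if "sym_pos_def S"
    using B by (intro le_less_trans[OF g[OF that]]) (simp add: ennreal_mult_less_top)
  have "(\<integral>\<^sup>+S. W.g \<alpha> S \<partial>spd_lborel) \<le> (\<integral>\<^sup>+S. ?B * decay_A \<alpha> * decay_S S \<partial>spd_lborel)"
    using g by (intro nn_integral_mono) (simp add: mult_ac)
  also have "\<dots> = ?B * decay_A \<alpha> * (\<integral>\<^sup>+S. decay_S S \<partial>spd_lborel)"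
    by (rule nn_integral_cmult) measurable
  also have "\<dots> < \<infinity>" using B nn_integral_spd_decay_finite[where 'r = 'r] by (simp add: ennreal_mult_less_top)
  finally show "(\<integral>\<^sup>+S. W.g \<alpha> S \<partial>spd_lborel) < \<infinity>" .
  have gA: "(\<integral>\<^sup>+\<alpha>. W.g \<alpha> S \<partial>lborel) \<le> ?B * (\<integral>\<^sup>+\<alpha>. decay_A \<alpha> \<partial>lborel) * decay_S S" if S: "sym_pos_def S" for S
  proof -
    have "(\<integral>\<^sup>+\<alpha>. W.g \<alpha> S \<partial>lborel) \<le> (\<integral>\<^sup>+\<alpha>. ?B * decay_S S * decay_A \<alpha> \<partial>lborel)"
      using g[OF S] by (intro nn_integral_mono)
    also have "\<dots> = ?B * decay_S S * (\<integral>\<^sup>+\<alpha>. decay_A \<alpha> \<partial>lborel)"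
      by (rule nn_integral_cmult) measurable
    finally show ?thesis by (simp add: mult_ac)
  qed
  show "(\<integral>\<^sup>+\<alpha>. W.g \<alpha> S \<partial>lborel) < \<infinity>" if "sym_pos_def S"
    using B decay_A_finite by (intro le_less_trans[OF gA[OF that]]) (simp add: ennreal_mult_less_top)
  have "(\<integral>\<^sup>+S. \<integral>\<^sup>+\<alpha>. W.g \<alpha> S \<partial>lborel \<partial>spd_lborel) \<le> (\<integral>\<^sup>+S. ?B * (\<integral>\<^sup>+\<alpha>. decay_A \<alpha> \<partial>lborel) * decay_S S \<partial>spd_lborel)"
    using gA by (intro nn_integral_mono) simp
  also have "\<dots> = ?B * (\<integral>\<^sup>+\<alpha>. decay_A \<alpha> \<partial>lborel) * (\<integral>\<^sup>+S. decay_S S \<partial>spd_lborel)"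
    by (rule nn_integral_cmult) measurable
  also have "\<dots> < \<infinity>" using B decay_A_finite nn_integral_spd_decay_finite[where 'r = 'r] by (simp add: ennreal_mult_less_top)
  finally show "(\<integral>\<^sup>+z. (case z of (\<alpha>, B, S) \<Rightarrow> w \<alpha> B S) \<partial>W.joint) < \<infinity>"
    unfolding total_eq .
qed

end

section \<open>The three estimates behind the minorization\<close>

context var_posterior
begin

text \<open>
  For fixed \<open>S\<close>, the posterior of \<open>(\<alpha>, \<B>)\<close> is the prior of \<open>\<alpha>\<close> times an even Gaussian weight around a centre
  that is the same for all \<open>S\<close>. The factor \<open>\<kappa>\<close> cancels in conditional densities.
\<close>

lemma split_at_least_squares:
  obtains zh where "fst zh \<bullet> fst zh \<le> CARD('r) * K\<^sup>2"
    and "\<And>S. sym_pos_def S \<Longrightarrow> \<exists>\<kappa>>0. \<forall>\<alpha> B. unnorm m C D a n y x \<alpha> B S =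
      \<kappa> * (exp (- (1/2) * penalty C (\<alpha> - m)) * exp (- (1/2) * fit S ((\<alpha>, B) - zh)))"
proof -
  obtain zh :: "(real^('r \<times> ('q \<times> 'r))) \<times> (real^'r^'p)"
    where zh: "\<And>S z. sym_pos_def S \<Longrightarrow> rss S z = rss S zh + fit S (z - zh)"
      "fst zh \<bullet> fst zh \<le> CARD('r) * K\<^sup>2"
    using least_squares by metis
  have "\<exists>\<kappa>>0. \<forall>\<alpha> B. unnorm m C D a n y x \<alpha> B S =
      \<kappa> * (exp (- (1/2) * penalty C (\<alpha> - m)) * exp (- (1/2) * fit S ((\<alpha>, B) - zh)))" if S: "sym_pos_def S" for S
  proof -
    let ?\<kappa> = "(2 * pi) powr (- (real n * real CARD('r) / 2)) * det S powr (- ((real n + a) / 2)) *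
      exp (- (1/2) * trace (D ** matrix_inv S)) * exp (- (1/2) * rss S zh)"
    have split: "exp (- (1/2) * rss S (\<alpha>, B)) = exp (- (1/2) * rss S zh) * exp (- (1/2) * fit S ((\<alpha>, B) - zh))" for \<alpha> B
      by (subst zh(1)[OF S]) (simp add: distrib_left flip: exp_add)
    have "0 < ?\<kappa>" using sym_pos_def_det_pos[OF S] by simp
    moreover have "unnorm m C D a n y x \<alpha> B S =
      ?\<kappa> * (exp (- (1/2) * penalty C (\<alpha> - m)) * exp (- (1/2) * fit S ((\<alpha>, B) - zh)))" for \<alpha> B
      unfolding unnorm_eq[OF S] split by (simp only: mult_ac)
    ultimately show ?thesis by blast
  qed
  with zh(2) show ?thesis by (rule that)
qed

lemma w_section_measurable:
  assumes S: "sym_pos_def S"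
  shows "(\<lambda>z. w (fst z) (snd z) S) \<in> borel_measurable borel"
proof -
  have [measurable]: "S \<in> space spd_lborel" using S by simp
  have "(\<lambda>z. w (fst z) (snd z) S) \<in> borel_measurable (lborel \<Otimes>\<^sub>M lborel)" by measurable
  then show ?thesis by (simp add: lborel_prod)
qed

lemma nn_integral_gA:
  assumes S: "sym_pos_def S" and U[measurable]: "U \<in> sets borel"
  shows "(\<integral>\<^sup>+\<alpha>. W.g \<alpha> S * indicator U \<alpha> \<partial>lborel) = (\<integral>\<^sup>+z. w (fst z) (snd z) S * indicator U (fst z) \<partial>lborel)"
proof -
  have [measurable]: "S \<in> space spd_lborel" using S by simp
  have "(\<integral>\<^sup>+\<alpha>. W.g \<alpha> S * indicator U \<alpha> \<partial>lborel) = (\<integral>\<^sup>+\<alpha>. \<integral>\<^sup>+B. w \<alpha> B S * indicator U \<alpha> \<partial>lborel \<partial>lborel)"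
    unfolding W.g_def by (intro nn_integral_cong nn_integral_multc[symmetric]) measurable
  also have "\<dots> = (\<integral>\<^sup>+z. w (fst z) (snd z) S * indicator U (fst z) \<partial>(lborel \<Otimes>\<^sub>M lborel))"
    by (subst lborel.nn_integral_fst[symmetric]) (simp_all, measurable)
  finally show ?thesis by (simp add: lborel_prod)
qed

text \<open>
  An instance of \<open>prior_weighted_mass\<close> after moving the origin to the least squares estimate.
\<close>

lemma prior_ball_likely:
  assumes S: "sym_pos_def S" and fin: "(\<integral>\<^sup>+\<alpha>. W.g \<alpha> S \<partial>lborel) < \<infinity>"
    and zh: "\<exists>\<kappa>>0. \<forall>\<alpha> B. unnorm m C D a n y x \<alpha> B S =
      \<kappa> * (exp (- (1/2) * penalty C (\<alpha> - m)) * exp (- (1/2) * fit S ((\<alpha>, B) - zh)))"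
    and R: "2 * 2 ^ DIM((real^('r \<times> ('q \<times> 'r))) \<times> (real^'r^'p)) * exp (3 / 4 * penalty C (fst zh - m)) \<le> exp (R / 4)"
  shows "(\<integral>\<^sup>+\<alpha>. W.g \<alpha> S \<partial>lborel) \<le> 2 * (\<integral>\<^sup>+\<alpha>. W.g \<alpha> S * indicator {\<alpha>. penalty C (\<alpha> - m) \<le> R} \<alpha> \<partial>lborel)"
proof -
  obtain \<kappa> where \<kappa>: "0 < \<kappa>" "\<And>\<alpha> B. unnorm m C D a n y x \<alpha> B S =
      \<kappa> * (exp (- (1/2) * penalty C (\<alpha> - m)) * exp (- (1/2) * fit S ((\<alpha>, B) - zh)))"
    using zh by blast
  let ?v = "fst zh - m"
  define f where "f z = ennreal (exp (- (1/2) * penalty C (fst z + ?v)) * exp (- (1/2) * fit S z))" for z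
  have fm[measurable]: "f \<in> borel_measurable borel" unfolding f_def by measurable
  have int: "(\<integral>\<^sup>+\<alpha>. W.g \<alpha> S * indicator {\<alpha>. \<alpha> - m \<in> T} \<alpha> \<partial>lborel) = ennreal \<kappa> * (\<integral>\<^sup>+z. f z * indicator T (fst z + ?v) \<partial>lborel)"
    if T[measurable]: "T \<in> sets borel" for T
  proof -
    have wf: "w (fst (zh + z)) (snd (zh + z)) S = ennreal \<kappa> * f z" for z
    proof -
      have "(fst (zh + z), snd (zh + z)) - zh = z" by (simp add: prod_eq_iff)
      moreover have "fst (zh + z) - m = fst z + ?v" by simp
      ultimately show ?thesis
        using \<kappa>(1) by (simp only: w_def \<kappa>(2) f_def ennreal_mult less_imp_le mult_nonneg_nonneg exp_ge_zero)
    qed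
    have m1: "{\<alpha>. \<alpha> - m \<in> T} \<in> sets borel" by measurable
    have "(\<lambda>z :: (real^('r \<times> ('q \<times> 'r))) \<times> (real^'r^'p). indicator {\<alpha>. \<alpha> - m \<in> T} (fst z) :: ennreal) \<in> borel_measurable borel"
      using m1 by measurable
    then have m2: "(\<lambda>z. w (fst z) (snd z) S * indicator {\<alpha>. \<alpha> - m \<in> T} (fst z)) \<in> borel_measurable borel"
      by (intro borel_measurable_times_ennreal w_section_measurable[OF S])
    have "(\<integral>\<^sup>+\<alpha>. W.g \<alpha> S * indicator {\<alpha>. \<alpha> - m \<in> T} \<alpha> \<partial>lborel) =
        (\<integral>\<^sup>+z. w (fst z) (snd z) S * indicator {\<alpha>. \<alpha> - m \<in> T} (fst z) \<partial>lborel)"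
      by (rule nn_integral_gA[OF S m1])
    also have "\<dots> = (\<integral>\<^sup>+z. w (fst (zh + z)) (snd (zh + z)) S * indicator {\<alpha>. \<alpha> - m \<in> T} (fst (zh + z)) \<partial>lborel)"
      using nn_integral_lborel_affine[OF m2, of 1 zh] by simp
    also have "\<dots> = (\<integral>\<^sup>+z. ennreal \<kappa> * (f z * indicator T (fst z + ?v)) \<partial>lborel)"
      unfolding wf by (intro nn_integral_cong) (simp add: indicator_def algebra_simps)
    also have "\<dots> = ennreal \<kappa> * (\<integral>\<^sup>+z. f z * indicator T (fst z + ?v) \<partial>lborel)"
      by (rule nn_integral_cmult) measurable
    finally show ?thesis .
  qed
  have tot: "(\<integral>\<^sup>+\<alpha>. W.g \<alpha> S \<partial>lborel) = ennreal \<kappa> * (\<integral>\<^sup>+z. f z \<partial>lborel)"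
    using int[of UNIV] by simp
  have "(\<integral>\<^sup>+z. f z \<partial>lborel) < \<infinity>"
    using fin \<kappa>(1) unfolding tot by (auto simp: ennreal_mult_less_top)
  then have "(\<integral>\<^sup>+z. f z \<partial>lborel) \<le> 2 * (\<integral>\<^sup>+z. f z * indicator {u. penalty C u \<le> R} (fst z + ?v) \<partial>lborel)"
    unfolding f_def using R
    by (intro prior_weighted_mass penalty_parallelogram penalty_nonneg C weighted_fit_scaleR weighted_fit_nonneg S) measurable
  then have "ennreal \<kappa> * (\<integral>\<^sup>+z. f z \<partial>lborel) \<le> ennreal \<kappa> * (2 * (\<integral>\<^sup>+z. f z * indicator {u. penalty C u \<le> R} (fst z + ?v) \<partial>lborel))"
    by (rule mult_left_mono) simp
  moreover have "{u. penalty C u \<le> R} \<in> sets borel" by measurable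
  ultimately show ?thesis
    unfolding tot using int[of "{u. penalty C u \<le> R}"] by (simp add: mult.left_commute)
qed

text \<open>
  An instance of \<open>gaussian_ball_density\<close>, with the constants of \<open>fit_bounds\<close>.
\<close>

lemma neighbourhood_density:
  assumes S: "sym_pos_def S"
    and zh: "\<exists>\<kappa>>0. \<forall>\<alpha> B. unnorm m C D a n y x \<alpha> B S =
      \<kappa> * (exp (- (1/2) * penalty C (\<alpha> - m)) * exp (- (1/2) * fit S ((\<alpha>, B) - zh)))"
    and k: "0 < k1" "0 \<le> k2" "K * CARD('r) * trace S \<le> 1 / k1" "K * CARD('r) * trace (matrix_inv S) \<le> k2"
    and N1: "penalty C (\<alpha> - m) \<le> N1" and \<alpha>: "norm (\<alpha> - fst zh) < 1 / sqrt n"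
    and G: "(\<integral>\<^sup>+(z :: (real^('r \<times> ('q \<times> 'r))) \<times> (real^'r^'p)). ennreal (exp (- (k1 / 2) * (z \<bullet> z))) \<partial>lborel) \<le> ennreal G" "0 < G"
  shows "ennreal (exp (- N1 / 2 - k2) * unit_ball_vol DIM(real^'r^'p) * sqrt n ^ DIM(real^('r \<times> ('q \<times> 'r))) / G) *
      (\<integral>\<^sup>+u. W.g u S \<partial>lborel) \<le> W.g \<alpha> S"
proof -
  obtain \<kappa> where \<kappa>: "0 < \<kappa>" "\<And>\<alpha> B. unnorm m C D a n y x \<alpha> B S =
      \<kappa> * (exp (- (1/2) * penalty C (\<alpha> - m)) * exp (- (1/2) * fit S ((\<alpha>, B) - zh)))"
    using zh by blast
  let ?N = "\<lambda>u. penalty C (u - m)"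
  define f where "f z = ennreal (exp (- (1/2) * ?N (fst z)) * exp (- (1/2) * fit S (z - (fst zh, snd zh))))" for z
  have wf: "w u B S = ennreal \<kappa> * f (u, B)" for u B
    using \<kappa>(1) by (simp add: w_def \<kappa>(2) f_def ennreal_mult)
  have [measurable]: "(\<lambda>z. z - (fst zh, snd zh)) \<in> borel_measurable borel"
    by (intro borel_measurable_continuous_onI continuous_intros)+
  have fm[measurable]: "f \<in> borel_measurable borel" unfolding f_def by measurable
  have pair: "(\<lambda>B. (\<alpha>, B)) \<in> borel \<rightarrow>\<^sub>M borel" by (intro borel_measurable_continuous_onI continuous_intros)
  have tr: "0 < trace S" by (rule spd_entry_le_trace(3)[OF S])
  have n0: "0 < real n" using n by simp
  let ?c = "ennreal (exp (- N1 / 2 - k2) * unit_ball_vol DIM(real^'r^'p) * sqrt n ^ DIM(real^('r \<times> ('q \<times> 'r))) / G)"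
  have "?c * (\<integral>\<^sup>+z. f z \<partial>lborel) \<le> (\<integral>\<^sup>+B. f (\<alpha>, B) \<partial>lborel)"
    unfolding f_def fst_conv
  proof (rule gaussian_ball_density[where N = ?N, OF _ _ _ n0 k(1) _ _ N1 \<alpha> k(2) G])
    show "real n * k1 * (z \<bullet> z) \<le> fit S z" for z
    proof -
      have "k1 \<le> 1 / (K * CARD('r) * trace S)" using k(1,3) tr K by (simp add: field_simps)
      then have "real n * k1 \<le> real n * (1 / (K * CARD('r) * trace S))" by (intro mult_left_mono) auto
      then have "real n * k1 * (z \<bullet> z) \<le> real n / (K * CARD('r) * trace S) * (z \<bullet> z)"
        by (intro mult_right_mono) auto
      also have "\<dots> \<le> fit S z" by (rule fit_bounds(1)[OF S])
      finally show ?thesis .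
    qed
    show "fit S z \<le> real n * k2 * (z \<bullet> z)" for z
    proof -
      have "fit S z \<le> K * real n * CARD('r) * trace (matrix_inv S) * (z \<bullet> z)" by (rule fit_bounds(2)[OF S])
      also have "\<dots> = real n * (K * CARD('r) * trace (matrix_inv S)) * (z \<bullet> z)" by (simp add: mult_ac)
      also have "\<dots> \<le> real n * k2 * (z \<bullet> z)" using k(4) by (intro mult_right_mono mult_left_mono) auto
      finally show ?thesis .
    qed
  qed (use C in \<open>auto intro: penalty_nonneg\<close>)
  then have "ennreal \<kappa> * (?c * (\<integral>\<^sup>+z. f z \<partial>lborel)) \<le> ennreal \<kappa> * (\<integral>\<^sup>+B. f (\<alpha>, B) \<partial>lborel)"
    by (rule mult_left_mono) simp
  also have "\<dots> = W.g \<alpha> S"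
    unfolding W.g_def wf using measurable_compose[OF pair fm] by (intro nn_integral_cmult[symmetric]) simp
  also have "ennreal \<kappa> * (?c * (\<integral>\<^sup>+z. f z \<partial>lborel)) = ?c * (\<integral>\<^sup>+u. W.g u S \<partial>lborel)"
  proof -
    have "(\<integral>\<^sup>+u. W.g u S \<partial>lborel) = (\<integral>\<^sup>+z. ennreal \<kappa> * f z \<partial>lborel)"
      using nn_integral_gA[OF S, of UNIV] by (simp add: wf)
    also have "\<dots> = ennreal \<kappa> * (\<integral>\<^sup>+z. f z \<partial>lborel)" by (rule nn_integral_cmult) measurable
    finally show ?thesis by (simp add: mult.left_commute)
  qed
  finally show ?thesis .
qed

text \<open>
  Outside the set \<open>spread K S \<le> R\<close> the density is at most the envelope times \<open>exp (- n R / 4)\<close>, while the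
  total is at least \<open>l\<close> times the volume of a fixed set. The hypothesis on \<open>R\<close> says that the first is at
  most half the second.
\<close>

lemma covariance_likely:
  assumes upper: "\<And>B S. sym_pos_def S \<Longrightarrow> unnorm m C D a n y x \<alpha> B S \<le>
      (\<zeta> * exp (- (real n / 4) * spread K S)) * (envelope B S * exp (- (1/2) * penalty C (\<alpha> - m)))"
    and lower: "\<And>B S. sym_pos_def S \<Longrightarrow> trace S \<le> k \<Longrightarrow> trace (matrix_inv S) \<le> k \<Longrightarrow> B \<bullet> B \<le> 1 \<Longrightarrow>
      l \<le> unnorm m C D a n y x \<alpha> B S"
    and V0: "ennreal v \<le> emeasure (spd_lborel :: (real^'r^'r) measure) {S. sym_pos_def S \<and> trace S \<le> k \<and> trace (matrix_inv S) \<le> k}" "0 \<le> v"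
    and IB: "(\<integral>\<^sup>+B. decay_B B \<partial>lborel) \<le> ennreal ib" "0 \<le> ib"
    and IS: "(\<integral>\<^sup>+S. decay_S S \<partial>spd_lborel) \<le> ennreal is" "0 \<le> is"
    and \<zeta>: "0 \<le> \<zeta>" and l: "0 \<le> l"
    and R: "2 * (\<zeta> * exp (- (real n / 4) * R) * ib * is) \<le> l * unit_ball_vol DIM(real^'r^'p) * v"
    and fin: "(\<integral>\<^sup>+S. W.g \<alpha> S \<partial>spd_lborel) < \<infinity>"
  shows "(\<integral>\<^sup>+S. W.g \<alpha> S \<partial>spd_lborel) \<le> 2 * (\<integral>\<^sup>+S. W.g \<alpha> S * indicator {S. sym_pos_def S \<and> spread K S \<le> R} S \<partial>spd_lborel)"
proof -
  let ?V = "{S :: real^'r^'r. sym_pos_def S \<and> spread K S \<le> R}"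
  let ?V' = "{S :: real^'r^'r. sym_pos_def S \<and> \<not> spread K S \<le> R}"
  let ?Vk = "{S :: real^'r^'r. sym_pos_def S \<and> trace S \<le> k \<and> trace (matrix_inv S) \<le> k}"
  have "{S \<in> space spd_lborel. spread K S \<le> R} \<in> sets (spd_lborel :: (real^'r^'r) measure)"
    "{S \<in> space spd_lborel. \<not> spread K S \<le> R} \<in> sets (spd_lborel :: (real^'r^'r) measure)"
    "{S \<in> space spd_lborel. trace S \<le> k \<and> trace (matrix_inv S) \<le> k} \<in> sets (spd_lborel :: (real^'r^'r) measure)"
    by measurable
  then have [measurable]: "?V \<in> sets spd_lborel" "?V' \<in> sets spd_lborel" "?Vk \<in> sets spd_lborel" by simp_all
  define T where "T = (\<integral>\<^sup>+S. W.g \<alpha> S \<partial>spd_lborel)"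
  let ?A = "\<integral>\<^sup>+S. W.g \<alpha> S * indicator ?V S \<partial>spd_lborel"
  let ?B = "\<integral>\<^sup>+S. W.g \<alpha> S * indicator ?V' S \<partial>spd_lborel"
  let ?e = "\<zeta> * exp (- (real n / 4) * R)"
  have "?B \<le> (\<integral>\<^sup>+S. ennreal (?e * ib) * decay_S S \<partial>spd_lborel)"
  proof (intro nn_integral_mono)
    fix S :: "real^'r^'r" assume "S \<in> space spd_lborel"
    then have S: "sym_pos_def S" by simp
    show "W.g \<alpha> S * indicator ?V' S \<le> ennreal (?e * ib) * decay_S S"
    proof (cases "spread K S \<le> R")
      case False
      have "unnorm m C D a n y x \<alpha> B S \<le> ?e * (envelope B S * exp (- (1/2) * penalty C (\<alpha> - m)))" for B
      proof (rule order_trans[OF upper[OF S]])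
        have "exp (- (real n / 4) * spread K S) \<le> exp (- (real n / 4) * R)"
          using False by (simp add: mult_left_mono)
        then show "\<zeta> * exp (- (real n / 4) * spread K S) * (envelope B S * exp (- (1/2) * penalty C (\<alpha> - m)))
            \<le> ?e * (envelope B S * exp (- (1/2) * penalty C (\<alpha> - m)))"
          using \<zeta> spd_entry_le_trace(3)[OF S]
          by (intro mult_right_mono mult_left_mono) (auto simp: envelope_def)
      qed
      from g_le[OF S _ this] \<zeta> have "W.g \<alpha> S \<le> ennreal ?e * (\<integral>\<^sup>+B. decay_B B \<partial>lborel) * decay_S S * decay_A \<alpha>" by simp
      also have "\<dots> \<le> ennreal ?e * ennreal ib * decay_S S * 1"
        using IB penalty_nonneg[OF C, of "\<alpha> - m"] by (intro mult_mono) auto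
      finally show ?thesis using S \<zeta> IB False by (simp add: ennreal_mult)
    qed simp
  qed
  also have "\<dots> = ennreal (?e * ib) * (\<integral>\<^sup>+S. decay_S S \<partial>spd_lborel)"
    by (rule nn_integral_cmult) measurable
  also have "\<dots> \<le> ennreal (?e * ib) * ennreal is" by (intro mult_left_mono IS) simp
  also have "\<dots> = ennreal (?e * ib * is)" using \<zeta> IB IS by (simp add: ennreal_mult)
  finally have "2 * ?B \<le> 2 * ennreal (?e * ib * is)" by (intro mult_left_mono) auto
  also have "\<dots> = ennreal (2 * (?e * ib * is))" using \<zeta> IB IS by (simp add: ennreal_mult)
  also have "\<dots> \<le> ennreal (l * unit_ball_vol DIM(real^'r^'p) * v)" by (intro ennreal_leI R)
  also have "\<dots> = ennreal (l * unit_ball_vol DIM(real^'r^'p)) * ennreal v" using l V0 by (simp add: ennreal_mult)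
  also have "\<dots> \<le> ennreal (l * unit_ball_vol DIM(real^'r^'p)) * emeasure spd_lborel ?Vk"
    by (intro mult_left_mono V0) simp
  also have "\<dots> = (\<integral>\<^sup>+S. ennreal (l * unit_ball_vol DIM(real^'r^'p)) * indicator ?Vk S \<partial>spd_lborel)"
    by (rule nn_integral_cmult_indicator[symmetric]) measurable
  also have "\<dots> \<le> T"
    unfolding T_def
  proof (intro nn_integral_mono)
    fix S :: "real^'r^'r" assume "S \<in> space spd_lborel"
    show "ennreal (l * unit_ball_vol DIM(real^'r^'p)) * indicator ?Vk S \<le> W.g \<alpha> S"
    proof (cases "S \<in> ?Vk")
      case True
      have "ennreal (l * unit_ball_vol DIM(real^'r^'p)) = ennreal l * emeasure lborel (ball (0 :: real^'r^'p) 1)"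
        using l by (simp add: emeasure_ball ennreal_mult)
      also have "\<dots> = (\<integral>\<^sup>+B. ennreal l * indicator (ball (0 :: real^'r^'p) 1) B \<partial>lborel)"
        by (rule nn_integral_cmult_indicator[symmetric]) simp
      also have "\<dots> \<le> W.g \<alpha> S"
        unfolding W.g_def
      proof (intro nn_integral_mono)
        fix B :: "real^'r^'p"
        have "l \<le> unnorm m C D a n y x \<alpha> B S" if "B \<in> ball 0 1"
        proof (rule lower)
          show "B \<bullet> B \<le> 1" using that by (simp add: dot_square_norm abs_square_le_1)
        qed (use True in auto)
        then show "ennreal l * indicator (ball 0 1) B \<le> w \<alpha> B S"
          by (auto simp: w_def indicator_def intro: ennreal_leI)
      qed
      finally show ?thesis using True by simp
    qed simp
  qed
  finally have half: "2 * ?B \<le> T" .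
  have "T = (\<integral>\<^sup>+S. W.g \<alpha> S * indicator ?V S + W.g \<alpha> S * indicator ?V' S \<partial>spd_lborel)"
    unfolding T_def by (intro nn_integral_cong) (auto simp: indicator_def)
  also have "\<dots> = ?A + ?B" by (rule nn_integral_add) measurable
  finally have "T + T = 2 * ?A + 2 * ?B" by (simp add: mult_2 add_ac)
  also have "\<dots> \<le> T + 2 * ?A" using half by (simp add: add.commute add_left_mono)
  finally have "T = \<infinity> \<or> T \<le> 2 * ?A" unfolding ennreal_add_left_cancel_le .
  then show ?thesis using fin unfolding T_def by auto
qed

end

section \<open>A rate that does not depend on the data\<close>

text \<open>
  The conclusion that the three kernels have in common, for one path of the data.
\<close>

definition samplers_converge where
  "samplers_converge m C D a n y x \<rho> \<longleftrightarrow>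
    posterior_proper m C D a n y x \<and>
    geom_bounded (kernel_C m C D a n y x) (posterior m C D a n y x) \<rho> \<and>
    geom_bounded (kernel_G m C D a n y x) (posterior_A_Sigma m C D a n y x) \<rho> \<and>
    geom_bounded (kernel_A m C D a n y x) (posterior_A m C D a n y x) \<rho>"

context var_posterior
begin

lemma norm_const_eq: "norm_const m C D a n y x = (\<integral>\<^sup>+z. (case z of (\<alpha>, B, S) \<Rightarrow> w \<alpha> B S) \<partial>W.joint)"
  unfolding norm_const_def param_lborel_def w_def unnorm_def ..

lemma post_eq: "post m C D a n y x = (\<lambda>\<alpha> B S. w \<alpha> B S / norm_const m C D a n y x)"
  by (simp add: fun_eq_iff post_def w_def unnorm_def)

text \<open>
  The posterior is the unnormalised density divided by \<open>norm_const\<close>, and the three hypotheses are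
  invariant under such a scaling, so the abstract result for Gibbs samplers applies.
\<close>

lemma kernels_geom_bounded:
  assumes g_fin: "\<And>\<alpha> S. sym_pos_def S \<Longrightarrow> W.g \<alpha> S < \<infinity>"
    and gS_fin: "\<And>\<alpha>. (\<integral>\<^sup>+S. W.g \<alpha> S \<partial>spd_lborel) < \<infinity>"
    and gA_fin: "\<And>S. sym_pos_def S \<Longrightarrow> (\<integral>\<^sup>+\<alpha>. W.g \<alpha> S \<partial>lborel) < \<infinity>"
    and total_fin: "(\<integral>\<^sup>+z. (case z of (\<alpha>, B, S) \<Rightarrow> w \<alpha> B S) \<partial>W.joint) < \<infinity>"
    and U: "U \<in> sets borel" and V: "V \<in> sets spd_lborel" and N: "N \<in> sets borel"
    and U_likely: "\<And>S. sym_pos_def S \<Longrightarrow> (\<integral>\<^sup>+\<alpha>. W.g \<alpha> S \<partial>lborel) \<le> 2 * (\<integral>\<^sup>+\<alpha>. W.g \<alpha> S * indicator U \<alpha> \<partial>lborel)"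
    and V_likely: "\<And>\<alpha>. \<alpha> \<in> U \<Longrightarrow> (\<integral>\<^sup>+S. W.g \<alpha> S \<partial>spd_lborel) \<le> 2 * (\<integral>\<^sup>+S. W.g \<alpha> S * indicator V S \<partial>spd_lborel)"
    and N_dense: "\<And>S \<alpha>. S \<in> V \<Longrightarrow> \<alpha> \<in> N \<Longrightarrow> c * (\<integral>\<^sup>+u. W.g u S \<partial>lborel) \<le> W.g \<alpha> S"
    and N_meas: "0 < emeasure lborel N" "emeasure lborel N < \<infinity>"
    and \<epsilon>: "4 * ennreal \<epsilon> \<le> c * emeasure lborel N" "0 \<le> \<epsilon>" "\<epsilon> < 1"
  shows "samplers_converge m C D a n y x (root 3 (1 - \<epsilon>))"
proof -
  define Z where "Z = norm_const m C D a n y x"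
  have Z: "0 < Z" "Z < \<infinity>"
    unfolding Z_def norm_const_eq using total_pos total_fin by auto
  then have proper: "posterior_proper m C D a n y x"
    by (simp add: posterior_proper_def Z_def)
  interpret G: gibbs_sampler lborel lborel spd_lborel "post m C D a n y x"
    unfolding post_eq norm_const_eq
    using total_fin g_fin gS_fin gA_fin
    by (intro W.normalised_gibbs_sampler) (auto intro: total_pos g_pos gS_pos gA_pos)
  have Gg: "G.g \<alpha> S = W.g \<alpha> S / Z" if "sym_pos_def S" for \<alpha> S
    unfolding G.g_def unfolding post_eq Z_def[symmetric] using that by (intro W.g_divide Z) auto
  have GA: "(\<integral>\<^sup>+\<alpha>. G.g \<alpha> S * h \<alpha> \<partial>lborel) = (\<integral>\<^sup>+\<alpha>. W.g \<alpha> S * h \<alpha> \<partial>lborel) / Z"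
    if [measurable]: "h \<in> borel_measurable borel" and S: "sym_pos_def S" for h S
  proof -
    have [measurable]: "S \<in> space spd_lborel" using S by simp
    show ?thesis
      by (subst nn_integral_divide[symmetric])
         (auto intro!: nn_integral_cong simp: Gg[OF S] divide_ennreal_def mult_ac)
  qed
  have GS: "(\<integral>\<^sup>+S. G.g \<alpha> S * h S \<partial>spd_lborel) = (\<integral>\<^sup>+S. W.g \<alpha> S * h S \<partial>spd_lborel) / Z"
    if [measurable]: "h \<in> borel_measurable spd_lborel" for h \<alpha>
    by (subst nn_integral_divide[symmetric])
       (auto intro!: nn_integral_cong simp: Gg divide_ennreal_def mult_ac)
  have kern: "G.kern = kernel_C m C D a n y x"
    by (auto simp: fun_eq_iff G.kern_def G.step_def kernel_C_def param_lborel_def G.cS_def G.cA_def G.cB_def G.g_def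
        cond_Sigma_def cond_A_def cond_B_def post_A_Sigma_def)
  have stat: "G.stationary = posterior m C D a n y x"
    by (simp add: G.stationary_def posterior_def param_lborel_def)
  have "geom_bounded G.kern G.stationary (root 3 (1 - \<epsilon>))"
  proof (rule G.kern_geom_bounded[OF _ V _ _ _ _ N_meas \<epsilon>])
    show "U \<in> sets lborel" "N \<in> sets lborel" using U N by simp_all
    show "(\<integral>\<^sup>+\<alpha>. G.g \<alpha> S \<partial>lborel) \<le> 2 * (\<integral>\<^sup>+\<alpha>. G.g \<alpha> S * indicator U \<alpha> \<partial>lborel)" if "S \<in> space spd_lborel" for S
    proof -
      have S: "sym_pos_def S" using that by simp
      show ?thesis
        using divide_right_mono_ennreal[OF U_likely[OF S], of Z] GA[of "\<lambda>_. 1", OF _ S] GA[of "indicator U", OF _ S] U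
        by (simp add: ennreal_times_divide)
    qed
    show "(\<integral>\<^sup>+S. G.g \<alpha> S \<partial>spd_lborel) \<le> 2 * (\<integral>\<^sup>+S. G.g \<alpha> S * indicator V S \<partial>spd_lborel)" if "\<alpha> \<in> U" for \<alpha>
      using divide_right_mono_ennreal[OF V_likely[OF that], of Z] GS[of "\<lambda>_. 1" \<alpha>] GS[of "indicator V" \<alpha>] V
      by (simp add: ennreal_times_divide)
    show "c * (\<integral>\<^sup>+u. G.g u S \<partial>lborel) \<le> G.g \<alpha> S" if "S \<in> V" "\<alpha> \<in> N" for S \<alpha>
    proof -
      have S: "sym_pos_def S" using sets.sets_into_space[OF V] that by auto
      show ?thesis
        using divide_right_mono_ennreal[OF N_dense[OF that], of Z] GA[of "\<lambda>_. 1", OF _ S]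
        by (simp add: ennreal_times_divide Gg[OF S])
    qed
  qed
  from proper this G.geom_bounded_marginals[OF this]
  show ?thesis
    unfolding samplers_converge_def kern stat
    by (simp add: kernel_G_def[abs_def] kernel_A_def[abs_def] posterior_A_Sigma_def posterior_A_def
        G.cS_def[abs_def] G.cA_def[abs_def] G.g_def[abs_def] cond_Sigma_def[abs_def] cond_A_def[abs_def] post_A_Sigma_def[abs_def])
qed

end

lemma inner_add_self_le:
  fixes u v :: "'v::real_inner"
  shows "(u + v) \<bullet> (u + v) \<le> 2 * (u \<bullet> u) + 2 * (v \<bullet> v)"
  using inner_ge_zero[of "u - v"]
  by (simp add: inner_add_left inner_add_right inner_diff_left inner_diff_right inner_commute)

lemma eventually_exp_neg_le:
  fixes u v :: real
  assumes "0 < u" "0 < v"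
  obtains N :: nat where "\<And>n. N \<le> n \<Longrightarrow> u * exp (- real n) \<le> v"
proof -
  obtain N :: nat where N: "ln (u / v) \<le> real N" using real_arch_simple by blast
  have "u * exp (- real n) \<le> v" if "N \<le> n" for n
  proof -
    have "u / v = exp (ln (u / v))" using assms by simp
    also have "\<dots> \<le> exp (real n)" using N that by simp
    finally show ?thesis using assms by (simp add: exp_minus field_simps)
  qed
  then show ?thesis by (rule that)
qed

text \<open>
  The constants are chosen in the order \<open>R\<close>, \<open>L\<close>, \<open>Rv\<close>, \<open>\<epsilon>\<close>: the ellipsoid \<open>U\<close> depends on the hyperparameters
  and \<open>K\<close>, the exponent \<open>L\<close> of the lower bound on \<open>U\<close>, the size \<open>Rv\<close> of \<open>V\<close> on \<open>L\<close>, and \<open>\<epsilon>\<close> on \<open>V\<close>. None of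
  them depends on \<open>n\<close> or the data.
\<close>

theorem uniform_geometric_rate:
  fixes m :: "real^('r::finite \<times> ('q::{finite,linorder} \<times> 'r))"
    and C :: "real^('r \<times> ('q \<times> 'r))^('r \<times> ('q \<times> 'r))"
    and D :: "real^'r^'r"
    and a K :: real
    and P :: "'p::finite itself"
  assumes K: "1 \<le> K" and D: "sym_pos_semidef D" and a: "0 \<le> a" and C: "sym_pos_def C"
  obtains n0 :: nat and \<epsilon> :: real where "0 < \<epsilon>" "\<epsilon> < 1"
    "\<And>n y (x :: int \<Rightarrow> real^'p). n0 \<le> n \<Longrightarrow> design TYPE('q) n y x K \<Longrightarrow>
      samplers_converge m C D a n y x (root 3 (1 - \<epsilon>))"
proof -
  let ?r = "real CARD('r)"
  let ?E = "DIM(real^('r \<times> ('q \<times> 'r)))" and ?F = "DIM(real^'r^'p)"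
  let ?EF = "DIM((real^('r \<times> ('q \<times> 'r))) \<times> (real^'r^'p))"
  define kC where "kC = real CARD('r \<times> ('q \<times> 'r)) * trace C"
  have kC: "0 \<le> kC" unfolding kC_def using spd_entry_le_trace(3)[OF C] by simp
  have pen_upper: "penalty C u \<le> kC * (u \<bullet> u)" for u
    unfolding penalty_def kC_def by (rule form_le_trace[OF C])
  define W0 where "W0 = 2 * (kC * (?r * K\<^sup>2)) + 2 * penalty C m"
  have W0: "0 \<le> W0" using kC penalty_nonneg[OF C, of m] by (simp add: W0_def)
  \<comment> \<open>The smallest \<open>R\<close> that \<open>prior_weighted_mass\<close> admits when the offset is bounded by \<open>W0\<close>.\<close>
  define R where "R = 4 * ln (2 * 2 ^ ?EF * exp (3 / 4 * W0))"
  have expR: "exp (R / 4) = 2 * 2 ^ ?EF * exp (3 / 4 * W0)"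
    by (simp add: R_def)
  obtain c0 where c0: "0 < c0" "\<And>u. c0 * (u \<bullet> u) \<le> u \<bullet> (C *v u)"
    using sym_pos_def_coercive[OF C] by blast
  define A where "A = 2 * (\<bar>R\<bar> / c0) + 2 * (m \<bullet> m)"
  have A: "0 \<le> A" using c0 by (simp add: A_def)
  have U_bounded: "\<alpha> \<bullet> \<alpha> \<le> A" if "penalty C (\<alpha> - m) \<le> R" for \<alpha>
  proof -
    have "c0 * ((\<alpha> - m) \<bullet> (\<alpha> - m)) \<le> \<bar>R\<bar>" using c0(2)[of "\<alpha> - m"] that by (simp add: penalty_def)
    then have 1: "(\<alpha> - m) \<bullet> (\<alpha> - m) \<le> \<bar>R\<bar> / c0" using c0(1) by (simp add: field_simps)
    have "\<alpha> \<bullet> \<alpha> \<le> 2 * ((\<alpha> - m) \<bullet> (\<alpha> - m)) + 2 * (m \<bullet> m)"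
      using inner_add_self_le[of "\<alpha> - m" m] by simp
    with 1 show ?thesis by (simp add: A_def)
  qed
  obtain c c1 where c: "1 \<le> c" "1 \<le> c1" and upper:
    "\<And>n y (x :: int \<Rightarrow> real^'p) \<alpha> B (S :: real^'r^'r). design TYPE('q) n y x K \<Longrightarrow> a \<le> real n \<Longrightarrow>
      4 * (?F + 2 * CARD('r uprod)) \<le> n \<Longrightarrow> sym_pos_def S \<Longrightarrow>
      unnorm m C D a n y x \<alpha> B S \<le> (2 * pi) powr (- (real n * real CARD('r) / 2)) * (c1 * c ^ n * exp (- (real n / 4) * spread K S)) *
        (envelope B S * exp (- (1/2) * penalty C (\<alpha> - m)))"
    using unnorm_upper[OF K a D, where m = m and C = C and 'p = 'p] by metis
  obtain k where k: "1 \<le> k"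
    "0 < emeasure (spd_lborel :: (real^'r^'r) measure) {S. sym_pos_def S \<and> trace S \<le> k \<and> trace (matrix_inv S) \<le> k}"
    by (rule spd_trace_bounds_positive)
  obtain L where lower: "\<And>n y (x :: int \<Rightarrow> real^'p) \<alpha> B (S :: real^'r^'r). design TYPE('q) n y x K \<Longrightarrow> a \<le> real n \<Longrightarrow> sym_pos_def S \<Longrightarrow>
      trace S \<le> k \<Longrightarrow> trace (matrix_inv S) \<le> k \<Longrightarrow> \<alpha> \<bullet> \<alpha> \<le> A \<Longrightarrow> penalty C (\<alpha> - m) \<le> R \<Longrightarrow> B \<bullet> B \<le> 1 \<Longrightarrow>
      (2 * pi) powr (- (real n * real CARD('r) / 2)) * exp (- L * real n) \<le> unnorm m C D a n y x \<alpha> B S"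
    using unnorm_lower[OF K a D C k(1) A, where m = m and R = R and 'p = 'p] by metis
  \<comment> \<open>Then \<open>c^n exp (- n Rv / 4) = exp (- L n) exp (- n)\<close>, and the last factor beats all constants.\<close>
  define Rv where "Rv = 4 * (L + ln c + 1)"
  let ?Vk = "{S :: real^'r^'r. sym_pos_def S \<and> trace S \<le> k \<and> trace (matrix_inv S) \<le> k}"
  obtain v where v: "0 < v" "ennreal v \<le> emeasure (spd_lborel :: (real^'r^'r) measure) ?Vk"
  proof (cases "emeasure (spd_lborel :: (real^'r^'r) measure) ?Vk")
    case (real u)
    then show ?thesis using k(2) that[of u] by simp
  next
    case top
    then show ?thesis using that[of 1] by simp
  qed
  define ib where "ib = enn2real (\<integral>\<^sup>+B. ennreal (inverse ((1 + B \<bullet> B) ^ ?F)) \<partial>(lborel :: (real^'r^'p) measure))"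
  have ib: "(\<integral>\<^sup>+B. ennreal (inverse ((1 + B \<bullet> B) ^ ?F)) \<partial>(lborel :: (real^'r^'p) measure)) \<le> ennreal ib" "0 \<le> ib"
    unfolding ib_def using nn_integral_decay_finite[where 'a = "real^'r^'p"] by (simp_all add: ennreal_enn2real_if)
  define js where "js = enn2real (\<integral>\<^sup>+S. ennreal (inverse ((1 + trace S) ^ (2 * CARD('r uprod)))) \<partial>(spd_lborel :: (real^'r^'r) measure))"
  have js: "(\<integral>\<^sup>+S. ennreal (inverse ((1 + trace S) ^ (2 * CARD('r uprod)))) \<partial>(spd_lborel :: (real^'r^'r) measure)) \<le> ennreal js" "0 \<le> js"
    unfolding js_def using nn_integral_spd_decay_finite[where 'r = 'r] by (simp_all add: ennreal_enn2real_if)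
  have "0 < 2 * c1 * ib * js + 1" using c ib js by (simp add: add_nonneg_pos)
  moreover have "0 < unit_ball_vol ?F * v" using v unit_ball_vol_pos[of "real ?F"] by simp
  ultimately obtain n1 :: nat where n1: "\<And>n. n1 \<le> n \<Longrightarrow> (2 * c1 * ib * js + 1) * exp (- real n) \<le> unit_ball_vol ?F * v"
    using eventually_exp_neg_le by blast
  \<comment> \<open>On \<open>V\<close>, \<open>tr S \<le> exp Rv\<close> and \<open>tr S\<^sup>-\<^sup>1 \<le> K Rv\<close>.\<close>
  define k1 where "k1 = 1 / (K * ?r * exp Rv)"
  have k1: "0 < k1" using K by (simp add: k1_def)
  define k2 where "k2 = K * ?r * (K * \<bar>Rv\<bar>)"
  have k2: "0 \<le> k2" using K by (simp add: k2_def)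
  define G where "G = enn2real (\<integral>\<^sup>+(z :: (real^('r \<times> ('q \<times> 'r))) \<times> (real^'r^'p)). ennreal (exp (- (k1 / 2) * (z \<bullet> z))) \<partial>lborel) + 1"
  have G: "(\<integral>\<^sup>+(z :: (real^('r \<times> ('q \<times> 'r))) \<times> (real^'r^'p)). ennreal (exp (- (k1 / 2) * (z \<bullet> z))) \<partial>lborel) \<le> ennreal G" "0 < G"
  proof -
    let ?I = "\<integral>\<^sup>+(z :: (real^('r \<times> ('q \<times> 'r))) \<times> (real^'r^'p)). ennreal (exp (- (k1 / 2) * (z \<bullet> z))) \<partial>lborel"
    have "?I < \<infinity>" using k1 by (intro nn_integral_gaussian_finite) simp
    then have "?I = ennreal (enn2real ?I)" by (simp add: ennreal_enn2real_if)
    also have "\<dots> \<le> ennreal G" unfolding G_def by (intro ennreal_leI) simp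
    finally show "?I \<le> ennreal G" .
    show "0 < G" unfolding G_def by (simp add: add_nonneg_pos)
  qed
  define N1 where "N1 = 2 * kC + 2 * W0"
  define e0 where "e0 = exp (- N1 / 2 - k2) * unit_ball_vol ?F * unit_ball_vol ?E / G"
  have e0: "0 < e0" using G(2) unit_ball_vol_pos[of "real ?F"] unit_ball_vol_pos[of "real ?E"] by (simp add: e0_def)
  \<comment> \<open>The powers of \<open>n\<close> in the density and in the volume of the ball cancel to give \<open>e0\<close>.\<close>
  define \<epsilon> where "\<epsilon> = min (1/2) (e0 / 4)"
  have \<epsilon>: "0 < \<epsilon>" "\<epsilon> < 1" "4 * \<epsilon> \<le> e0" using e0 by (auto simp: \<epsilon>_def)
  define n0 where "n0 = max (max n1 (nat \<lceil>a\<rceil>)) (4 * (?F + 2 * CARD('r uprod)))"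
  have "samplers_converge m C D a n y x (root 3 (1 - \<epsilon>))"
    if n: "n0 \<le> n" and des: "design TYPE('q) n y x K" for n y and x :: "int \<Rightarrow> real^'p"
  proof -
    have nn: "n1 \<le> n" "a \<le> real n" "4 * (?F + 2 * CARD('r uprod)) \<le> n"
      using n by (simp_all add: n0_def)
    interpret V: var_posterior n y x K "TYPE('q)" m C D a
      by (intro var_posterior.intro var_posterior_axioms.intro des D a nn C)
    define p0 where "p0 = (2 * pi) powr (- (real n * real CARD('r) / 2))"
    have p0: "0 < p0" by (simp add: p0_def)
    define \<zeta> where "\<zeta> = p0 * (c1 * c ^ n)"
    have \<zeta>: "0 \<le> \<zeta>" using p0 c by (simp add: \<zeta>_def)
    have up: "unnorm m C D a n y x \<alpha> B S \<le> \<zeta> * exp (- (real n / 4) * spread K S) * (envelope B S * exp (- (1/2) * penalty C (\<alpha> - m)))"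
      if "sym_pos_def S" for \<alpha> B S
      using upper[OF des nn(2,3) that, of \<alpha> B] by (simp add: \<zeta>_def p0_def mult_ac)
    have spread_nonneg: "0 \<le> ln (1 + trace S)" "0 \<le> trace (matrix_inv S) / K" "0 \<le> spread K S" if "sym_pos_def S" for S :: "real^'r^'r"
      using spd_entry_le_trace(3)[OF that] spd_entry_le_trace(3)[OF sym_pos_def_matrix_inv[OF that]] K
      by (simp_all add: spread_def)
    have up': "unnorm m C D a n y x \<alpha> B S \<le> \<zeta> * (envelope B S * exp (- (1/2) * penalty C (\<alpha> - m)))"
      if S: "sym_pos_def S" for \<alpha> B S
    proof -
      have "\<zeta> * exp (- (real n / 4) * spread K S) \<le> \<zeta> * 1"
        using \<zeta> spread_nonneg(3)[OF S] by (intro mult_left_mono) auto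
      then have "\<zeta> * exp (- (real n / 4) * spread K S) * (envelope B S * exp (- (1/2) * penalty C (\<alpha> - m))) \<le>
          \<zeta> * 1 * (envelope B S * exp (- (1/2) * penalty C (\<alpha> - m)))"
        using spd_entry_le_trace(3)[OF S] by (intro mult_right_mono) (auto simp: envelope_def)
      with up[OF S, of \<alpha> B] show ?thesis by simp
    qed
    have g_fin: "V.W.g \<alpha> S < \<infinity>" if "sym_pos_def S" for \<alpha> S
      by (rule V.finiteness(1)[OF \<zeta> _ that]) (rule up')
    have gS_fin: "(\<integral>\<^sup>+S. V.W.g \<alpha> S \<partial>spd_lborel) < \<infinity>" for \<alpha>
      by (rule V.finiteness(2)[OF \<zeta>]) (rule up')
    have gA_fin: "(\<integral>\<^sup>+\<alpha>. V.W.g \<alpha> S \<partial>lborel) < \<infinity>" if "sym_pos_def S" for S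
      by (rule V.finiteness(3)[OF \<zeta> _ that]) (rule up')
    have total_fin: "(\<integral>\<^sup>+z. (case z of (\<alpha>, B, S) \<Rightarrow> V.w \<alpha> B S) \<partial>V.W.joint) < \<infinity>"
      by (rule V.finiteness(4)[OF \<zeta>]) (rule up')
    obtain zh where zh: "fst zh \<bullet> fst zh \<le> ?r * K\<^sup>2"
      "\<And>S. sym_pos_def S \<Longrightarrow> \<exists>\<kappa>>0. \<forall>\<alpha> B. unnorm m C D a n y x \<alpha> B S =
      \<kappa> * (exp (- (1/2) * penalty C (\<alpha> - m)) * exp (- (1/2) * V.fit S ((\<alpha>, B) - zh)))"
      using V.split_at_least_squares by metis
    have pen_zh: "penalty C (fst zh - m) \<le> W0"
    proof -
      have "penalty C (fst zh - m) \<le> 2 * penalty C (fst zh) + 2 * penalty C m" by (rule penalty_diff_le[OF C])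
      also have "penalty C (fst zh) \<le> kC * (?r * K\<^sup>2)"
        using pen_upper[of "fst zh"] mult_left_mono[OF zh(1) kC] by simp
      finally show ?thesis by (simp add: W0_def)
    qed
    let ?U = "{\<alpha>. penalty C (\<alpha> - m) \<le> R}"
    let ?V = "{S :: real^'r^'r. sym_pos_def S \<and> spread K S \<le> Rv}"
    let ?N = "ball (fst zh) (1 / sqrt n)"
    have n_pos: "0 < real n" using V.n by simp
    have U_likely: "(\<integral>\<^sup>+\<alpha>. V.W.g \<alpha> S \<partial>lborel) \<le> 2 * (\<integral>\<^sup>+\<alpha>. V.W.g \<alpha> S * indicator ?U \<alpha> \<partial>lborel)" if S: "sym_pos_def S" for S
    proof (rule V.prior_ball_likely[OF S gA_fin[OF S] zh(2)[OF S]])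
      show "2 * 2 ^ ?EF * exp (3 / 4 * penalty C (fst zh - m)) \<le> exp (R / 4)"
        unfolding expR using pen_zh by (intro mult_left_mono) auto
    qed
    have V_likely: "(\<integral>\<^sup>+S. V.W.g \<alpha> S \<partial>spd_lborel) \<le> 2 * (\<integral>\<^sup>+S. V.W.g \<alpha> S * indicator ?V S \<partial>spd_lborel)" if \<alpha>: "\<alpha> \<in> ?U" for \<alpha>
    proof (rule V.covariance_likely[OF up _ v(2) _ ib js \<zeta> _ _ gS_fin])
      show "p0 * exp (- L * real n) \<le> unnorm m C D a n y x \<alpha> B S"
        if "sym_pos_def S" "trace S \<le> k" "trace (matrix_inv S) \<le> k" "B \<bullet> B \<le> 1" for B S
        unfolding p0_def using \<alpha> by (intro lower[OF des nn(2)] that U_bounded) auto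
      have eq: "c ^ n * exp (- (real n / 4) * Rv) = exp (- L * real n) * exp (- real n)"
      proof -
        have "c ^ n = exp (real n * ln c)" using c by (simp add: exp_of_nat_mult)
        then show ?thesis by (simp add: Rv_def algebra_simps flip: exp_add)
      qed
      have "2 * (\<zeta> * exp (- (real n / 4) * Rv) * ib * js) = p0 * (c ^ n * exp (- (real n / 4) * Rv)) * (2 * c1 * ib * js)"
        by (simp add: \<zeta>_def mult_ac)
      also have "\<dots> = p0 * exp (- L * real n) * (2 * c1 * ib * js * exp (- real n))"
        unfolding eq by (simp add: mult_ac)
      also have "\<dots> \<le> p0 * exp (- L * real n) * (unit_ball_vol ?F * v)"
      proof (rule mult_left_mono)
        have "2 * c1 * ib * js * exp (- real n) \<le> (2 * c1 * ib * js + 1) * exp (- real n)"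
          by (intro mult_right_mono) auto
        with n1[OF nn(1)] show "2 * c1 * ib * js * exp (- real n) \<le> unit_ball_vol ?F * v" by linarith
      qed (use p0 in simp)
      finally show "2 * (\<zeta> * exp (- (real n / 4) * Rv) * ib * js) \<le> p0 * exp (- L * real n) * unit_ball_vol ?F * v"
        by (simp add: mult_ac)
    qed (use v p0 in auto)
    let ?c = "ennreal (exp (- N1 / 2 - k2) * unit_ball_vol ?F * sqrt n ^ ?E / G)"
    have N_dense: "?c * (\<integral>\<^sup>+u. V.W.g u S \<partial>lborel) \<le> V.W.g \<alpha> S" if S: "S \<in> ?V" and \<alpha>: "\<alpha> \<in> ?N" for S \<alpha>
    proof (rule V.neighbourhood_density[OF _ zh(2) k1 k2 _ _ _ _ G])
      show S': "sym_pos_def S" "sym_pos_def S" using S by auto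
      have "ln (1 + trace S) \<le> Rv" "trace (matrix_inv S) / K \<le> Rv"
        using S spread_nonneg[OF S'(1)] by (auto simp: spread_def)
      then have "1 + trace S \<le> exp Rv" and t1: "trace (matrix_inv S) \<le> K * Rv"
        using spd_entry_le_trace(3)[OF S'(1)] K ln_le_cancel_iff[of "1 + trace S" "exp Rv"]
        by (auto simp: field_simps)
      moreover have "K * Rv \<le> K * \<bar>Rv\<bar>" using K by (intro mult_left_mono) auto
      ultimately have "trace S \<le> exp Rv" and t2: "trace (matrix_inv S) \<le> K * \<bar>Rv\<bar>" by linarith+
      then have "K * ?r * trace S \<le> K * ?r * exp Rv" using K by (intro mult_left_mono) auto
      then show "K * ?r * trace S \<le> 1 / k1" by (simp add: k1_def)
      show "K * ?r * trace (matrix_inv S) \<le> k2"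
        unfolding k2_def using t2 K by (intro mult_left_mono) auto
      show near: "norm (\<alpha> - fst zh) < 1 / sqrt n" using \<alpha> by (simp add: dist_norm norm_minus_commute)
      show "penalty C (\<alpha> - m) \<le> N1"
      proof -
        have "1 / sqrt n \<le> 1" using V.n by simp
        then have "(norm (\<alpha> - fst zh))\<^sup>2 \<le> 1" using near by (simp add: abs_square_le_1)
        then have "kC * ((\<alpha> - fst zh) \<bullet> (\<alpha> - fst zh)) \<le> kC * 1"
          using kC by (intro mult_left_mono) (simp_all add: dot_square_norm)
        then have "penalty C (\<alpha> - fst zh) \<le> kC" using pen_upper[of "\<alpha> - fst zh"] by simp
        moreover have "penalty C (\<alpha> - m) \<le> 2 * penalty C (\<alpha> - fst zh) + 2 * penalty C (fst zh - m)"
          using penalty_add_le[OF C, of "\<alpha> - fst zh" "fst zh - m"] by simp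
        ultimately show ?thesis using pen_zh by (simp add: N1_def)
      qed
    qed
    have ballN: "emeasure lborel ?N = ennreal (unit_ball_vol ?E * (1 / sqrt n) ^ ?E)"
      using n_pos by (intro emeasure_ball) simp
    have "ennreal (4 * \<epsilon>) \<le> ennreal e0" by (intro ennreal_leI \<epsilon>)
    also have "e0 = (exp (- N1 / 2 - k2) * unit_ball_vol ?F * sqrt n ^ ?E / G) * (unit_ball_vol ?E * (1 / sqrt n) ^ ?E)"
    proof -
      have "sqrt n ^ ?E * (1 / sqrt n) ^ ?E = 1" using n_pos by (simp flip: power_mult_distrib)
      then show ?thesis by (simp add: e0_def mult_ac)
    qed
    also have "ennreal \<dots> = ?c * emeasure lborel ?N"
      unfolding ballN using G(2) unit_ball_vol_pos[of "real ?F"] n_pos by (intro ennreal_mult) auto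
    finally have eps: "4 * ennreal \<epsilon> \<le> ?c * emeasure lborel ?N" using \<epsilon> by (simp add: ennreal_mult)
    have "{S \<in> space spd_lborel. spread K S \<le> Rv} \<in> sets (spd_lborel :: (real^'r^'r) measure)"
      by measurable
    then have V_meas: "?V \<in> sets spd_lborel" by simp
    have U_meas: "?U \<in> sets borel" by measurable
    have N_meas: "0 < emeasure lborel ?N" "emeasure lborel ?N < \<infinity>"
      unfolding ballN using n_pos unit_ball_vol_pos[of "real ?E"] by auto
    show ?thesis
      by (rule V.kernels_geom_bounded[OF g_fin gS_fin gA_fin total_fin U_meas V_meas borel_open[OF open_ball] U_likely V_likely N_dense N_meas eps
        less_imp_le[OF \<epsilon>(1)] \<epsilon>(2)])
  qed
  with \<epsilon>(1,2) show ?thesis by (rule that)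
qed

section \<open>From the spectrum of the Gram matrix to the samplers\<close>

text \<open>
  The infimum defining the rate is taken over a subset of \<open>[0, 1]\<close>, which could be empty for a
  degenerate posterior; the infimum of the empty set is an unspecified real number.
\<close>

lemma geom_rate_le_default: "geom_rate K \<pi> \<le> max 1 (Inf {})"
proof -
  let ?A = "{\<rho> \<in> {0..1}. \<exists>M :: 'a \<Rightarrow> real. \<forall>x\<in>space \<pi>. 0 \<le> M x \<and>
     (\<forall>h\<ge>1. tv_dist (kernel_pow K h x) \<pi> \<le> M x * \<rho> ^ h)}"
  show ?thesis
  proof (cases "?A = {}")
    case True
    then show ?thesis unfolding geom_rate_def True by simp
  next
    case False
    then obtain \<rho> where \<rho>: "\<rho> \<in> ?A" by blast
    have "Inf ?A \<le> \<rho>" by (rule cInf_lower[OF \<rho>]) (auto intro!: bdd_belowI[of _ 0])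
    also have "\<rho> \<le> 1" using \<rho> by simp
    finally show ?thesis unfolding geom_rate_def by simp
  qed
qed

text \<open>
  The bounds \<open>\<rho>\<^sub>n\<close> are \<open>c\<close> on the good event and the constant of \<open>geom_rate_le_default\<close>, which is at least 1,
  off it.
\<close>

lemma asymp_geom_ergodic_asI:
  assumes good: "\<And>n. {\<omega> \<in> space P. good n \<omega>} \<in> sets P" and c: "c < 1"
    and rate: "\<And>n \<omega>. good n \<omega> \<Longrightarrow> proper n \<omega> \<and> geom_rate (K n \<omega>) (\<pi> n \<omega>) \<le> c"
    and ev: "AE \<omega> in P. eventually (\<lambda>n. good n \<omega>) sequentially"
  shows "asymp_geom_ergodic_as P k proper K \<pi>"
  unfolding asymp_geom_ergodic_as_def
proof (intro exI conjI allI impI ballI)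
  let ?\<rho> = "\<lambda>n \<omega>. if good n \<omega> then c else max 1 (Inf {})"
  show "?\<rho> n \<in> borel_measurable P" for n
    using good[of n] by (intro measurable_If) auto
  show "(if proper n \<omega> then geom_rate (K n \<omega>) (\<pi> n \<omega>) else 1) \<le> ?\<rho> n \<omega>" for n \<omega>
    using rate[of n \<omega>] geom_rate_le_default[of "K n \<omega>" "\<pi> n \<omega>"] by auto
  show "AE \<omega> in P. limsup (\<lambda>n. ereal (?\<rho> n \<omega>)) < 1"
    using ev
  proof eventually_elim
    case (elim \<omega>)
    then have "eventually (\<lambda>n. ereal (?\<rho> n \<omega>) = ereal c) sequentially"
      by eventually_elim simp
    then have "limsup (\<lambda>n. ereal (?\<rho> n \<omega>)) = limsup (\<lambda>n::nat. ereal c)"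
      by (rule Limsup_eq)
    then show ?case using c by (simp add: Limsup_const one_ereal_def)
  qed
qed

lemma S_W_form: "\<xi> \<bullet> (S_W n y x *v \<xi>) = (\<Sum>t=1..int n. (data_row y x t \<bullet> \<xi>)\<^sup>2) / real n"
proof -
  have "\<xi> \<bullet> (gram n (data_row y x) *v \<xi>) =
      (\<Sum>i\<in>UNIV. \<Sum>j\<in>UNIV. \<Sum>t=1..int n. (data_row y x t $ i * \<xi> $ i) * (data_row y x t $ j * \<xi> $ j))"
    by (simp add: inner_vec_def matrix_vector_mult_def gram_def sum_distrib_left sum_distrib_right mult_ac)
  also have "\<dots> = (\<Sum>t=1..int n. \<Sum>i\<in>UNIV. \<Sum>j\<in>UNIV. (data_row y x t $ i * \<xi> $ i) * (data_row y x t $ j * \<xi> $ j))"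
    by (subst sum.swap[of _ UNIV "{1..int n}"], subst (2) sum.swap, rule refl)
  also have "\<dots> = (\<Sum>t=1..int n. (data_row y x t \<bullet> \<xi>)\<^sup>2)"
    by (simp add: inner_vec_def power2_eq_square sum_product)
  finally show ?thesis
    by (simp add: S_W_def scaleR_matrix_vector_assoc[symmetric])
qed

lemma S_W_symmetric: "transpose (S_W n y x) = S_W n y x"
  by (simp add: S_W_def transpose_def gram_def vec_eq_iff mult.commute)

text \<open>
  The form of the Gram matrix at \<open>\<xi>\<close> is \<open>|W \<xi>|^2 / n\<close>.
\<close>

lemma designI:
  fixes y :: "int \<Rightarrow> real^'r" and x :: "int \<Rightarrow> real^'p"
  assumes K: "1 \<le> K" and n: "1 \<le> n"
    and S: "\<And>\<xi> :: real^('r + ('q::{finite,linorder} \<times> 'r) + 'p).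
      1 / K * (\<xi> \<bullet> \<xi>) \<le> \<xi> \<bullet> (S_W n y x *v \<xi>) \<and> \<xi> \<bullet> (S_W n y x *v \<xi>) \<le> K * (\<xi> \<bullet> \<xi>)"
  shows "design TYPE('q) n y x K"
proof
  fix \<xi> :: "real^('r + ('q \<times> 'r) + 'p)"
  have n0: "0 < real n" using n by simp
  show "real n / K * (\<xi> \<bullet> \<xi>) \<le> (\<Sum>t=1..int n. (data_row y x t \<bullet> \<xi>)\<^sup>2)"
    using mult_left_mono[OF conjunct1[OF S[of \<xi>]], of "real n"] n0 by (simp add: S_W_form)
  show "(\<Sum>t=1..int n. (data_row y x t \<bullet> \<xi>)\<^sup>2) \<le> K * real n * (\<xi> \<bullet> \<xi>)"
    using mult_left_mono[OF conjunct2[OF S[of \<xi>]], of "real n"] n0 by (simp add: S_W_form mult_ac)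
qed (use K n in auto)

lemma vec_nth_measurable: "f \<in> P \<rightarrow>\<^sub>M borel \<Longrightarrow> (\<lambda>\<omega>. f \<omega> $ i) \<in> borel_measurable P" for f :: "'w \<Rightarrow> real^'k"
  by (rule measurable_compose[of _ _ borel]) (auto intro!: borel_measurable_continuous_onI continuous_intros)

lemma lag_bounds: "1 \<le> lag l" "lag (l :: 'q::{finite,linorder}) \<le> CARD('q)"
  using bij_betw_lag[where 'q = 'q] by (auto simp: bij_betw_def)

lemma S_W_measurable:
  fixes Y :: "int \<Rightarrow> 'w \<Rightarrow> real^'r" and X :: "int \<Rightarrow> 'w \<Rightarrow> real^'p"
  assumes Y: "\<And>t. 1 \<le> t \<Longrightarrow> Y t \<in> borel_measurable P"
    and X: "\<And>t. 1 \<le> t \<Longrightarrow> X t \<in> borel_measurable P"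
    and y0: "\<And>t \<omega>. - int CARD('q) + 1 \<le> t \<Longrightarrow> t \<le> 0 \<Longrightarrow> \<omega> \<in> space P \<Longrightarrow> Y t \<omega> = y0 t"
  shows "(\<lambda>\<omega>. S_W n (\<lambda>t. Y t \<omega>) (\<lambda>t. X t \<omega>) :: real^('r + ('q::{finite,linorder} \<times> 'r) + 'p)^('r + ('q \<times> 'r) + 'p)) \<in> P \<rightarrow>\<^sub>M borel"
proof -
  have Y': "Y t \<in> borel_measurable P" if "- int CARD('q) + 1 \<le> t" for t
  proof (cases "1 \<le> t")
    case False
    then show ?thesis using y0[OF that] by (subst measurable_cong[where g = "\<lambda>_. y0 t"]) auto
  qed (rule Y)
  have row[measurable]: "(\<lambda>\<omega>. (data_row (\<lambda>t. Y t \<omega>) (\<lambda>t. X t \<omega>) t :: real^('r + ('q \<times> 'r) + 'p)) $ s) \<in> borel_measurable P"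
    if t: "1 \<le> t" for t s
  proof -
    consider i where "s = Inl i" | l j where "s = Inr (Inl (l, j))" | i where "s = Inr (Inr i)"
      by (metis sum.exhaust surj_pair)
    then show ?thesis
    proof cases
      case 2
      \<comment> \<open>Lags reach back to time \<open>- q + 1\<close> at most, and from there to time \<open>0\<close> the path is deterministic.\<close>
      have "- int CARD('q) + 1 \<le> t - int (lag l)" using lag_bounds[of l] t by linarith
      then show ?thesis using 2 by (simp add: data_row_def lags_def vec_nth_measurable Y')
    qed (use t in \<open>simp_all add: data_row_def vec_nth_measurable Y X\<close>)
  qed
  show ?thesis
  proof (rule borel_measurable_euclidean_space[THEN iffD2], rule ballI)
    fix b :: "real^('r + ('q \<times> 'r) + 'p)^('r + ('q \<times> 'r) + 'p)" assume "b \<in> Basis"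
    then obtain i j where b: "b = axis i (axis j 1)" by (auto simp: Basis_vec_def)
    have "(\<lambda>\<omega>. S_W n (\<lambda>t. Y t \<omega>) (\<lambda>t. X t \<omega>) \<bullet> b) = (\<lambda>\<omega>. 1 / real n *
      (\<Sum>t=1..int n. (data_row (\<lambda>t. Y t \<omega>) (\<lambda>t. X t \<omega>) t :: real^('r + ('q \<times> 'r) + 'p)) $ i *
        (data_row (\<lambda>t. Y t \<omega>) (\<lambda>t. X t \<omega>) t :: real^('r + ('q \<times> 'r) + 'p)) $ j))"
      by (simp add: b inner_axis S_W_def gram_def)
    also have "\<dots> \<in> borel_measurable P"
      by (intro borel_measurable_times borel_measurable_const borel_measurable_sum row) auto
    finally show "(\<lambda>\<omega>. S_W n (\<lambda>t. Y t \<omega>) (\<lambda>t. X t \<omega>) \<bullet> b) \<in> borel_measurable P" .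
  qed
qed

text \<open>
  The bounds for each fixed \<open>\<xi>\<close> define a closed set, so the good event is the preimage of a closed set.
\<close>

lemma closed_form_bounds:
  "closed {S :: real^'k^'k. \<forall>\<xi>. l * (\<xi> \<bullet> \<xi>) \<le> \<xi> \<bullet> (S *v \<xi>) \<and> \<xi> \<bullet> (S *v \<xi>) \<le> u * (\<xi> \<bullet> \<xi>)}"
proof -
  have "{S :: real^'k^'k. \<forall>\<xi>. l * (\<xi> \<bullet> \<xi>) \<le> \<xi> \<bullet> (S *v \<xi>) \<and> \<xi> \<bullet> (S *v \<xi>) \<le> u * (\<xi> \<bullet> \<xi>)} =
      (\<Inter>\<xi>. {S. l * (\<xi> \<bullet> \<xi>) \<le> \<xi> \<bullet> (S *v \<xi>)} \<inter> {S. \<xi> \<bullet> (S *v \<xi>) \<le> u * (\<xi> \<bullet> \<xi>)})"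
    by auto
  also have "closed \<dots>"
    by (intro closed_INT closed_Int ballI closed_Collect_le continuous_intros)
  finally show ?thesis .
qed

theorem theorem5p3:
  fixes P :: "'w measure"
    and Y :: "int \<Rightarrow> 'w \<Rightarrow> real^'r"
    and X :: "int \<Rightarrow> 'w \<Rightarrow> real^'p"
    and y0 :: "int \<Rightarrow> real^'r"
    and m :: "real^('r \<times> ('q::{finite,linorder} \<times> 'r))"
    and C :: "real^('r \<times> ('q \<times> 'r))^('r \<times> ('q \<times> 'r))"
    and D :: "real^'r^'r"
    and a M :: real
  assumes "prob_space P"
    and "\<And>t. 1 \<le> t \<Longrightarrow> Y t \<in> borel_measurable P"
    and "\<And>t. 1 \<le> t \<Longrightarrow> X t \<in> borel_measurable P"
    and "\<And>t \<omega>. - int CARD('q) + 1 \<le> t \<Longrightarrow> t \<le> 0 \<Longrightarrow> \<omega> \<in> space P \<Longrightarrow> Y t \<omega> = y0 t"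
    and "sym_pos_semidef D"
    and "0 \<le> a"
    and "sym_pos_def C"
    and "0 < M"
    and "AE \<omega> in P.
      let S = (\<lambda>n. S_W n (\<lambda>t. Y t \<omega>) (\<lambda>t. X t \<omega>)
                 :: real^('r + ('q \<times> 'r) + 'p)^('r + ('q \<times> 'r) + 'p))
      in ereal (1 / M) \<le> liminf (\<lambda>n. ereal (gamma_min (S n)))
         \<and> liminf (\<lambda>n. ereal (gamma_min (S n))) \<le> limsup (\<lambda>n. ereal (gamma_max (S n)))
         \<and> limsup (\<lambda>n. ereal (gamma_max (S n))) \<le> ereal M"
  shows "asymp_geom_ergodic_as P CARD('p)
           (\<lambda>n \<omega>. posterior_proper m C D a n (\<lambda>t. Y t \<omega>) (\<lambda>t. X t \<omega>))
           (\<lambda>n \<omega>. kernel_C m C D a n (\<lambda>t. Y t \<omega>) (\<lambda>t. X t \<omega>))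
           (\<lambda>n \<omega>. posterior m C D a n (\<lambda>t. Y t \<omega>) (\<lambda>t. X t \<omega>))
    \<and> asymp_geom_ergodic_as P CARD('p)
           (\<lambda>n \<omega>. posterior_proper m C D a n (\<lambda>t. Y t \<omega>) (\<lambda>t. X t \<omega>))
           (\<lambda>n \<omega>. kernel_G m C D a n (\<lambda>t. Y t \<omega>) (\<lambda>t. X t \<omega>))
           (\<lambda>n \<omega>. posterior_A_Sigma m C D a n (\<lambda>t. Y t \<omega>) (\<lambda>t. X t \<omega>))
    \<and> asymp_geom_ergodic_as P CARD('p)
           (\<lambda>n \<omega>. posterior_proper m C D a n (\<lambda>t. Y t \<omega>) (\<lambda>t. X t \<omega>))
           (\<lambda>n \<omega>. kernel_A m C D a n (\<lambda>t. Y t \<omega>) (\<lambda>t. X t \<omega>))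
           (\<lambda>n \<omega>. posterior_A m C D a n (\<lambda>t. Y t \<omega>) (\<lambda>t. X t \<omega>))"
proof -
  \<comment> \<open>The factor 2 turns the bounds on the limits into strict bounds for all large \<open>n\<close>.\<close>
  define K where "K = max 1 (2 * M)"
  have K: "1 \<le> K" "2 * M \<le> K" by (auto simp: K_def)
  obtain n0 :: nat and \<epsilon> where \<epsilon>: "0 < \<epsilon>" "\<epsilon> < 1" and unif:
    "\<And>n y (x :: int \<Rightarrow> real^'p). n0 \<le> n \<Longrightarrow> design TYPE('q) n y x K \<Longrightarrow>
      samplers_converge m C D a n y x (root 3 (1 - \<epsilon>))"
    using uniform_geometric_rate[OF K(1) assms(5,6,7), where 'p = 'p] by metis
  let ?S = "\<lambda>n \<omega>. S_W n (\<lambda>t. Y t \<omega>) (\<lambda>t. X t \<omega>) :: real^('r + ('q \<times> 'r) + 'p)^('r + ('q \<times> 'r) + 'p)"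
  let ?F = "{S :: real^('r + ('q \<times> 'r) + 'p)^('r + ('q \<times> 'r) + 'p).
      \<forall>\<xi>. 1 / K * (\<xi> \<bullet> \<xi>) \<le> \<xi> \<bullet> (S *v \<xi>) \<and> \<xi> \<bullet> (S *v \<xi>) \<le> K * (\<xi> \<bullet> \<xi>)}"
  define good where "good n \<omega> \<longleftrightarrow> max 1 n0 \<le> n \<and> ?S n \<omega> \<in> ?F" for n \<omega>
  have meas: "{\<omega> \<in> space P. good n \<omega>} \<in> sets P" for n
  proof -
    have "?S n -` ?F \<inter> space P \<in> sets P"
      by (rule measurable_sets[OF S_W_measurable[OF assms(2,3,4)] borel_closed[OF closed_form_bounds]])
    moreover have "{\<omega> \<in> space P. good n \<omega>} = (if max 1 n0 \<le> n then ?S n -` ?F \<inter> space P else {})"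
      by (auto simp: good_def)
    ultimately show ?thesis by simp
  qed
  have ev: "AE \<omega> in P. eventually (\<lambda>n. good n \<omega>) sequentially"
    using assms(9)
  proof eventually_elim
    case (elim \<omega>)
    then have lo: "ereal (1 / M) \<le> liminf (\<lambda>n. ereal (gamma_min (?S n \<omega>)))"
      and hi: "limsup (\<lambda>n. ereal (gamma_max (?S n \<omega>))) \<le> ereal M"
      by (simp_all add: Let_def)
    have "ereal (1 / (2 * M)) < liminf (\<lambda>n. ereal (gamma_min (?S n \<omega>)))"
      by (rule less_le_trans[OF _ lo]) (use \<open>0 < M\<close> in \<open>simp add: field_simps\<close>)
    then have 1: "eventually (\<lambda>n. ereal (1 / (2 * M)) < ereal (gamma_min (?S n \<omega>))) sequentially"
      by (rule less_LiminfD)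
    have "limsup (\<lambda>n. ereal (gamma_max (?S n \<omega>))) < ereal (2 * M)"
      by (rule le_less_trans[OF hi]) (use \<open>0 < M\<close> in simp)
    then have 2: "eventually (\<lambda>n. ereal (gamma_max (?S n \<omega>)) < ereal (2 * M)) sequentially"
      by (rule Limsup_lessD)
    show ?case
      using 1 2 eventually_ge_at_top[of "max 1 n0"]
    proof eventually_elim
      case (elim n)
      have "1 / K \<le> 1 / (2 * M)" using K \<open>0 < M\<close> by (intro divide_left_mono) auto
      with elim(1) have lo: "1 / K \<le> gamma_min (?S n \<omega>)" by simp
      from elim(2) K have hi: "gamma_max (?S n \<omega>) \<le> K" by simp
      have "?S n \<omega> \<in> ?F"
      proof (intro CollectI allI conjI)
        fix \<xi> :: "real^('r + ('q \<times> 'r) + 'p)"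
        show "1 / K * (\<xi> \<bullet> \<xi>) \<le> \<xi> \<bullet> (?S n \<omega> *v \<xi>)"
          using mult_right_mono[OF lo inner_ge_zero[of \<xi>]] gamma_min_le_form[OF S_W_symmetric, of n _ _ \<xi>]
          by (rule order_trans)
        show "\<xi> \<bullet> (?S n \<omega> *v \<xi>) \<le> K * (\<xi> \<bullet> \<xi>)"
          using form_le_gamma_max[OF S_W_symmetric, of \<xi> n] mult_right_mono[OF hi inner_ge_zero[of \<xi>]]
          by (rule order_trans)
      qed
      then show ?case using elim(3) by (simp add: good_def)
    qed
  qed
  have c: "root 3 (1 - \<epsilon>) < 1" "0 \<le> root 3 (1 - \<epsilon>)" "root 3 (1 - \<epsilon>) \<le> 1"
    using \<epsilon> by auto
  have des: "design TYPE('q) n (\<lambda>t. Y t \<omega>) (\<lambda>t. X t \<omega>) K" "n0 \<le> n" if "good n \<omega>" for n \<omega>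
    using that K by (auto simp: good_def intro!: designI)
  show ?thesis
    using unif[OF des(2,1)] unfolding samplers_converge_def by (intro conjI asymp_geom_ergodic_asI[OF meas c(1) _ ev] geom_rate_le[OF _ c(2,3)]) auto
qed

end
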